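(* Let $G\curvearrowright(B,\nu)$ be a $\mu$-stationary, essentially free extension of the Poisson boundary $\Pi(G,\mu)$, and let $\mathbb{X}=\{0,1\}^{\mathbb N}$ be the Cantor space. Then the set of measures $\eta\in\mathcal{P}_\mu(\mathbb{X}^G)$ such that $G\curvearrowright(\mathbb{X}^G,\eta)$ is measurably conjugate to $G\curvearrowright(B,\nu)$ is dense in $\mathcal{P}_\mu(\mathbb{X}^G)$.
   Context: $G$ is a countably infinite discrete group, $\mu$ a probability measure on $G$ whose support generates $G$ as a semigroup. $\mathbb X$ carries the product topology, $G$ acts on $\mathbb X^G$ by $(gx)(k)=x(g^{-1}k)$, and $\mathcal{P}_\mu(\mathbb X^G)$ is the set of Borel probability measures $\eta$ with $\sum_g\mu(g)g_*\eta=\eta$, weak* topology. The Poisson boundary $\Pi(G,\mu)=(B_0,\beta)$ is the Mackey realization of the shift-invariant $\sigma$-algebra of the random walk $(g_1,g_1g_2,\dots)$ with i.i.d. $\mu$-increments. An extension of it is an action with a $G$-equivariant measurable map to $B_0$ pushing the measure to $\beta$. Essentially free: every $g\ne e$ has null fixed-point set. Measurably conjugate: there is a $G$-equivariant measure-space isomorphism mod null sets. *)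

theory Defs
  imports "HOL-Probability.Probability"
begin

(* G is modelled as a type 'g of class group_add (written additively; not assumed
   commutative).  The group identity is 0, the product g h is g + h, g^{-1} is - g. *)

inductive_set semigroup_gen :: "'g::group_add set \<Rightarrow> 'g set" for S where
  base: "s \<in> S \<Longrightarrow> s \<in> semigroup_gen S"
| mult: "a \<in> semigroup_gen S \<Longrightarrow> b \<in> semigroup_gen S \<Longrightarrow> a + b \<in> semigroup_gen S"

definition measurable_action :: "'b measure \<Rightarrow> ('g::group_add \<Rightarrow> 'b \<Rightarrow> 'b) \<Rightarrow> bool" where
  "measurable_action M a \<longleftrightarrow>
     (\<forall>g. a g \<in> measurable M M) \<and>
     (\<forall>x\<in>space M. a 0 x = x) \<and>
     (\<forall>g h. \<forall>x\<in>space M. a (g + h) x = a g (a h x))"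

definition stationary :: "'g pmf \<Rightarrow> 'b measure \<Rightarrow> ('g \<Rightarrow> 'b \<Rightarrow> 'b) \<Rightarrow> bool" where
  "stationary \<mu> M a \<longleftrightarrow>
     (\<forall>A\<in>sets M. emeasure M A =
        (\<integral>\<^sup>+ g. emeasure M {x \<in> space M. a g x \<in> A} \<partial>measure_pmf \<mu>))"

definition shift_act :: "'g::group_add \<Rightarrow> ('g \<Rightarrow> 'x) \<Rightarrow> ('g \<Rightarrow> 'x)" where
  "shift_act g x = (\<lambda>k. x (- g + k))"

(* Cantor space X = {0,1}^N with the product topology; X^G with the product topology *)
type_synonym ('g) cantor_pow = "'g \<Rightarrow> nat \<Rightarrow> bool"

definition stationary_measures :: "'g::group_add pmf \<Rightarrow> ('g cantor_pow) measure set" where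
  "stationary_measures \<mu> =
     {\<eta>. sets \<eta> = sets borel \<and> prob_space \<eta> \<and> stationary \<mu> \<eta> shift_act}"

(* density in the weak* topology, stated through the basic weak* neighbourhoods
   {eta'. |int f_i d eta' - int f_i d eta| < eps, i = 1..k} with f_i continuous *)
definition weak_star_dense_in ::
  "('a::topological_space) measure set \<Rightarrow> 'a measure set \<Rightarrow> bool" where
  "weak_star_dense_in S P \<longleftrightarrow>
     (\<forall>\<eta>\<in>P. \<forall>F :: ('a \<Rightarrow> real) set. \<forall>\<epsilon>::real.
        finite F \<longrightarrow> (\<forall>f\<in>F. continuous_on UNIV f) \<longrightarrow> \<epsilon> > 0 \<longrightarrow>
        (\<exists>\<eta>'\<in>S. \<forall>f\<in>F. \<bar>(\<integral>x. f x \<partial>\<eta>') - (\<integral>x. f x \<partial>\<eta>)\<bar> < \<epsilon>))"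

definition paths :: "(nat \<Rightarrow> 'g) measure" where
  "paths = PiM UNIV (\<lambda>_. count_space UNIV)"

definition walk :: "'g::group_add pmf \<Rightarrow> 'g \<Rightarrow> (nat \<Rightarrow> 'g) measure" where
  "walk \<mu> h = distr (PiM UNIV (\<lambda>_. measure_pmf \<mu>)) paths
                 (\<lambda>\<omega> n. h + sum_list (map \<omega> [0..<Suc n]))"

definition path_shift :: "(nat \<Rightarrow> 'g) \<Rightarrow> (nat \<Rightarrow> 'g)" where
  "path_shift x = (\<lambda>n. x (Suc n))"

(* Poisson boundary Pi(G,mu) = (B0, beta): a standard Borel (Polish) G-space with a
   measurable boundary map bnd from paths, which is (P_h-a.e., every h) shift invariant
   and G-equivariant, pushes P_e to beta, and such that every shift-invariant event
   coincides, modulo P_h-null sets for all h (i.e. mod P_theta-null sets for a fully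
   supported theta), with bnd^{-1} of a Borel set: the Mackey realization of the
   shift-invariant sigma-algebra. The measure beta is B0 itself. *)
definition poisson_boundary ::
  "'g::group_add pmf \<Rightarrow> ('c::polish_space) measure \<Rightarrow> ('g \<Rightarrow> 'c \<Rightarrow> 'c)
     \<Rightarrow> ((nat \<Rightarrow> 'g) \<Rightarrow> 'c) \<Rightarrow> bool" where
  "poisson_boundary \<mu> B0 a0 bnd \<longleftrightarrow>
     sets B0 = sets borel \<and> prob_space B0 \<and> measurable_action B0 a0 \<and>
     bnd \<in> measurable paths B0 \<and>
     (\<forall>h. AE x in walk \<mu> h. bnd (path_shift x) = bnd x) \<and>
     (\<forall>g h. AE x in walk \<mu> h. bnd (\<lambda>n. g + x n) = a0 g (bnd x)) \<and>
     distr (walk \<mu> 0) B0 bnd = B0 \<and>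
     (\<forall>A\<in>sets paths. path_shift -` A = A \<longrightarrow>
        (\<exists>C\<in>sets B0. \<forall>h. emeasure (walk \<mu> h) ((A - bnd -` C) \<union> (bnd -` C - A)) = 0))"

definition measurably_conjugate ::
  "'a measure \<Rightarrow> ('g \<Rightarrow> 'a \<Rightarrow> 'a) \<Rightarrow> 'b measure \<Rightarrow> ('g \<Rightarrow> 'b \<Rightarrow> 'b) \<Rightarrow> bool" where
  "measurably_conjugate M a N b \<longleftrightarrow>
     (\<exists>\<phi> \<psi>. \<phi> \<in> measurable M N \<and> \<psi> \<in> measurable N M \<and>
        (AE x in M. \<psi> (\<phi> x) = x) \<and> (AE y in N. \<phi> (\<psi> y) = y) \<and>
        distr M N \<phi> = N \<and> distr N M \<psi> = M \<and>
        (\<forall>g. AE x in M. \<phi> (a g x) = b g (\<phi> x)))"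

definition essentially_free :: "'b measure \<Rightarrow> ('g::group_add \<Rightarrow> 'b \<Rightarrow> 'b) \<Rightarrow> bool" where
  "essentially_free M a \<longleftrightarrow> (\<forall>g. g \<noteq> 0 \<longrightarrow> (AE x in M. a g x \<noteq> x))"

end

theory Submission
  imports Defs
begin

text \<open>A measure conjugate to \<open>(B, \<nu>)\<close> is the law of \<open>k \<mapsto> f (k\<^sup>-\<^sup>1 x)\<close> for an injective \<open>f\<close> from \<open>B\<close> to
  the Cantor space. Late bits of \<open>f\<close> may be used to encode \<open>x\<close>, so it suffices to approximate the
  \<open>\<eta>\<close>-probabilities of finitely many cylinder events.

  Let \<open>\<lambda>\<^sub>x\<close> be the law of \<open>g\<^sub>n\<close>, with \<open>n\<close> uniform in \<open>{0..<N}\<close>, given that the random walk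
  \<open>(g\<^sub>n)\<close> tends to the boundary point below \<open>x\<close>. Shift-invariant events depend only on the boundary
  point, hence \<open>\<lambda>\<^sub>x\<close> becomes equivariant in total variation as \<open>N\<close> grows.
  If \<open>g\<close> has law \<open>\<lambda>\<^sub>x\<close> and \<open>y\<close> is an independent sample of \<open>\<eta>\<close> then \<open>g y\<close> has law \<open>\<eta>\<close> on average
  over \<open>x\<close>, because \<open>\<eta>\<close> is stationary; no disintegration of \<open>\<eta>\<close> over the boundary is needed.

  To choose \<open>g\<close> so that \<open>x\<close> and \<open>k\<^sup>-\<^sup>1 x\<close> select the same orbit point \<open>t = g\<^sup>-\<^sup>1 x\<close> with high
  probability, round \<open>\<lambda>\<^sub>x\<close> to a set of equally likely tokens and let \<open>x\<close> take its first token in a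
  random ranking of all tokens. The point \<open>t\<close> carries a sample \<open>y\<^sub>t\<close> of \<open>\<eta>\<close>, and \<open>f x = y\<^sub>t (g\<^sup>-\<^sup>1)\<close>.
  Rankings and samples are attached not to points but to the cells of a fine finite partition of
  \<open>B\<close>: freeness makes the relevant cells along an orbit distinct, and since \<open>\<nu>\<close> has no atoms two
  independent points rarely use a common cell, so a second moment bound yields one ranking and one
  family of samples that work for almost all \<open>x\<close> simultaneously.\<close>

section \<open>Almost invariant functions\<close>

text \<open>The difficulty is that \<open>f\<close> is a single deterministic function while its
  target is a distribution; all randomness is put into finite auxiliary data. Tokens make closeness
  in total variation usable: the first of several equally likely tokens in a random ranking is
  uniform, and two token sets have the same first element except with probability at most the
  relative size of their symmetric difference. One ranking thus couples all the laws at once,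
  without measurable selection. The equivariance estimate compares the walk from the identity with
  the walk from k. Their boundary laws are different measures of the same class, so the second walk
  is first reweighted to have the boundary law of the first; the two then agree on shift-invariant
  events. A time average of length N changes by at most 2/N under the shift, so for large N it
  hardly distinguishes the two walks. Testing with the sign of the difference of the conditional
  laws turns this into an L^1 bound.\<close>

lemma AE_convergent_of_fast_L2_Cauchy:
  fixes v :: "nat \<Rightarrow> 'a \<Rightarrow> real"
  assumes "prob_space M" and meas[measurable]: "\<And>i. v i \<in> borel_measurable M"
    and bdd: "\<And>i x. x \<in> space M \<Longrightarrow> \<bar>v i x\<bar> \<le> 1"
    and le: "\<And>i. (\<integral>x. (v i x - v (Suc i) x)\<^sup>2 \<partial>M) \<le> 4 * (1/4)^i"
  shows "AE x in M. convergent (\<lambda>i. v i x)"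
proof -
  interpret prob_space M by fact
  have int: "integrable M (\<lambda>x. \<bar>v (Suc i) x - v i x\<bar>)" for i
  proof (rule integrable_const_bound[where B=2])
    have "\<bar>v (Suc i) x - v i x\<bar> \<le> 2" if "x \<in> space M" for x
      using bdd[OF that, of i] bdd[OF that, of "Suc i"] by argo
    then show "AE x in M. norm \<bar>v (Suc i) x - v i x\<bar> \<le> 2" by auto
  qed measurable
  have int2: "integrable M (\<lambda>x. (v i x - v (Suc i) x)\<^sup>2)" for i
  proof (rule integrable_const_bound[where B=4])
    have "(v i x - v (Suc i) x)\<^sup>2 \<le> 2\<^sup>2" if "x \<in> space M" for x
      using bdd[of x i] bdd[of x "Suc i"] that by (intro power2_le_iff_abs_le[THEN iffD2]) auto
    then show "AE x in M. norm ((v i x - v (Suc i) x)\<^sup>2) \<le> 4" by (intro AE_I2) auto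
  qed (use meas in auto)
  have L1: "(\<integral>x. \<bar>v (Suc i) x - v i x\<bar> \<partial>M) \<le> 3 * (1/2)^i" for i
  proof -
    \<comment> \<open>Weighted AM-GM in place of Cauchy-Schwarz. The weight 2^i turns the L^2 bound
      into 4 * (1/2)^i, so the L^1 norms of the increments are summable.\<close>
    have pt: "\<bar>y\<bar> \<le> (2^i * y\<^sup>2 + (1/2)^i) / 2" for y :: real
    proof -
      have "0 \<le> (2^i * \<bar>y\<bar> - 1)\<^sup>2 * (1/2)^i" by simp
      also have "\<dots> = (2^i * (1/2)^i) * (2^i * \<bar>y\<bar>\<^sup>2) - 2 * (2^i * (1/2)^i) * \<bar>y\<bar> + (1/2)^i"
        by (simp add: power2_eq_square algebra_simps)
      also have "2^i * (1/2::real)^i = 1" by (simp add: power_mult_distrib[symmetric])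
      finally show ?thesis by simp
    qed
    have "(\<integral>x. \<bar>v (Suc i) x - v i x\<bar> \<partial>M) \<le> (\<integral>x. (2^i * (v i x - v (Suc i) x)\<^sup>2 + (1/2)^i) / 2 \<partial>M)"
      by (intro integral_mono int Bochner_Integration.integrable_add Bochner_Integration.integrable_divide
          Bochner_Integration.integrable_mult_right int2) (use pt in \<open>auto simp: power2_commute\<close>, metis abs_minus_commute pt)
    also have "\<dots> = (2^i * (\<integral>x. (v i x - v (Suc i) x)\<^sup>2 \<partial>M) + (1/2)^i) / 2"
      using int2 by (simp add: prob_space)
    also have "\<dots> \<le> (2^i * (4 * (1/4)^i) + (1/2)^i) / 2"
      by (intro divide_right_mono add_right_mono mult_left_mono le) auto
    also have "2^i * (4 * (1/4::real)^i) = 4 * (1/2)^i"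
      by (simp add: power_mult_distrib[symmetric])
    finally show ?thesis using zero_le_power[of "1/2::real" i] by argo
  qed
  have "(\<integral>\<^sup>+x. (\<Sum>i. ennreal \<bar>v (Suc i) x - v i x\<bar>) \<partial>M) = (\<Sum>i. \<integral>\<^sup>+x. ennreal \<bar>v (Suc i) x - v i x\<bar> \<partial>M)"
    using meas by (intro nn_integral_suminf) auto
  also have "\<dots> = (\<Sum>i. ennreal (\<integral>x. \<bar>v (Suc i) x - v i x\<bar> \<partial>M))"
    using int by (subst nn_integral_eq_integral) auto
  also have "\<dots> \<le> (\<Sum>i. ennreal (3 * (1/2)^i))"
    by (intro suminf_le ennreal_leI L1) auto
  also have "\<dots> < \<infinity>"
    by (subst suminf_ennreal_eq[OF _ sums_mult[OF geometric_sums]]) auto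
  finally have fin: "(\<integral>\<^sup>+x. (\<Sum>i. ennreal \<bar>v (Suc i) x - v i x\<bar>) \<partial>M) < \<infinity>" .
  have "AE x in M. (\<Sum>i. ennreal \<bar>v (Suc i) x - v i x\<bar>) \<noteq> \<infinity>"
    by (rule nn_integral_noteq_infinite, measurable) (use fin in simp)
  then show ?thesis
  proof (rule AE_mp, intro AE_I2 impI)
    fix x assume "(\<Sum>i. ennreal \<bar>v (Suc i) x - v i x\<bar>) \<noteq> \<infinity>"
    then have "summable (\<lambda>i. \<bar>v (Suc i) x - v i x\<bar>)"
      by (intro summable_suminf_not_top) simp_all
    then have "summable (\<lambda>i. v (Suc i) x - v i x)" by (rule summable_rabs_cancel)
    then have "convergent (\<lambda>n. \<Sum>i<n. v (Suc i) x - v i x)"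
      by (simp add: summable_iff_convergent)
    moreover have "(\<Sum>i<n. v (Suc i) x - v i x) = v n x - v 0 x" for n
      by (rule sum_lessThan_telescope[of "\<lambda>i. v i x"])
    ultimately have "convergent (\<lambda>n. v n x - v 0 x)" by simp
    then have "convergent (\<lambda>n. (v n x - v 0 x) + v 0 x)" by (intro convergent_add convergent_const)
    then show "convergent (\<lambda>i. v i x)" by simp
  qed
qed

text \<open>This replaces the usual Hahn--Banach argument: near-minimisers of the \<open>L\<^sup>2\<close> norm
  in the decreasing convex sets of almost invariant separating functions are Cauchy,
  and their limit is an everywhere invariant separating function.\<close>

lemma almost_invariant_functions_cannot_separate:
  fixes P Q :: "'a measure" and \<epsilon> :: real
  assumes P: "prob_space P" and Q: "prob_space Q" and sets: "sets Q = sets P"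
    and \<theta>: "\<theta> \<in> measurable P P"
    and inv: "\<And>A. A \<in> sets P \<Longrightarrow> \<theta> -` A \<inter> space P = A \<Longrightarrow> emeasure P A = emeasure Q A"
    and "\<epsilon> > 0"
  shows "\<exists>\<delta>>0. \<forall>u\<in>borel_measurable P.
           (\<forall>x\<in>space P. \<bar>u x\<bar> \<le> 1 \<and> \<bar>u (\<theta> x) - u x\<bar> \<le> \<delta>) \<longrightarrow>
           (\<integral>x. u x \<partial>P) - (\<integral>x. u x \<partial>Q) < \<epsilon>"
proof (rule ccontr)
  assume neg: "\<not> ?thesis"
  interpret P: prob_space P by fact
  interpret Q: prob_space Q by fact
  have space: "space Q = space P" by (rule sets_eq_imp_space_eq[OF sets])
  have measQ: "f \<in> borel_measurable Q \<longleftrightarrow> f \<in> borel_measurable P" for f :: "'a \<Rightarrow> real"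
    by (simp add: measurable_def space sets)
  \<comment> \<open>The negated claim at \<delta> = 1/(j+1) makes each of these sets nonempty; all
    the conditions are convex, so midpoints stay inside.\<close>
  define S where "S j = {u \<in> borel_measurable P. 
      (\<forall>x\<in>space P. \<bar>u x\<bar> \<le> 1 \<and> \<bar>u (\<theta> x) - u x\<bar> \<le> 1 / real (Suc j)) \<and>
           (\<integral>x. u x \<partial>P) - (\<integral>x. u x \<partial>Q) \<ge> \<epsilon>}" for j
  have Sne: "S j \<noteq> {}" for j
    using neg[simplified, rule_format, of "1 / real (Suc j)"] by (auto simp: S_def not_less)
  have Smono: "S j \<subseteq> S i" if "i \<le> j" for i j
  proof -
    have "1 / real (Suc j) \<le> 1 / real (Suc i)" using that by (intro divide_left_mono) auto
    then show ?thesis by (fastforce simp: S_def)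
  qed
  have Sm: "u \<in> borel_measurable P" and Sb: "\<And>x. x \<in> space P \<Longrightarrow> \<bar>u x\<bar> \<le> 1" if "u \<in> S j" for u j
    using that by (auto simp: S_def)
  have intP: "integrable P u" and intQ: "integrable Q u" if "u \<in> borel_measurable P" "\<And>x. x \<in> space P \<Longrightarrow> \<bar>u x\<bar> \<le> 1" for u :: "'a \<Rightarrow> real"
    using that by (auto intro!: P.integrable_const_bound[where B=1] Q.integrable_const_bound[where B=1] AE_I2
        simp: measQ space)
  \<comment> \<open>The squared norm of L^2(P) plus that of L^2(Q), so that one minimising sequence
    serves both measures.\<close>
  define q where "q u = (\<integral>x. (u x)\<^sup>2 \<partial>P) + (\<integral>x. (u x)\<^sup>2 \<partial>Q)" for u :: "'a \<Rightarrow> real"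
  have q0: "0 \<le> q u" for u by (simp add: q_def)
  have sqb: "y\<^sup>2 \<le> 1" if "\<bar>y\<bar> \<le> 1" for y :: real
    using that by (simp add: abs_square_le_1)
  have q2: "q u \<le> 2" if "u \<in> S j" for u j
  proof -
    have "(\<integral>x. (u x)\<^sup>2 \<partial>P) \<le> (\<integral>x. 1 \<partial>P)" "(\<integral>x. (u x)\<^sup>2 \<partial>Q) \<le> (\<integral>x. 1 \<partial>Q)"
      using Sm[OF that] Sb[OF that] by (auto intro!: integral_mono intP intQ simp: sqb space simp del: P.prob_space Q.prob_space Bochner_Integration.lebesgue_integral_const)
    then show ?thesis by (simp add: q_def P.prob_space Q.prob_space)
  qed
  define d where "d j = Inf (q ` S j)" for j
  have bddb: "bdd_below (q ` S j)" for j using q0 by (auto intro!: bdd_belowI[of _ 0])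
  have dle: "d j \<le> q u" if "u \<in> S j" for u j
    unfolding d_def using that bddb by (intro cInf_lower) auto
  have dmono: "incseq d"
    unfolding incseq_def d_def using Smono Sne bddb by (intro allI impI cInf_superset_mono) auto
  have d2: "d j \<le> 2" for j using Sne[of j] dle[of _ j] q2[of _ j] by force
  obtain D where D: "d \<longlonglongrightarrow> D" "\<And>i. d i \<le> D"
    using incseq_convergent[OF dmono, of 2] d2 by auto
  have "\<exists>u\<in>S j. q u < d j + 1 / real (Suc j)" for j
  proof -
    have "Inf (q ` S j) < d j + 1 / real (Suc j)" unfolding d_def by simp
    then show ?thesis using Sne[of j] bddb[of j] by (subst (asm) cInf_less_iff) auto
  qed
  then obtain u where u: "\<And>j. u j \<in> S j" "\<And>j. q (u j) < d j + 1 / real (Suc j)" by metis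
  \<comment> \<open>Error in the parallelogram law: the midpoint has \<open>q\<close> at least
    \<open>d i\<close>, while \<open>q (u i)\<close> and \<open>q (u j)\<close> are at most
    \<open>D + 1 / real (Suc i)\<close>.\<close>
  define e where "e i = D - d i + 2 * (1 / real (Suc i))" for i
  have cauchy: "q (\<lambda>x. u i x - u j x) \<le> 4 * e i" if "i \<le> j" for i j
  proof -
    have ui: "u i \<in> S i" and uj: "u j \<in> S i" using u(1) Smono[OF that] by auto
    define w where "w = (\<lambda>x. (u i x + u j x) / 2)"
    note m = Sm[OF ui] Sm[OF uj] and b = Sb[OF ui] Sb[OF uj]
    have "w \<in> S i"
    proof -
      have "\<bar>w (\<theta> x) - w x\<bar> \<le> 1 / real (Suc i)" "\<bar>w x\<bar> \<le> 1" if "x \<in> space P" for x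
      proof -
        have "\<bar>u i (\<theta> x) - u i x\<bar> \<le> 1 / real (Suc i)" "\<bar>u j (\<theta> x) - u j x\<bar> \<le> 1 / real (Suc i)"
          using ui uj that by (auto simp: S_def)
        then show "\<bar>w (\<theta> x) - w x\<bar> \<le> 1 / real (Suc i)" unfolding w_def by argo
        show "\<bar>w x\<bar> \<le> 1" using b[OF that] unfolding w_def by argo
      qed
      moreover have "(\<integral>x. w x \<partial>P) - (\<integral>x. w x \<partial>Q) = (((\<integral>x. u i x \<partial>P) - (\<integral>x. u i x \<partial>Q)) + ((\<integral>x. u j x \<partial>P) - (\<integral>x. u j x \<partial>Q))) / 2"
        using m b by (simp add: w_def intP intQ Bochner_Integration.integral_add field_simps)
      ultimately show ?thesis using ui uj m by (auto simp: S_def w_def)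
    qed
    then have wle: "d i \<le> q w" by (rule dle)
    have sq: "integrable P (\<lambda>x. (u k x)\<^sup>2)" "integrable Q (\<lambda>x. (u k x)\<^sup>2)"
      "integrable P (\<lambda>x. (u k x * u l x))" "integrable Q (\<lambda>x. (u k x * u l x))" for k l
      using Sm[OF u(1)] Sb[OF u(1)] by (auto intro!: intP intQ simp: sqb abs_mult mult_le_one)
    have eq: "q (\<lambda>x. u i x - u j x) = 2 * q (u i) + 2 * q (u j) - 4 * q w"
    proof -
      have 1: "(\<integral>x. (u i x - u j x)\<^sup>2 \<partial>M) = 2 * (\<integral>x. (u i x)\<^sup>2 \<partial>M) + 2 * (\<integral>x. (u j x)\<^sup>2 \<partial>M) - 4 * (\<integral>x. (w x)\<^sup>2 \<partial>M)"
        if "\<And>k. integrable M (\<lambda>x. (u k x)\<^sup>2)" "\<And>k l. integrable M (\<lambda>x. (u k x * u l x))" for M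
      proof -
        have "integrable M (\<lambda>x. (w x)\<^sup>2)"
          using that by (auto simp: w_def power2_sum power_divide mult.assoc)
        then have "2 * (\<integral>x. (u i x)\<^sup>2 \<partial>M) + 2 * (\<integral>x. (u j x)\<^sup>2 \<partial>M) - 4 * (\<integral>x. (w x)\<^sup>2 \<partial>M) 
          = (\<integral>x. 2 * (u i x)\<^sup>2 + 2 * (u j x)\<^sup>2 - 4 * (w x)\<^sup>2 \<partial>M)"
          using that(1) by simp
        also have "\<dots> = (\<integral>x. (u i x - u j x)\<^sup>2 \<partial>M)"
          by (intro Bochner_Integration.integral_cong refl) (simp add: w_def power2_eq_square field_simps)
        finally show ?thesis by simp
      qed
      show ?thesis unfolding q_def using 1[of P] 1[of Q] sq by simp
    qed
    have "1 / real (Suc j) \<le> 1 / real (Suc i)" "0 \<le> 1 / real (Suc i)" using that by (intro divide_left_mono) auto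
    then show ?thesis unfolding eq e_def using wle u(2)[of i] u(2)[of j] D(2)[of i] D(2)[of j] by argo
  qed
  have e0: "e \<longlonglongrightarrow> 0"
  proof -
    have "e \<longlonglongrightarrow> D - D + 2 * 0" unfolding e_def
      by (intro tendsto_intros D LIMSEQ_Suc[OF lim_1_over_n])
    then show ?thesis by simp
  qed
  have "\<exists>n>m. e n \<le> (1/4)^i" for m i
  proof -
    have "eventually (\<lambda>n. e n < (1/4)^i) sequentially" by (intro order_tendstoD(2)[OF e0]) auto
    then have "eventually (\<lambda>n. e n < (1/4)^i \<and> n > m) sequentially"
      by (intro eventually_conj eventually_gt_at_top)
    then show ?thesis by (auto simp: eventually_sequentially intro: less_imp_le)
  qed
  then obtain nx where nx: "\<And>m i. nx m i > m" "\<And>m i. e (nx m i) \<le> (1/4)^i" by metis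
  define r where "r = rec_nat (nx 0 0) (\<lambda>i m. nx m (Suc i))"
  have rS: "r i < r (Suc i)" for i by (simp add: r_def nx)
  then have r: "strict_mono r" by (rule strict_monoI_Suc)
  have er: "e (r i) \<le> (1/4)^i" for i by (cases i) (use nx(2)[of _ i] in \<open>simp_all add: r_def del: power_Suc\<close>)
  define v where "v i = u (r i)" for i
  have vm: "v i \<in> borel_measurable P" and vb: "\<And>x. x \<in> space P \<Longrightarrow> \<bar>v i x\<bar> \<le> 1" for i
    unfolding v_def using Sm[OF u(1)] Sb[OF u(1)] by auto
  have qv: "q (\<lambda>x. v i x - v (Suc i) x) \<le> 4 * (1/4)^i" for i
    unfolding v_def using cauchy[OF less_imp_le[OF rS[of i]]] er[of i] by argo
  have "(\<integral>x. (v i x - v (Suc i) x)\<^sup>2 \<partial>P) \<le> 4 * (1/4)^i" for i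
    using order_trans[OF _ qv[of i], of "(\<integral>x. (v i x - v (Suc i) x)\<^sup>2 \<partial>P)"] by (simp add: q_def)
  then have convP: "AE x in P. convergent (\<lambda>i. v i x)"
    using vm vb by (intro AE_convergent_of_fast_L2_Cauchy) (auto intro: P)
  have "(\<integral>x. (v i x - v (Suc i) x)\<^sup>2 \<partial>Q) \<le> 4 * (1/4)^i" for i
    using order_trans[OF _ qv[of i], of "(\<integral>x. (v i x - v (Suc i) x)\<^sup>2 \<partial>Q)"] by (simp add: q_def)
  then have convQ: "AE x in Q. convergent (\<lambda>i. v i x)"
    using vm vb by (intro AE_convergent_of_fast_L2_Cauchy) (auto intro: Q simp: measQ space)
  \<comment> \<open>Since \<open>v i (\<theta> x) - v i x\<close> tends to 0 at every point, the
    convergence set and the limit are exactly invariant under \<open>\<theta>\<close>, and the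
    default 0 preserves this. The assumption \<open>inv\<close> speaks of exactly invariant events,
    so invariance almost everywhere would not do.\<close>
  define \<psi> where "\<psi> x = (if convergent (\<lambda>i. v i x) then lim (\<lambda>i. v i x) else 0)" for x
  have \<psi>m[measurable]: "\<psi> \<in> borel_measurable P"
  proof -
    note vm[measurable]
    show ?thesis unfolding \<psi>_def Cauchy_convergent_iff[symmetric] by measurable
  qed
  have \<psi>inv: "\<psi> (\<theta> x) = \<psi> x" if x: "x \<in> space P" for x
  proof -
    have "(\<lambda>i. v i (\<theta> x) - v i x) \<longlonglongrightarrow> 0"
    proof (rule Lim_null_comparison)
      have "\<bar>v i (\<theta> x) - v i x\<bar> \<le> 1 / real (Suc i)" for i
      proof -
        have "\<bar>v i (\<theta> x) - v i x\<bar> \<le> 1 / real (Suc (r i))" using u(1)[of "r i"] x by (auto simp: S_def v_def)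
        also have "\<dots> \<le> 1 / real (Suc i)" using seq_suble[OF r, of i] by (intro divide_left_mono) auto
        finally show ?thesis .
      qed
      then show "\<forall>\<^sub>F i in sequentially. norm (v i (\<theta> x) - v i x) \<le> 1 / real (Suc i)" by simp
      show "(\<lambda>i. 1 / real (Suc i)) \<longlonglongrightarrow> 0" by (rule LIMSEQ_Suc[OF lim_1_over_n])
    qed
    then have iff: "(\<lambda>i. v i (\<theta> x)) \<longlonglongrightarrow> l \<longleftrightarrow> (\<lambda>i. v i x) \<longlonglongrightarrow> l" for l
      using Lim_transform[of "\<lambda>i. v i x" l sequentially "\<lambda>i. v i (\<theta> x)"]
        Lim_transform2[of "\<lambda>i. v i (\<theta> x)" l sequentially "\<lambda>i. v i x"] by blast
    have "convergent (\<lambda>i. v i (\<theta> x)) = convergent (\<lambda>i. v i x)"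
      by (simp only: convergent_def iff)
    moreover have "lim (\<lambda>i. v i (\<theta> x)) = lim (\<lambda>i. v i x)"
      by (simp only: lim_def iff)
    ultimately show ?thesis by (simp only: \<psi>_def)
  qed
  \<comment> \<open>Preimages under \<open>\<psi>\<close> are invariant events, on which
    \<open>P\<close> and \<open>Q\<close> agree. Hence \<open>\<psi>\<close> has equal integrals,
    although the gap \<epsilon> survives dominated convergence.\<close>
  have "distr P borel \<psi> = distr Q borel \<psi>"
  proof (rule measure_eqI)
    fix A assume "A \<in> sets (distr P borel \<psi>)"
    then have A: "A \<in> sets borel" by simp
    have "\<theta> -` (\<psi> -` A \<inter> space P) \<inter> space P = \<psi> -` A \<inter> space P"
      using \<psi>inv measurable_space[OF \<theta>] by auto
    then have "emeasure P (\<psi> -` A \<inter> space P) = emeasure Q (\<psi> -` A \<inter> space P)"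
      by (intro inv measurable_sets[OF \<psi>m A])
    then show "emeasure (distr P borel \<psi>) A = emeasure (distr Q borel \<psi>) A"
      using A by (simp add: emeasure_distr \<psi>m measQ space)
  qed simp
  moreover have "(\<integral>x. x \<partial>distr P borel \<psi>) = (\<integral>x. \<psi> x \<partial>P)"
    by (rule integral_distr) (rule \<psi>m, simp)
  moreover have "(\<integral>x. x \<partial>distr Q borel \<psi>) = (\<integral>x. \<psi> x \<partial>Q)"
    by (rule integral_distr) (simp only: measQ \<psi>m, simp)
  ultimately have eq: "(\<integral>x. \<psi> x \<partial>P) = (\<integral>x. \<psi> x \<partial>Q)"
    by simp
  have lP: "(\<lambda>i. \<integral>x. v i x \<partial>P) \<longlonglongrightarrow> (\<integral>x. \<psi> x \<partial>P)"
  proof (rule integral_dominated_convergence[where w="\<lambda>_. 1"])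
    show "AE x in P. (\<lambda>i. v i x) \<longlonglongrightarrow> \<psi> x"
      using convP by (rule eventually_mono) (auto simp: \<psi>_def convergent_LIMSEQ_iff)
    show "\<psi> \<in> borel_measurable P" "\<And>i. v i \<in> borel_measurable P"
      using \<psi>m vm by (simp_all only: measQ)
    show "AE x in P. norm (v i x) \<le> 1" for i
      using vb by (intro AE_I2) (simp add: space)
  qed simp
  have lQ: "(\<lambda>i. \<integral>x. v i x \<partial>Q) \<longlonglongrightarrow> (\<integral>x. \<psi> x \<partial>Q)"
  proof (rule integral_dominated_convergence[where w="\<lambda>_. 1"])
    show "AE x in Q. (\<lambda>i. v i x) \<longlonglongrightarrow> \<psi> x"
      using convQ by (rule eventually_mono) (auto simp: \<psi>_def convergent_LIMSEQ_iff)
    show "\<psi> \<in> borel_measurable Q" "\<And>i. v i \<in> borel_measurable Q"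
      using \<psi>m vm by (simp_all only: measQ)
    show "AE x in Q. norm (v i x) \<le> 1" for i
      using vb by (intro AE_I2) (simp add: space)
  qed simp
  have "(\<lambda>i. (\<integral>x. v i x \<partial>P) - (\<integral>x. v i x \<partial>Q)) \<longlonglongrightarrow> (\<integral>x. \<psi> x \<partial>P) - (\<integral>x. \<psi> x \<partial>Q)"
    by (intro tendsto_diff lP lQ)
  moreover have "(\<integral>x. v i x \<partial>P) - (\<integral>x. v i x \<partial>Q) \<ge> \<epsilon>" for i
    using u(1)[of "r i"] by (auto simp: S_def v_def)
  ultimately have "\<epsilon> \<le> (\<integral>x. \<psi> x \<partial>P) - (\<integral>x. \<psi> x \<partial>Q)"
    by (intro LIMSEQ_le_const) auto
  with eq \<open>\<epsilon> > 0\<close> show False by simp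
qed

section \<open>Random walks\<close>

lemma space_paths [simp]: "space paths = UNIV"
  by (simp add: paths_def space_PiM)

lemma measurable_path_component [measurable]: "(\<lambda>x. x n) \<in> measurable paths (count_space UNIV)"
  unfolding paths_def by measurable

lemma measurable_into_paths:
  assumes "\<And>n. (\<lambda>x. f x n) \<in> measurable M (count_space UNIV)"
  shows "f \<in> measurable M paths"
  unfolding paths_def using assms by (intro measurable_PiM_single') auto

lemma measurable_path_shift [measurable]: "path_shift \<in> measurable paths paths"
  by (rule measurable_into_paths) (simp add: path_shift_def)

lemma measurable_path_translate [measurable]: "(\<lambda>x n. g + x n) \<in> measurable paths paths"
  by (rule measurable_into_paths) (rule measurable_compose[OF measurable_path_component], simp)

abbreviation increments :: "'g pmf \<Rightarrow> (nat \<Rightarrow> 'g) measure" where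
  "increments \<mu> \<equiv> PiM UNIV (\<lambda>_. measure_pmf \<mu>)"

definition walk_path :: "'g::group_add \<Rightarrow> (nat \<Rightarrow> 'g) \<Rightarrow> nat \<Rightarrow> 'g" where
  "walk_path h \<omega> = (\<lambda>n. h + sum_list (map \<omega> [0..<Suc n]))"

lemma measurable_walk_path [measurable]:
  fixes \<mu> :: "'g::{group_add,countable} pmf"
  shows "walk_path h \<in> measurable (increments \<mu>) paths"
proof (rule measurable_into_paths)
  fix n
  have comp: "(\<lambda>\<omega>. \<omega> n) \<in> measurable (increments \<mu>) (count_space UNIV)" for n
    using measurable_component_singleton[of n UNIV "\<lambda>_. measure_pmf \<mu>"] by simp
  have "(\<lambda>\<omega>. sum_list (map \<omega> [0..<n])) \<in> measurable (increments \<mu>) (count_space UNIV)" for n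
  proof (induction n)
    case (Suc n)
    have "(\<lambda>\<omega>. (\<lambda>i \<omega>. i + \<omega> n) (sum_list (map \<omega> [0..<n])) \<omega>) \<in> measurable (increments \<mu>) (count_space UNIV)"
      by (rule measurable_compose_countable[OF measurable_compose[OF comp] Suc]) simp
    then show ?case by simp
  qed simp
  from measurable_compose[OF this[of "Suc n"], of "\<lambda>s. h + s" "count_space UNIV"]
  show "(\<lambda>\<omega>. walk_path h \<omega> n) \<in> measurable (increments \<mu>) (count_space UNIV)" by (simp add: walk_path_def)
qed

lemma walk_eq_distr: "walk \<mu> h = distr (increments \<mu>) paths (walk_path h)"
  by (simp add: walk_def walk_path_def[abs_def])

lemma sets_walk [simp, measurable_cong]: "sets (walk \<mu> h) = sets paths"
  by (simp add: walk_def)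

lemma space_walk [simp]: "space (walk \<mu> h) = UNIV"
  by (simp add: walk_def)

lemma prob_space_walk:
  fixes \<mu> :: "'g::{group_add,countable} pmf"
  shows "prob_space (walk \<mu> h)"
proof -
  interpret product_prob_space "\<lambda>_. measure_pmf \<mu>" "UNIV :: nat set" ..
  show ?thesis unfolding walk_eq_distr by (rule prob_space_distr) (rule measurable_walk_path)
qed

lemma walk_translate:
  fixes \<mu> :: "'g::{group_add,countable} pmf"
  shows "walk \<mu> (g + h) = distr (walk \<mu> h) paths (\<lambda>x n. g + x n)"
  unfolding walk_eq_distr
  by (subst distr_distr[OF measurable_path_translate measurable_walk_path])
     (simp add: o_def add.assoc walk_path_def[abs_def])

text \<open>Markov property at the first step. Entry 0 of a path is already \<open>h\<close> times
  the first increment, so dropping it leaves a walk started at \<open>h + g\<close> with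
  \<open>g\<close> distributed by \<open>\<mu>\<close>.\<close>

lemma nn_integral_walk_shift:
  fixes \<mu> :: "'g::{group_add,countable} pmf"
  assumes f[measurable]: "f \<in> borel_measurable paths"
  shows "(\<integral>\<^sup>+x. f (path_shift x) \<partial>walk \<mu> h) = (\<integral>\<^sup>+g. (\<integral>\<^sup>+x. f x \<partial>walk \<mu> (h + g)) \<partial>measure_pmf \<mu>)"
proof -
  interpret S: sequence_space "measure_pmf \<mu>" ..
  have sf: "sigma_finite_measure (increments \<mu>)"
    by (rule prob_space_imp_sigma_finite[OF S.prob_space_axioms])
  have shift: "path_shift (walk_path h (case_nat s \<omega>)) = walk_path (h + s) \<omega>" for s \<omega>
    by (simp add: walk_path_def path_shift_def fun_eq_iff add.assoc upt_conv_Cons map_Suc_upt[symmetric] o_def del: upt_Suc)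
  have "(\<integral>\<^sup>+x. f (path_shift x) \<partial>walk \<mu> h) = (\<integral>\<^sup>+\<omega>. f (path_shift (walk_path h \<omega>)) \<partial>increments \<mu>)"
    unfolding walk_eq_distr by (rule nn_integral_distr) measurable
  also have "\<dots> = (\<integral>\<^sup>+\<omega>. f (path_shift (walk_path h \<omega>)) \<partial>distr (measure_pmf \<mu> \<Otimes>\<^sub>M increments \<mu>) (increments \<mu>) (\<lambda>(s, \<omega>). case_nat s \<omega>))"
    by (simp only: S.PiM_iter)
  also have "\<dots> = (\<integral>\<^sup>+p. f (path_shift (walk_path h (case_nat (fst p) (snd p)))) \<partial>(measure_pmf \<mu> \<Otimes>\<^sub>M increments \<mu>))"
    by (subst nn_integral_distr) (auto simp: case_prod_beta)
  also have "\<dots> = (\<integral>\<^sup>+s. \<integral>\<^sup>+\<omega>. f (path_shift (walk_path h (case_nat s \<omega>))) \<partial>increments \<mu> \<partial>measure_pmf \<mu>)"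
    by (subst sigma_finite_measure.nn_integral_fst[OF sf, symmetric]) auto
  also have "\<dots> = (\<integral>\<^sup>+g. (\<integral>\<^sup>+x. f x \<partial>walk \<mu> (h + g)) \<partial>measure_pmf \<mu>)"
    unfolding shift walk_eq_distr by (subst nn_integral_distr) auto
  finally show ?thesis .
qed

text \<open>The shift does not preserve \<open>walk \<mu> h\<close> but maps it to a mixture of the
  walks from \<open>h + g\<close>. This is why the property is assumed from every starting
  point.\<close>

lemma AE_walk_shift:
  fixes \<mu> :: "'g::{group_add,countable} pmf"
  assumes R: "{x. R x} \<in> sets paths" and AE: "\<And>h. AE x in walk \<mu> h. R x"
  shows "AE x in walk \<mu> h. R (path_shift x)"
proof -
  have meas: "(\<lambda>x. indicator (- {x. R x}) x :: ennreal) \<in> borel_measurable paths"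
    using R by (intro borel_measurable_indicator) (metis space_paths Compl_eq_Diff_UNIV sets.compl_sets)
  have meas': "(\<lambda>x. indicator (- {x. R x}) x :: ennreal) \<in> borel_measurable (walk \<mu> h)" for h
    using meas unfolding measurable_cong_sets[OF sets_walk refl] .
  have 0: "(\<integral>\<^sup>+x. indicator (- {x. R x}) x \<partial>walk \<mu> h) = 0" for h
  proof (subst nn_integral_0_iff_AE)
    show "AE x in walk \<mu> h. indicator (- {x. R x}) x = (0::ennreal)" using AE[of h] by (auto simp: indicator_def)
  qed (use meas' in simp)
  have "(\<integral>\<^sup>+x. indicator (- {x. R x}) (path_shift x) \<partial>walk \<mu> h) = 0"
    unfolding nn_integral_walk_shift[OF meas] 0 by simp
  moreover have "(\<lambda>x. indicator (- {x. R x}) (path_shift x) :: ennreal) \<in> borel_measurable (walk \<mu> h)"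
    using measurable_compose[OF measurable_path_shift meas] unfolding measurable_cong_sets[OF sets_walk refl] .
  ultimately have "AE x in walk \<mu> h. indicator (- {x. R x}) (path_shift x) = (0::ennreal)"
    by (simp add: nn_integral_0_iff_AE)
  then show ?thesis by (rule eventually_mono) (auto simp: indicator_def split: if_splits)
qed

text \<open>Stationarity says that the measure of the set of \<open>y\<close> with
  \<open>a h y \<in> A\<close> is a harmonic function of \<open>h\<close> (this is
  \<open>step\<close>), so its mean along the walk keeps the value at the start.\<close>

lemma walk_marginal_stationary:
  fixes \<mu> :: "'g::{group_add,countable} pmf"
  assumes act: "measurable_action M a" and stat: "stationary \<mu> M a" and A: "A \<in> sets M"
  shows "(\<integral>\<^sup>+x. emeasure M {y \<in> space M. a (x n) y \<in> A} \<partial>walk \<mu> h) = emeasure M {y \<in> space M. a h y \<in> A}"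
proof -
  have am: "a g \<in> measurable M M" for g using act by (simp add: measurable_action_def)
  have step: "(\<integral>\<^sup>+g. emeasure M {y \<in> space M. a (h + g) y \<in> A} \<partial>measure_pmf \<mu>) = emeasure M {y \<in> space M. a h y \<in> A}" for h
  proof -
    let ?A = "{y \<in> space M. a h y \<in> A}"
    have "?A \<in> sets M" using measurable_sets[OF am A] by (simp add: vimage_def Int_def conj_commute)
    then have "emeasure M ?A = (\<integral>\<^sup>+g. emeasure M {x \<in> space M. a g x \<in> ?A} \<partial>measure_pmf \<mu>)"
      using stat by (simp add: stationary_def)
    moreover have "{x \<in> space M. a g x \<in> ?A} = {y \<in> space M. a (h + g) y \<in> A}" for g
      using act measurable_space[OF am] by (auto simp: measurable_action_def)
    ultimately show ?thesis by simp
  qed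
  show ?thesis
  proof (induction n arbitrary: h)
    case 0
    interpret S: sequence_space "measure_pmf \<mu>" ..
    have "(\<integral>\<^sup>+x. emeasure M {y \<in> space M. a (x 0) y \<in> A} \<partial>walk \<mu> h) =
       (\<integral>\<^sup>+\<omega>. emeasure M {y \<in> space M. a (h + \<omega> 0) y \<in> A} \<partial>increments \<mu>)"
      unfolding walk_eq_distr
      by (subst nn_integral_distr[OF measurable_walk_path])
         (auto simp: walk_path_def intro!: measurable_compose[OF measurable_path_component])
    also have "\<dots> = (\<integral>\<^sup>+g. emeasure M {y \<in> space M. a (h + g) y \<in> A} \<partial>distr (increments \<mu>) (measure_pmf \<mu>) (\<lambda>\<omega>. \<omega> 0))"
      using measurable_component_singleton[of 0 UNIV "\<lambda>_. measure_pmf \<mu>"]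
      by (subst nn_integral_distr) auto
    also have "distr (increments \<mu>) (measure_pmf \<mu>) (\<lambda>\<omega>. \<omega> 0) = measure_pmf \<mu>"
      using S.PiM_component[of 0] by simp
    finally show ?case unfolding step .
  next
    case (Suc n)
    have "(\<integral>\<^sup>+x. emeasure M {y \<in> space M. a (x (Suc n)) y \<in> A} \<partial>walk \<mu> h) =
      (\<integral>\<^sup>+x. emeasure M {y \<in> space M. a (path_shift x n) y \<in> A} \<partial>walk \<mu> h)" by (simp add: path_shift_def)
    also have "\<dots> = (\<integral>\<^sup>+g. (\<integral>\<^sup>+x. emeasure M {y \<in> space M. a (x n) y \<in> A} \<partial>walk \<mu> (h + g)) \<partial>measure_pmf \<mu>)"
      by (rule nn_integral_walk_shift) (rule measurable_compose[OF measurable_path_component], simp)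
    finally show ?case unfolding Suc step .
  qed
qed

section \<open>Approximate equivariance over the Poisson boundary\<close>

lemma ennreal_avg_const: "N > 0 \<Longrightarrow> (\<Sum>n<N::nat. x) / of_nat N = (x :: ennreal)"
  by (simp add: mult.commute[of "of_nat N"] mult_divide_eq_ennreal)

locale poisson_space =
  fixes \<mu> :: "'g::{group_add, countable} pmf"
    and B0 :: "'c::polish_space measure" and a0 :: "'g \<Rightarrow> 'c \<Rightarrow> 'c"
    and bnd :: "(nat \<Rightarrow> 'g) \<Rightarrow> 'c"
  assumes generates: "semigroup_gen (set_pmf \<mu>) = UNIV"
    and boundary: "poisson_boundary \<mu> B0 a0 bnd"
begin

lemma sets_B0 [measurable_cong]: "sets B0 = sets borel"
  using boundary by (simp add: poisson_boundary_def)

lemma space_B0 [simp]: "space B0 = UNIV"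
  using sets_eq_imp_space_eq[OF sets_B0] by simp

lemma prob_space_B0: "prob_space B0"
  using boundary by (simp add: poisson_boundary_def)

lemma measurable_a0 [measurable]: "a0 g \<in> measurable B0 B0"
  using boundary by (simp add: poisson_boundary_def measurable_action_def)

lemma a0_zero [simp]: "a0 0 b = b"
  using boundary by (simp add: poisson_boundary_def measurable_action_def)

lemma a0_add: "a0 (g + h) b = a0 g (a0 h b)"
  using boundary by (simp add: poisson_boundary_def measurable_action_def)

lemma a0_cancel [simp]: "a0 g (a0 (- g) b) = b" "a0 (- g) (a0 g b) = b"
  by (simp_all add: a0_add[symmetric])

lemma measurable_bnd [measurable]: "bnd \<in> measurable paths B0"
  using boundary by (simp add: poisson_boundary_def)

lemma AE_bnd_shift: "AE x in walk \<mu> h. bnd (path_shift x) = bnd x"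
  using boundary by (simp add: poisson_boundary_def)

lemma AE_bnd_translate: "AE x in walk \<mu> h. bnd (\<lambda>n. g + x n) = a0 g (bnd x)"
  using boundary by (simp add: poisson_boundary_def)

lemma distr_bnd: "distr (walk \<mu> 0) B0 bnd = B0"
  using boundary by (simp add: poisson_boundary_def)

lemma measurable_bnd_borel: "bnd \<in> borel_measurable paths"
  using measurable_bnd measurable_cong_sets[OF refl sets_B0] by blast

text \<open>Lets the boundary point be read off any tail of the path. The induction keeps
  \<open>h\<close> arbitrary because each shift moves the starting point.\<close>

lemma AE_bnd_funpow_shift: "AE x in walk \<mu> h. \<forall>n. bnd ((path_shift ^^ n) x) = bnd x"
proof (subst AE_all_countable, intro allI)
  fix n
  show "AE x in walk \<mu> h. bnd ((path_shift ^^ n) x) = bnd x"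
  proof (induction n arbitrary: h)
    case (Suc n)
    have m: "(\<lambda>x. bnd ((path_shift ^^ n) x)) \<in> borel_measurable paths"
      by (rule measurable_compose[OF _ measurable_bnd_borel]) (induction n; simp)
    have "AE x in walk \<mu> h. bnd ((path_shift ^^ n) (path_shift x)) = bnd (path_shift x)"
      using measurable_equality_set[OF m measurable_bnd_borel] by (intro AE_walk_shift Suc) simp
    with AE_bnd_shift[of h] show ?case
      by eventually_elim (simp add: funpow_swap1)
  qed simp
qed

lemma distr_walk_bnd: "distr (walk \<mu> k) B0 bnd = distr B0 B0 (a0 k)"
proof -
  have "distr (walk \<mu> k) B0 bnd = distr (distr (walk \<mu> 0) paths (\<lambda>x n. k + x n)) B0 bnd"
    using walk_translate[of \<mu> k 0] by simp
  also have "\<dots> = distr (walk \<mu> 0) B0 (\<lambda>x. bnd (\<lambda>n. k + x n))"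
    by (subst distr_distr) (auto simp: o_def)
  also have "\<dots> = distr (walk \<mu> 0) B0 (\<lambda>x. a0 k (bnd x))"
    by (rule distr_cong_AE[OF refl refl AE_bnd_translate])
       (auto intro: measurable_compose[OF measurable_path_translate])
  also have "\<dots> = distr (distr (walk \<mu> 0) B0 bnd) B0 (a0 k)"
    by (subst distr_distr) (auto simp: o_def)
  finally show ?thesis unfolding distr_bnd .
qed

section \<open>Stationarity and quasi-invariance of the boundary measure\<close>

lemma vimage_a0: "C \<in> sets B0 \<Longrightarrow> a0 g -` C \<in> sets B0"
  using measurable_sets[OF measurable_a0] by simp

text \<open>Apply the Markov property to the event that the boundary point lies in \<open>C\<close>:
  the shift leaves that point alone and replaces the start by \<open>g\<close>, from which the
  boundary law is the image of \<open>B0\<close> under \<open>a0 g\<close>.\<close>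

lemma B0_stationary:
  assumes C: "C \<in> sets B0"
  shows "emeasure B0 C = (\<integral>\<^sup>+g. emeasure B0 (a0 g -` C) \<partial>measure_pmf \<mu>)"
proof -
  note C[measurable]
  have e: "emeasure (distr (walk \<mu> h) B0 bnd) C = (\<integral>\<^sup>+x. indicator C (bnd x) \<partial>walk \<mu> h)" for h
    by (subst nn_integral_distr[where f="indicator C" and M'=B0, symmetric]) auto
  have "emeasure B0 C = (\<integral>\<^sup>+x. indicator C (bnd x) \<partial>walk \<mu> 0)"
    unfolding e[symmetric] distr_bnd ..
  also have "\<dots> = (\<integral>\<^sup>+x. indicator C (bnd (path_shift x)) \<partial>walk \<mu> 0)"
    using AE_bnd_shift[of 0] by (intro nn_integral_cong_AE) (auto elim!: eventually_mono)
  also have "\<dots> = (\<integral>\<^sup>+g. \<integral>\<^sup>+x. indicator C (bnd x) \<partial>walk \<mu> (0 + g) \<partial>measure_pmf \<mu>)"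
    by (rule nn_integral_walk_shift) measurable
  also have "\<dots> = (\<integral>\<^sup>+g. emeasure B0 (a0 g -` C) \<partial>measure_pmf \<mu>)"
    unfolding e[symmetric] distr_walk_bnd using C by (simp add: emeasure_distr)
  finally show ?thesis .
qed

text \<open>The measure of \<open>C\<close> is an average of the measures of its preimages. If it is
  zero, so is every term with \<open>g\<close> in the support of \<open>\<mu>\<close>; the support
  generates the group as a semigroup, so composing preimages reaches every \<open>g\<close>.\<close>

lemma quasi_invariant:
  assumes "C \<in> sets B0" "emeasure B0 C = 0"
  shows "emeasure B0 (a0 g -` C) = 0"
proof -
  have "g \<in> semigroup_gen (set_pmf \<mu>)" by (simp add: generates)
  then show ?thesis using assms
  proof (induction arbitrary: C)
    case (base s)
    have "(\<integral>\<^sup>+g. emeasure B0 (a0 g -` C) \<partial>measure_pmf \<mu>) = 0"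
      using B0_stationary base by simp
    then have "AE g in measure_pmf \<mu>. emeasure B0 (a0 g -` C) = 0"
      by (simp add: nn_integral_0_iff_AE)
    then show ?case using base by (auto simp: AE_measure_pmf_iff)
  next
    case (mult g h)
    have "a0 (g + h) -` C = a0 h -` (a0 g -` C)" by (auto simp: a0_add)
    then show ?case using mult vimage_a0 by simp
  qed
qed

lemma absolutely_continuous_B0: "absolutely_continuous (distr B0 B0 (a0 k)) B0"
proof -
  have "emeasure B0 C = 0" if "C \<in> sets B0" "emeasure (distr B0 B0 (a0 k)) C = 0" for C
  proof -
    have "emeasure B0 (a0 k -` C) = 0" using that by (simp add: emeasure_distr)
    then have "emeasure B0 (a0 (- k) -` (a0 k -` C)) = 0"
      by (rule quasi_invariant[OF vimage_a0[OF that(1)]])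
    then show ?thesis by (simp add: vimage_def)
  qed
  then show ?thesis by (auto simp: absolutely_continuous_def null_sets_def)
qed

section \<open>The walk reweighted to a common boundary law\<close>

definition boundary_weight :: "'g \<Rightarrow> 'c \<Rightarrow> ennreal" where
  "boundary_weight k = RN_deriv (distr B0 B0 (a0 k)) B0"

lemma measurable_boundary_weight [measurable]: "boundary_weight k \<in> borel_measurable B0"
  unfolding boundary_weight_def using borel_measurable_RN_deriv[of "distr B0 B0 (a0 k)" B0] by simp

lemma density_boundary_weight: "density (distr B0 B0 (a0 k)) (boundary_weight k) = B0"
proof -
  interpret B: prob_space B0 by (rule prob_space_B0)
  interpret D: prob_space "distr B0 B0 (a0 k)" by (rule B.prob_space_distr) measurable
  show ?thesis unfolding boundary_weight_def
    by (rule D.density_RN_deriv[OF absolutely_continuous_B0]) simp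
qed

text \<open>The law of the walk started at \<open>k\<close>, reweighted so that its boundary point has the
  same distribution as for the walk started at the identity.\<close>

definition tilted_walk :: "'g \<Rightarrow> (nat \<Rightarrow> 'g) measure" where
  "tilted_walk k = density (walk \<mu> k) (\<lambda>x. boundary_weight k (bnd x))"

lemma sets_tilted_walk [simp, measurable_cong]: "sets (tilted_walk k) = sets paths"
  by (simp add: tilted_walk_def)

lemma space_tilted_walk [simp]: "space (tilted_walk k) = UNIV"
  by (simp add: tilted_walk_def)

lemma nn_integral_tilted_walk:
  assumes "f \<in> borel_measurable paths"
  shows "(\<integral>\<^sup>+x. f x \<partial>tilted_walk k) = (\<integral>\<^sup>+x. boundary_weight k (bnd x) * f x \<partial>walk \<mu> k)"
  unfolding tilted_walk_def using assms by (subst nn_integral_density) auto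

lemma tilted_walk_bnd:
  assumes C[measurable]: "C \<in> sets B0"
  shows "emeasure (tilted_walk k) (bnd -` C) = emeasure B0 C"
proof -
  have s: "bnd -` C \<in> sets paths" using measurable_sets[OF measurable_bnd C] by simp
  have "emeasure (tilted_walk k) (bnd -` C) = (\<integral>\<^sup>+x. boundary_weight k (bnd x) * indicator (bnd -` C) x \<partial>walk \<mu> k)"
    unfolding tilted_walk_def using s by (subst emeasure_density) auto
  also have "\<dots> = (\<integral>\<^sup>+x. (\<lambda>b. boundary_weight k b * indicator C b) (bnd x) \<partial>walk \<mu> k)"
    by (intro nn_integral_cong) (auto simp: indicator_def)
  also have "\<dots> = (\<integral>\<^sup>+b. boundary_weight k b * indicator C b \<partial>distr (walk \<mu> k) B0 bnd)"
    by (subst nn_integral_distr) auto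
  also have "\<dots> = emeasure (density (distr B0 B0 (a0 k)) (boundary_weight k)) C"
    unfolding distr_walk_bnd using C by (subst emeasure_density) auto
  finally show ?thesis unfolding density_boundary_weight .
qed

lemma prob_space_tilted_walk: "prob_space (tilted_walk k)"
  using tilted_walk_bnd[of UNIV k] prob_space.emeasure_space_1[OF prob_space_B0] sets.top[of B0]
  by (intro prob_spaceI) simp

text \<open>This is where the maximality of the Poisson boundary enters. An invariant event is a
  boundary event modulo null sets of every walk, hence also for the reweighted walk, and both
  measures have boundary law \<open>B0\<close>.\<close>

lemma tilted_walk_invariant:
  assumes A: "A \<in> sets paths" and inv: "path_shift -` A = A"
  shows "emeasure (walk \<mu> 0) A = emeasure (tilted_walk k) A"
proof -
  obtain C where C: "C \<in> sets B0" "\<And>h. emeasure (walk \<mu> h) ((A - bnd -` C) \<union> (bnd -` C - A)) = 0"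
  proof -
    have "\<forall>A\<in>sets paths. path_shift -` A = A \<longrightarrow>
        (\<exists>C\<in>sets B0. \<forall>h. emeasure (walk \<mu> h) ((A - bnd -` C) \<union> (bnd -` C - A)) = 0)"
      using boundary unfolding poisson_boundary_def by (elim conjE)
    from this[rule_format, OF A inv] show ?thesis using that by metis
  qed
  have s[measurable]: "bnd -` C \<in> sets paths" using measurable_sets[OF measurable_bnd C(1)] by simp
  note A[measurable]
  have null: "(A - bnd -` C) \<union> (bnd -` C - A) \<in> null_sets (walk \<mu> h)" for h
    using C(2) by (auto simp: null_sets_def)
  have AE: "AE x in walk \<mu> h. x \<in> A \<longleftrightarrow> x \<in> bnd -` C" for h
    using AE_not_in[OF null[of h]] by (rule eventually_mono) auto
  have AE': "AE x in tilted_walk k. x \<in> A \<longleftrightarrow> x \<in> bnd -` C"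
    unfolding tilted_walk_def using AE[of k] by (subst AE_density) (auto elim!: eventually_mono)
  have "emeasure (walk \<mu> 0) A = emeasure (walk \<mu> 0) (bnd -` C)"
    using AE[of 0] by (intro emeasure_eq_AE) auto
  also have "\<dots> = emeasure (distr (walk \<mu> 0) B0 bnd) C"
    using C by (simp add: emeasure_distr)
  also have "\<dots> = emeasure (tilted_walk k) (bnd -` C)"
    unfolding distr_bnd by (simp add: tilted_walk_bnd C)
  also have "\<dots> = emeasure (tilted_walk k) A"
    using AE' by (intro emeasure_eq_AE) auto
  finally show ?thesis .
qed

section \<open>Conditional laws of the positions given the boundary point\<close>

abbreviation CB :: "('g \<times> 'c) measure" where
  "CB \<equiv> count_space UNIV \<Otimes>\<^sub>M B0"

definition translate :: "'g \<Rightarrow> 'g \<times> 'c \<Rightarrow> 'g \<times> 'c" where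
  "translate k p = (- k + fst p, a0 (- k) (snd p))"

lemma measurable_translate [measurable]: "translate k \<in> measurable CB CB"
proof -
  have "(\<lambda>p. - k + fst p) \<in> measurable CB (count_space UNIV)"
    by (rule measurable_compose[OF measurable_fst]) simp
  moreover have "(\<lambda>p. a0 (- k) (snd p)) \<in> measurable CB B0" by measurable
  ultimately show ?thesis unfolding translate_def[abs_def] by (rule measurable_Pair)
qed

lemma pair_sigma_finite_CB: "pair_sigma_finite (count_space (UNIV::'g set)) B0"
  by (intro pair_sigma_finite.intro sigma_finite_measure_count_space_countable
      prob_space_imp_sigma_finite prob_space_B0) simp

lemma nn_integral_CB:
  "f \<in> borel_measurable CB \<Longrightarrow> (\<integral>\<^sup>+p. f p \<partial>CB) = (\<integral>\<^sup>+b. \<integral>\<^sup>+g. f (g, b) \<partial>count_space UNIV \<partial>B0)"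
  by (rule pair_sigma_finite.nn_integral_snd[OF pair_sigma_finite_CB, symmetric])

lemma measurable_nn_integral_group:
  assumes f: "f \<in> borel_measurable CB"
  shows "(\<lambda>b. \<integral>\<^sup>+g. f (g, b) \<partial>count_space UNIV) \<in> borel_measurable B0"
  using sigma_finite_measure.borel_measurable_nn_integral_fst[OF sigma_finite_measure_count_space_countable,
      of "UNIV::'g set" "\<lambda>(b, g). f (g, b)" B0] f
  by (simp add: measurable_pair_swap_iff[of _ "count_space UNIV"] case_prod_beta)

definition position_law :: "nat \<Rightarrow> ('g \<times> 'c) measure" where
  "position_law n = distr (walk \<mu> 0) CB (\<lambda>x. (x n, bnd x))"

text \<open>The boundary marginal of the joint law is \<open>B0\<close>, and counting measure has no
  nonempty null sets. So a null set of \<open>CB\<close> misses the whole fibre over almost every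
  \<open>b\<close> and is null for the joint law; Radon-Nikodym does the rest.\<close>

lemma position_density_exists:
  "\<exists>r. r \<in> borel_measurable CB \<and> (\<forall>p. 0 \<le> r p) \<and> position_law n = density CB (\<lambda>p. ennreal (r p))"
proof -
  interpret CB: pair_sigma_finite "count_space (UNIV::'g set)" B0 by (rule pair_sigma_finite_CB)
  interpret W: prob_space "walk \<mu> 0" by (rule prob_space_walk)
  interpret J: prob_space "position_law n" unfolding position_law_def by (rule W.prob_space_distr) measurable
  have sets: "sets (position_law n) = sets CB" by (simp add: position_law_def)
  have ac: "absolutely_continuous CB (position_law n)"
  proof (unfold absolutely_continuous_def, rule subsetI)
    fix N assume N: "N \<in> null_sets CB"
    then have Nm[measurable]: "N \<in> sets CB" by auto
    have "(\<integral>\<^sup>+p. indicator N p \<partial>CB) = 0" using null_setsD1[OF N] by simp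
    then have "(\<integral>\<^sup>+b. \<integral>\<^sup>+g. indicator N (g, b) \<partial>count_space UNIV \<partial>B0) = 0"
      by (subst (asm) nn_integral_CB) auto
    then have "AE b in B0. (\<integral>\<^sup>+g. indicator N (g, b) \<partial>count_space UNIV) = 0"
      by (subst (asm) nn_integral_0_iff_AE) auto
    then have "AE b in B0. \<forall>g. (g, b) \<notin> N"
      by (rule eventually_mono) (auto simp: nn_integral_0_iff_AE AE_count_space indicator_eq_0_iff)
    then have "AE b in distr (walk \<mu> 0) B0 bnd. \<forall>g. (g, b) \<notin> N" unfolding distr_bnd .
    then have "AE x in walk \<mu> 0. \<forall>g. (g, bnd x) \<notin> N"
      by (rule AE_distrD[rotated]) measurable
    then have "AE x in walk \<mu> 0. (x n, bnd x) \<notin> N" by (rule eventually_mono) auto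
    then have "AE p in position_law n. p \<notin> N"
      unfolding position_law_def by (subst AE_distr_iff) auto
    then show "N \<in> null_sets (position_law n)"
      using Nm sets by (subst (asm) AE_iff_null_sets[symmetric]) auto
  qed
  obtain D where D: "D \<in> borel_measurable CB" "AE x in CB. RN_deriv CB (position_law n) x = ennreal (D x)" "\<And>x. 0 \<le> D x"
    using CB.real_RN_deriv[OF J.finite_measure_axioms ac sets] by metis
  have "position_law n = density CB (RN_deriv CB (position_law n))"
    by (rule CB.density_RN_deriv[OF ac sets, symmetric])
  also have "\<dots> = density CB (\<lambda>p. ennreal (D p))"
    using D by (intro density_cong) auto
  finally show ?thesis using D by blast
qed

text \<open>\<open>position_density n (g, b)\<close> is the conditional probability that the walk is at \<open>g\<close> at time \<open>n\<close>
  given its boundary point \<open>b\<close>.\<close>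

definition position_density :: "nat \<Rightarrow> 'g \<times> 'c \<Rightarrow> real" where
  "position_density n = (SOME r. r \<in> borel_measurable CB \<and> (\<forall>p. 0 \<le> r p) \<and> position_law n = density CB (\<lambda>p. ennreal (r p)))"

lemma position_density:
  "position_density n \<in> borel_measurable CB \<and> (\<forall>p. 0 \<le> position_density n p) \<and>
   position_law n = density CB (\<lambda>p. ennreal (position_density n p))"
  unfolding position_density_def by (rule someI_ex[OF position_density_exists[of n]])

lemma measurable_position_density [measurable]: "position_density n \<in> borel_measurable CB"
  using position_density by blast

lemma position_density_nonneg: "0 \<le> position_density n p"
  using position_density by blast

lemma position_law_eq: "position_law n = density CB (\<lambda>p. ennreal (position_density n p))"
  using position_density by blast

text \<open>A walk from \<open>k\<close> is \<open>k\<close> times a walk from the identity, and its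
  boundary point moves along. Substituting \<open>a0 k b\<close> for the boundary point produces the
  image of \<open>B0\<close>, and the weight is exactly the density that turns this image back into
  \<open>B0\<close>. So reweighting only translates both arguments of the conditional law.\<close>

lemma tilted_position_law:
  "distr (tilted_walk k) CB (\<lambda>x. (x n, bnd x)) = density CB (\<lambda>p. ennreal (position_density n (translate k p)))"
proof (rule measure_eqI)
  fix A assume "A \<in> sets (distr (tilted_walk k) CB (\<lambda>x. (x n, bnd x)))"
  then have A[measurable]: "A \<in> sets CB" by simp
  let ?r = "position_density n" and ?w = "boundary_weight k"
  have shiftm[measurable]: "(\<lambda>p. (k + fst p, a0 k (snd p))) \<in> measurable CB CB"
    using measurable_translate[of "- k"] by (simp add: translate_def[abs_def])
  define H where "H p = ?w (a0 k (snd p)) * indicator A (k + fst p, a0 k (snd p))" for p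
  have indm[measurable]: "(\<lambda>p. indicator A (k + fst p, a0 k (snd p)) :: ennreal) \<in> borel_measurable CB"
    by (rule measurable_compose[OF shiftm]) simp
  have Hm[measurable]: "H \<in> borel_measurable CB"
    unfolding H_def[abs_def] by measurable
  define \<Psi> where "\<Psi> b = (\<integral>\<^sup>+g. ennreal (?r (translate k (g, b))) * indicator A (g, b) \<partial>count_space UNIV)" for b
  have \<Psi>m[measurable]: "\<Psi> \<in> borel_measurable B0"
    unfolding \<Psi>_def[abs_def] by (rule measurable_nn_integral_group) measurable
  have "emeasure (distr (tilted_walk k) CB (\<lambda>x. (x n, bnd x))) A = (\<integral>\<^sup>+x. indicator A (x n, bnd x) \<partial>tilted_walk k)"
    by (subst nn_integral_distr[where M'=CB, symmetric]) auto
  also have "\<dots> = (\<integral>\<^sup>+x. ?w (bnd x) * indicator A (x n, bnd x) \<partial>walk \<mu> k)"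
    by (rule nn_integral_tilted_walk) measurable
  also have "\<dots> = (\<integral>\<^sup>+x. ?w (bnd x) * indicator A (x n, bnd x) \<partial>distr (walk \<mu> 0) paths (\<lambda>x n. k + x n))"
    using walk_translate[of \<mu> k 0] by simp
  also have "\<dots> = (\<integral>\<^sup>+x. ?w (bnd (\<lambda>n. k + x n)) * indicator A (k + x n, bnd (\<lambda>n. k + x n)) \<partial>walk \<mu> 0)"
    by (subst nn_integral_distr) auto
  also have "\<dots> = (\<integral>\<^sup>+x. H (x n, bnd x) \<partial>walk \<mu> 0)"
  proof (rule nn_integral_cong_AE)
    have "AE x in walk \<mu> 0. bnd (\<lambda>n. k + x n) = a0 k (bnd x)" by (rule AE_bnd_translate)
    then show "AE x in walk \<mu> 0. ?w (bnd (\<lambda>n. k + x n)) * indicator A (k + x n, bnd (\<lambda>n. k + x n)) = H (x n, bnd x)"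
      by (rule eventually_mono) (simp add: H_def)
  qed
  also have "\<dots> = (\<integral>\<^sup>+p. H p \<partial>position_law n)"
    unfolding position_law_def by (subst nn_integral_distr) auto
  also have "\<dots> = (\<integral>\<^sup>+p. ennreal (?r p) * H p \<partial>CB)"
    unfolding position_law_eq by (subst nn_integral_density) auto
  also have "\<dots> = (\<integral>\<^sup>+b. \<integral>\<^sup>+g. ennreal (?r (g, b)) * H (g, b) \<partial>count_space UNIV \<partial>B0)"
    by (rule nn_integral_CB) measurable
  also have "\<dots> = (\<integral>\<^sup>+b. ?w (a0 k b) * \<Psi> (a0 k b) \<partial>B0)"
  proof (rule nn_integral_cong)
    fix b
    have "bij_betw (\<lambda>g. k + g) UNIV (UNIV::'g set)" 
      by (rule bij_betw_byWitness[where f'="\<lambda>g. - k + g"]) (auto simp: add.assoc[symmetric])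
    then have "\<Psi> (a0 k b) = (\<integral>\<^sup>+g. ennreal (?r (translate k (k + g, a0 k b))) * indicator A (k + g, a0 k b) \<partial>count_space UNIV)"
      unfolding \<Psi>_def by (rule nn_integral_bij_count_space[symmetric])
    also have "\<dots> = (\<integral>\<^sup>+g. ennreal (?r (g, b)) * indicator A (k + g, a0 k b) \<partial>count_space UNIV)"
      by (simp add: translate_def add.assoc[symmetric])
    finally have \<Psi>: "\<Psi> (a0 k b) = \<dots>" .
    show "(\<integral>\<^sup>+g. ennreal (?r (g, b)) * H (g, b) \<partial>count_space UNIV) = ?w (a0 k b) * \<Psi> (a0 k b)"
      unfolding \<Psi> by (subst nn_integral_cmult[symmetric]) (auto simp: H_def mult_ac intro!: nn_integral_cong)
  qed
  also have "\<dots> = (\<integral>\<^sup>+b. ?w b * \<Psi> b \<partial>distr B0 B0 (a0 k))"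
    by (subst nn_integral_distr) auto
  also have "\<dots> = (\<integral>\<^sup>+b. \<Psi> b \<partial>density (distr B0 B0 (a0 k)) ?w)"
    by (subst nn_integral_density) auto
  also have "\<dots> = (\<integral>\<^sup>+p. ennreal (?r (translate k p)) * indicator A p \<partial>CB)"
    unfolding density_boundary_weight by (subst nn_integral_CB) (simp_all add: \<Psi>_def[abs_def])
  also have "\<dots> = emeasure (density CB (\<lambda>p. ennreal (?r (translate k p)))) A"
    by (subst emeasure_density) auto
  finally show "emeasure (distr (tilted_walk k) CB (\<lambda>x. (x n, bnd x))) A = \<dots>" .
qed simp

section \<open>Time averages of the conditional laws\<close>

definition avg_density :: "nat \<Rightarrow> 'g \<times> 'c \<Rightarrow> real" where
  "avg_density N p = (\<Sum>n<N. position_density n p) / N"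

lemma measurable_avg_density [measurable]: "avg_density N \<in> borel_measurable CB"
  unfolding avg_density_def[abs_def] by measurable

lemma avg_density_nonneg: "0 \<le> avg_density N p"
  unfolding avg_density_def by (intro divide_nonneg_nonneg sum_nonneg position_density_nonneg) simp

lemma integral_position:
  fixes s :: "'g \<times> 'c \<Rightarrow> real"
  assumes P: "prob_space P" "sets P = sets paths" and r[measurable]: "r \<in> borel_measurable CB" and r0: "\<And>p. 0 \<le> r p"
    and distr: "distr P CB (\<lambda>x. (x n, bnd x)) = density CB (\<lambda>p. ennreal (r p))"
    and s[measurable]: "s \<in> borel_measurable CB" and s1: "\<And>p. \<bar>s p\<bar> \<le> 1"
  shows "integrable CB (\<lambda>p. r p * s p)" "(\<integral>x. s (x n, bnd x) \<partial>P) = (\<integral>p. r p * s p \<partial>CB)"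
    "integrable P (\<lambda>x. s (x n, bnd x))"
proof -
  interpret P: prob_space P by fact
  note P(2)[measurable_cong]
  interpret D: prob_space "distr P CB (\<lambda>x. (x n, bnd x))" by (rule P.prob_space_distr) measurable
  have "integrable (distr P CB (\<lambda>x. (x n, bnd x))) s"
    using s1 by (intro D.integrable_const_bound[where B=1]) auto
  then show "integrable CB (\<lambda>p. r p * s p)"
    unfolding distr using r0 by (subst (asm) integrable_real_density) auto
  have "(\<integral>x. s (x n, bnd x) \<partial>P) = (\<integral>p. s p \<partial>distr P CB (\<lambda>x. (x n, bnd x)))"
    by (subst integral_distr) auto
  also have "\<dots> = (\<integral>p. r p * s p \<partial>CB)"
    unfolding distr using r0 by (subst integral_real_density) auto
  finally show "(\<integral>x. s (x n, bnd x) \<partial>P) = (\<integral>p. r p * s p \<partial>CB)" .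
  show "integrable P (\<lambda>x. s (x n, bnd x))"
    using s1 by (intro P.integrable_const_bound[where B=1]) auto
qed

text \<open>The integral is an L^1 distance, realised by the sign \<open>s\<close> of the
  difference. Averaging \<open>s\<close> along the path gives a nearly shift-invariant function
  \<open>u\<close>. The walk and the reweighted walk agree on shift-invariant events, so their
  integrals of \<open>u\<close> nearly agree.\<close>

lemma avg_density_almost_equivariant:
  assumes "\<epsilon> > 0"
  shows "\<exists>N0. \<forall>N\<ge>N0. (\<integral>\<^sup>+p. ennreal \<bar>avg_density N p - avg_density N (translate k p)\<bar> \<partial>CB) \<le> ennreal \<epsilon>"
proof -
  obtain \<delta> where "\<delta> > 0" and \<delta>: "\<And>u. u \<in> borel_measurable (walk \<mu> 0) \<Longrightarrow> 
      (\<And>x. \<bar>u x\<bar> \<le> 1 \<and> \<bar>u (path_shift x) - u x\<bar> \<le> \<delta>) \<Longrightarrow>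
      (\<integral>x. u x \<partial>walk \<mu> 0) - (\<integral>x. u x \<partial>tilted_walk k) < \<epsilon>"
  proof -
    have "path_shift \<in> measurable (walk \<mu> 0) (walk \<mu> 0)" by measurable
    from almost_invariant_functions_cannot_separate[OF prob_space_walk prob_space_tilted_walk _ this _ assms, of k]
    show ?thesis using tilted_walk_invariant that by auto
  qed
  have "(\<integral>\<^sup>+p. ennreal \<bar>avg_density N p - avg_density N (translate k p)\<bar> \<partial>CB) \<le> ennreal \<epsilon>"
    if N: "N \<ge> Suc (nat \<lceil>2 / \<delta>\<rceil>)" for N
  proof -
    have "N > 0" using N by simp
    have "2 / \<delta> \<le> real N" using N by linarith
    then have N\<delta>: "2 / real N \<le> \<delta>" using \<open>\<delta> > 0\<close> \<open>N > 0\<close> by (simp add: field_simps)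
    define f where "f = avg_density N"
    define s where "s p = (if f (translate k p) \<le> f p then 1 else - 1 :: real)" for p
    have fm[measurable]: "f \<in> borel_measurable CB" unfolding f_def by measurable
    have sm[measurable]: "s \<in> borel_measurable CB" unfolding s_def[abs_def] by measurable
    have s1: "\<bar>s p\<bar> \<le> 1" for p by (simp add: s_def)
    \<comment> \<open>Uses the boundary point of the tail instead of \<open>bnd x\<close>: shifting
      the path then turns \<open>c n\<close> into \<open>c (Suc n)\<close> for every single path, as
      the separation lemma requires. The two boundary points agree almost surely, which suffices for
      the integrals.\<close>
    define c where "c n x = s (x n, bnd ((path_shift ^^ n) x))" for n x
    have c1: "\<bar>c n x\<bar> \<le> 1" for n x by (simp add: c_def s1)
    have cm[measurable]: "c n \<in> borel_measurable paths" for n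
    proof -
      have [measurable]: "path_shift ^^ n \<in> measurable paths paths" by (induction n) auto
      show ?thesis unfolding c_def[abs_def] by measurable
    qed
    have c_shift: "c n (path_shift x) = c (Suc n) x" for n x
    proof -
      have "path_shift x n = x (Suc n)" by (simp add: path_shift_def)
      moreover have "(path_shift ^^ n) (path_shift x) = (path_shift ^^ Suc n) x"
        by (simp only: funpow_Suc_right o_apply)
      ultimately show ?thesis by (simp only: c_def)
    qed
    define u where "u x = (\<Sum>n<N. c n x) / N" for x
    have um[measurable]: "u \<in> borel_measurable paths" unfolding u_def[abs_def] by measurable
    have u1: "\<bar>u x\<bar> \<le> 1" for x
    proof -
      have "\<bar>\<Sum>n<N. c n x\<bar> \<le> (\<Sum>n<N. 1)" by (rule order_trans[OF sum_abs sum_mono]) (rule c1)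
      then show ?thesis using \<open>N > 0\<close> by (simp add: u_def)
    qed
    have u2: "\<bar>u (path_shift x) - u x\<bar> \<le> \<delta>" for x
    proof -
      have "u (path_shift x) - u x = (\<Sum>n<N. (c (Suc n) x - c n x)) / N"
        by (simp add: u_def c_shift sum_subtractf diff_divide_distrib)
      also have "(\<Sum>n<N. (c (Suc n) x - c n x)) = c N x - c 0 x"
        by (rule sum_lessThan_telescope[of "\<lambda>n. c n x"])
      also have "\<bar>(c N x - c 0 x) / N\<bar> \<le> 2 / N"
        using c1[of N x] c1[of 0 x] \<open>N > 0\<close> by (simp add: divide_right_mono abs_le_iff)
      finally show ?thesis using N\<delta> by simp
    qed
    have lt: "(\<integral>x. u x \<partial>walk \<mu> 0) - (\<integral>x. u x \<partial>tilted_walk k) < \<epsilon>"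
      by (rule \<delta>) (use u1 u2 um in simp_all)
    \<comment> \<open>Stated for a general path measure \<open>P\<close> so as to serve both the
      walk and the reweighted walk.\<close>
    have int: "integrable CB (\<lambda>p. (\<Sum>n<N. r n p) / N * s p) \<and> (\<integral>x. u x \<partial>P) = (\<integral>p. (\<Sum>n<N. r n p) / N * s p \<partial>CB)"
      if P: "prob_space P" "sets P = sets paths" "AE x in P. \<forall>n. bnd ((path_shift ^^ n) x) = bnd x"
        and r: "\<And>n. r n \<in> borel_measurable CB" "\<And>n p. 0 \<le> r n p"
        "\<And>n. distr P CB (\<lambda>x. (x n, bnd x)) = density CB (\<lambda>p. ennreal (r n p))"
      for P and r :: "nat \<Rightarrow> 'g \<times> 'c \<Rightarrow> real"
    proof -
      note P(2)[measurable_cong]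
      note i = integral_position[OF P(1,2) r sm s1]
      have eq: "(\<Sum>n<N. r n p) / N * s p = (\<Sum>n<N. r n p * s p) / N" for p
        by (simp add: sum_distrib_right)
      have "(\<integral>x. u x \<partial>P) = (\<integral>x. (\<Sum>n<N. s (x n, bnd x)) / N \<partial>P)"
      proof (rule integral_cong_AE)
        show "AE x in P. u x = (\<Sum>n<N. s (x n, bnd x)) / N"
          using P(3) by (rule eventually_mono) (simp add: u_def c_def)
      qed measurable
      also have "\<dots> = (\<Sum>n<N. (\<integral>x. s (x n, bnd x) \<partial>P)) / N"
        using i(3) by (simp add: Bochner_Integration.integral_sum)
      also have "\<dots> = (\<Sum>n<N. (\<integral>p. r n p * s p \<partial>CB)) / N"
        using i(2) by simp
      also have "\<dots> = (\<integral>p. (\<Sum>n<N. r n p) / N * s p \<partial>CB)"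
        unfolding eq using i(1) by (simp add: Bochner_Integration.integral_sum)
      finally show ?thesis unfolding eq using i(1) by simp
    qed
    have 1: "integrable CB (\<lambda>p. f p * s p) \<and> (\<integral>x. u x \<partial>walk \<mu> 0) = (\<integral>p. f p * s p \<partial>CB)"
      unfolding f_def avg_density_def
      by (rule int) (auto intro: prob_space_walk AE_bnd_funpow_shift position_density_nonneg
          position_law_eq[unfolded position_law_def])
    have 2: "integrable CB (\<lambda>p. f (translate k p) * s p) \<and> (\<integral>x. u x \<partial>tilted_walk k) = (\<integral>p. f (translate k p) * s p \<partial>CB)"
      unfolding f_def avg_density_def
    proof (rule int)
      show "AE x in tilted_walk k. \<forall>n. bnd ((path_shift ^^ n) x) = bnd x"
        unfolding tilted_walk_def using AE_bnd_funpow_shift[of k]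
        by (subst AE_density) (auto elim!: eventually_mono)
      show "(\<lambda>p. position_density n (translate k p)) \<in> borel_measurable CB" for n by measurable
    qed (auto intro: prob_space_tilted_walk position_density_nonneg tilted_position_law)
    have abs: "f p * s p - f (translate k p) * s p = \<bar>f p - f (translate k p)\<bar>" for p
      by (simp add: s_def)
    have "integrable CB (\<lambda>p. f p * s p - f (translate k p) * s p)" using 1 2 by simp
    then have "integrable CB (\<lambda>p. \<bar>f p - f (translate k p)\<bar>)" unfolding abs .
    then have "(\<integral>\<^sup>+p. ennreal \<bar>f p - f (translate k p)\<bar> \<partial>CB) = ennreal (\<integral>p. \<bar>f p - f (translate k p)\<bar> \<partial>CB)"
      by (rule nn_integral_eq_integral) simp
    also have "(\<integral>p. \<bar>f p - f (translate k p)\<bar> \<partial>CB) = (\<integral>x. u x \<partial>walk \<mu> 0) - (\<integral>x. u x \<partial>tilted_walk k)"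
      using 1 2 by (simp add: abs[symmetric])
    also have "ennreal \<dots> \<le> ennreal \<epsilon>" using lt by (intro ennreal_leI) simp
    finally show ?thesis unfolding f_def .
  qed
  then show ?thesis by blast
qed

lemma nn_integral_avg_density:
  assumes H[measurable]: "H \<in> borel_measurable CB" and N: "N > 0"
  shows "(\<integral>\<^sup>+p. ennreal (avg_density N p) * H p \<partial>CB) = (\<Sum>n<N. (\<integral>\<^sup>+x. H (x n, bnd x) \<partial>walk \<mu> 0)) / N"
proof -
  have "(\<integral>\<^sup>+x. H (x n, bnd x) \<partial>walk \<mu> 0) = (\<integral>\<^sup>+p. ennreal (position_density n p) * H p \<partial>CB)" for n
  proof -
    have "(\<integral>\<^sup>+x. H (x n, bnd x) \<partial>walk \<mu> 0) = (\<integral>\<^sup>+p. H p \<partial>position_law n)"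
      unfolding position_law_def by (subst nn_integral_distr) auto
    also have "\<dots> = (\<integral>\<^sup>+p. ennreal (position_density n p) * H p \<partial>CB)"
      unfolding position_law_eq by (subst nn_integral_density) auto
    finally show ?thesis .
  qed
  then have "(\<Sum>n<N. (\<integral>\<^sup>+x. H (x n, bnd x) \<partial>walk \<mu> 0)) / N = (\<integral>\<^sup>+p. (\<Sum>n<N. ennreal (position_density n p) * H p) \<partial>CB) / N"
    by (subst nn_integral_sum) auto
  also have "\<dots> = (\<integral>\<^sup>+p. (\<Sum>n<N. ennreal (position_density n p) * H p) / N \<partial>CB)"
    by (rule nn_integral_divide[symmetric]) measurable
  also have "\<dots> = (\<integral>\<^sup>+p. ennreal (avg_density N p) * H p \<partial>CB)"
  proof (rule nn_integral_cong)
    fix p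
    have "(\<Sum>n<N. ennreal (position_density n p) * H p) = (\<Sum>n<N. ennreal (position_density n p)) * H p"
      by (rule sum_distrib_right[symmetric])
    also have "(\<Sum>n<N. ennreal (position_density n p)) = ennreal (\<Sum>n<N. position_density n p)"
      by (rule sum_ennreal) (rule position_density_nonneg)
    finally have "(\<Sum>n<N. ennreal (position_density n p) * H p) / N = (ennreal (\<Sum>n<N. position_density n p) / ennreal (real N)) * H p"
      by (simp only: ennreal_of_nat_eq_real_of_nat divide_ennreal_def mult_ac)
    also have "ennreal (\<Sum>n<N. position_density n p) / ennreal (real N) = ennreal (avg_density N p)"
      unfolding avg_density_def using N by (intro divide_ennreal sum_nonneg position_density_nonneg) auto
    finally show "(\<Sum>n<N. ennreal (position_density n p) * H p) / N = ennreal (avg_density N p) * H p" .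
  qed
  finally show ?thesis ..
qed

text \<open>Testing against boundary events shows that the total mass is a density of
  \<open>B0\<close> with respect to itself, so uniqueness of densities makes it 1 almost
  everywhere.\<close>

lemma avg_density_sum:
  assumes "N > 0"
  shows "AE b in B0. (\<integral>\<^sup>+g. ennreal (avg_density N (g, b)) \<partial>count_space UNIV) = 1"
proof -
  interpret B: prob_space B0 by (rule prob_space_B0)
  have m[measurable]: "(\<lambda>b. \<integral>\<^sup>+g. ennreal (avg_density N (g, b)) \<partial>count_space UNIV) \<in> borel_measurable B0"
    by (rule measurable_nn_integral_group) measurable
  show ?thesis
  proof (rule B.density_unique2[OF m])
    fix C assume C[measurable]: "C \<in> sets B0"
    have "(\<integral>\<^sup>+b\<in>C. (\<integral>\<^sup>+g. ennreal (avg_density N (g, b)) \<partial>count_space UNIV) \<partial>B0) = 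
       (\<integral>\<^sup>+b. \<integral>\<^sup>+g. ennreal (avg_density N (g, b)) * indicator C b \<partial>count_space UNIV \<partial>B0)"
      by (simp add: nn_integral_multc)
    also have "\<dots> = (\<integral>\<^sup>+p. ennreal (avg_density N p) * indicator C (snd p) \<partial>CB)"
      by (subst nn_integral_CB) auto
    also have "\<dots> = (\<Sum>n<N. (\<integral>\<^sup>+x. indicator C (bnd x) \<partial>walk \<mu> 0)) / N"
      using assms by (subst nn_integral_avg_density) auto
    also have "(\<integral>\<^sup>+x. indicator C (bnd x) \<partial>walk \<mu> 0) = emeasure (distr (walk \<mu> 0) B0 bnd) C"
      by (subst nn_integral_distr[where f="indicator C" and M'=B0, symmetric]) auto
    also have "(\<Sum>n<N. \<dots>) / N = emeasure B0 C"
      unfolding distr_bnd by (rule ennreal_avg_const[OF assms])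
    finally show "(\<integral>\<^sup>+b\<in>C. (\<integral>\<^sup>+g. ennreal (avg_density N (g, b)) \<partial>count_space UNIV) \<partial>B0) = (\<integral>\<^sup>+b\<in>C. 1 \<partial>B0)"
      by simp
  qed simp
qed

text \<open>The test function ignores the boundary coordinate, so only the unconditional law of the
  position matters, and translating a stationary measure by that law preserves it on average. No map
  from \<open>M\<close> to the boundary is involved.\<close>

lemma avg_density_stationary:
  assumes "measurable_action M a" "stationary \<mu> M a" "A \<in> sets M" "N > 0"
  shows "(\<integral>\<^sup>+p. ennreal (avg_density N p) * emeasure M {y \<in> space M. a (fst p) y \<in> A} \<partial>CB) = emeasure M A"
proof -
  have id: "{y \<in> space M. a 0 y \<in> A} = A"
    using assms(1) sets.sets_into_space[OF assms(3)] by (auto simp: measurable_action_def subset_iff)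
  have "(\<lambda>p. emeasure M {y \<in> space M. a (fst p) y \<in> A}) \<in> borel_measurable CB"
    by (rule measurable_compose[OF measurable_fst]) simp
  then have "(\<integral>\<^sup>+p. ennreal (avg_density N p) * emeasure M {y \<in> space M. a (fst p) y \<in> A} \<partial>CB) = 
     (\<Sum>n<N. (\<integral>\<^sup>+x. emeasure M {y \<in> space M. a (x n) y \<in> A} \<partial>walk \<mu> 0)) / N"
    using assms by (subst nn_integral_avg_density) auto
  also have "\<dots> = (\<Sum>n<N. emeasure M A) / N"
    using assms by (simp add: walk_marginal_stationary id)
  also have "\<dots> = emeasure M A"
    by (rule ennreal_avg_const[OF assms(4)])
  finally show ?thesis .
qed

end

section \<open>Rounding to integer masses\<close>

lemma finite_to_nat_less: "finite {g::'g::countable. to_nat g < j}"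
  by (rule finite_imageD[of to_nat]) (auto intro: finite_subset[of _ "{..<j}"] inj_on_subset[OF inj_to_nat])

text \<open>Facts about a probability vector \<open>l\<close>. The exhausting finite sets always
  contain \<open>z\<close>, the point that absorbs the rounding error later.\<close>

lemma count_space_mass_one:
  fixes l :: "'g::countable \<Rightarrow> real"
  assumes l0: "\<And>g. 0 \<le> l g" and sum: "(\<integral>\<^sup>+g. ennreal (l g) \<partial>count_space UNIV) = 1"
  shows "finite F \<Longrightarrow> sum l F \<le> 1"
    and "(\<lambda>j. sum l (insert z {g. to_nat g < j})) \<longlonglongrightarrow> 1"
    and "finite F \<Longrightarrow> (\<integral>\<^sup>+g. ennreal (l g) * indicator (- F) g \<partial>count_space UNIV) = ennreal (1 - sum l F)"
proof -
  have ind: "(\<integral>\<^sup>+g. ennreal (l g) * indicator F g \<partial>count_space UNIV) = ennreal (sum l F)" if "finite F" for F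
    using that l0 by (simp add: nn_integral_count_space_indicator[symmetric] nn_integral_count_space_finite sum_ennreal)
  have "ennreal (sum l F) \<le> 1" if "finite F" for F
    unfolding ind[OF that, symmetric] sum[symmetric]
    by (intro nn_integral_mono) (auto simp: indicator_def)
  then show le: "sum l F \<le> 1" if "finite F" for F using that by simp
  show "(\<integral>\<^sup>+g. ennreal (l g) * indicator (- F) g \<partial>count_space UNIV) = ennreal (1 - sum l F)" if "finite F"
  proof -
    have "1 = (\<integral>\<^sup>+g. ennreal (l g) * indicator F g + ennreal (l g) * indicator (- F) g \<partial>count_space UNIV)"
      unfolding sum[symmetric] by (intro nn_integral_cong) (auto simp: indicator_def)
    also have "\<dots> = ennreal (sum l F) + (\<integral>\<^sup>+g. ennreal (l g) * indicator (- F) g \<partial>count_space UNIV)"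
      by (subst nn_integral_add) (auto simp: ind[OF that])
    finally have "(\<integral>\<^sup>+g. ennreal (l g) * indicator (- F) g \<partial>count_space UNIV) = 1 - ennreal (sum l F)"
      by (metis ennreal_add_diff_cancel_left ennreal_neq_top)
    also have "\<dots> = ennreal (1 - sum l F)"
      using ennreal_minus[of "sum l F" 1] l0 by (simp add: sum_nonneg)
    finally show ?thesis .
  qed
  define F where "F j = insert z {g::'g. to_nat g < j}" for j
  have finF: "finite (F j)" for j by (simp add: F_def finite_to_nat_less)
  have "(\<lambda>j. \<integral>\<^sup>+g. ennreal (l g) * indicator (F j) g \<partial>count_space UNIV) \<longlonglongrightarrow> (\<integral>\<^sup>+g. ennreal (l g) \<partial>count_space UNIV)"
  proof (rule nn_integral_LIMSEQ)
    show "incseq (\<lambda>j g. ennreal (l g) * indicator (F j) g)"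
      by (auto simp: incseq_def le_fun_def F_def indicator_def)
    fix g
    have "eventually (\<lambda>j. ennreal (l g) * indicator (F j) g = ennreal (l g)) sequentially"
      using eventually_gt_at_top[of "to_nat g"] by (rule eventually_mono) (auto simp: F_def)
    then show "(\<lambda>j. ennreal (l g) * indicator (F j) g) \<longlonglongrightarrow> ennreal (l g)" by (rule tendsto_eventually)
  qed simp
  then have "(\<lambda>j. ennreal (sum l (F j))) \<longlonglongrightarrow> ennreal 1"
    unfolding ind[OF finF] sum by simp
  then show "(\<lambda>j. sum l (insert z {g. to_nat g < j})) \<longlonglongrightarrow> 1"
    unfolding F_def[symmetric] by (subst (asm) tendsto_ennreal_iff) (auto intro!: always_eventually sum_nonneg l0)
qed

text \<open>All mass lost by rounding down is put on \<open>z\<close>; the second alternative only serves to make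
  the total mass exactly \<open>M\<close> for every \<open>l\<close>.\<close>

definition round_mass :: "'g set \<Rightarrow> 'g \<Rightarrow> nat \<Rightarrow> ('g \<Rightarrow> real) \<Rightarrow> 'g \<Rightarrow> nat" where
  "round_mass F z M l g =
     (if g \<notin> F then 0
      else if (\<Sum>h\<in>F - {z}. nat \<lfloor>M * l h\<rfloor>) \<le> M
      then (if g = z then M - (\<Sum>h\<in>F - {z}. nat \<lfloor>M * l h\<rfloor>) else nat \<lfloor>M * l g\<rfloor>)
      else (if g = z then M else 0))"

lemma round_mass_outside: "g \<notin> F \<Longrightarrow> round_mass F z M l g = 0"
  by (simp add: round_mass_def)

lemma sum_round_mass:
  assumes "finite F" "z \<in> F"
  shows "(\<Sum>g\<in>F. round_mass F z M l g) = M"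
proof -
  have "(\<Sum>g\<in>F. round_mass F z M l g) = round_mass F z M l z + (\<Sum>g\<in>F - {z}. round_mass F z M l g)"
    using assms by (rule sum.remove)
  also have "(\<Sum>g\<in>F - {z}. round_mass F z M l g) = 
    (if (\<Sum>h\<in>F - {z}. nat \<lfloor>M * l h\<rfloor>) \<le> M then (\<Sum>h\<in>F - {z}. nat \<lfloor>M * l h\<rfloor>) else 0)"
    by (auto simp: round_mass_def intro!: sum.cong)
  finally show ?thesis using assms by (simp add: round_mass_def)
qed

text \<open>Each point of \<open>F\<close> other than \<open>z\<close> is off by at most 1/M. The
  point \<open>z\<close> absorbs all these errors and the mass outside \<open>F\<close>, while
  outside \<open>F\<close> that mass is lost; so both kinds of error count twice.\<close>

lemma round_mass_error:
  fixes l :: "'g \<Rightarrow> real"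
  assumes F: "finite F" "z \<in> F" and M: "M > 0" and l0: "\<And>g. 0 \<le> l g" 
    and l1: "\<And>F. finite F \<Longrightarrow> sum l F \<le> 1" and F': "finite F'"
  shows "(\<Sum>g\<in>F'. \<bar>round_mass F z M l g / M - l g\<bar>) \<le> 2 * (card F / M) + 2 * (1 - sum l F)"
proof -
  let ?m = "round_mass F z M l" and ?G = "F - {z}"
  let ?c = "\<lambda>h. nat \<lfloor>M * l h\<rfloor>"
  have c: "real (?c h) \<le> M * l h" "M * l h \<le> real (?c h) + 1" for h
    using l0[of h] by (simp_all add: of_nat_nat)
  have "real (\<Sum>h\<in>?G. ?c h) \<le> (\<Sum>h\<in>?G. M * l h)"
    unfolding of_nat_sum by (intro sum_mono c)
  also have "\<dots> \<le> real M * 1" unfolding sum_distrib_left[symmetric] using F l1 by (intro mult_left_mono) auto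
  finally have le: "(\<Sum>h\<in>?G. ?c h) \<le> M" by (simp del: of_nat_sum)
  have mG: "?m g = ?c g" if "g \<in> ?G" for g using that le by (simp add: round_mass_def)
  have mz: "real (?m z) = M - (\<Sum>h\<in>?G. real (?c h))" using F le by (simp add: round_mass_def of_nat_diff)
  have G: "\<bar>?m g / M - l g\<bar> \<le> 1 / M" if "g \<in> ?G" for g
  proof -
    have "real (?c g) / M - l g = (real (?c g) - M * l g) / M"
      using M by (simp add: diff_divide_distrib)
    then have "\<bar>?m g / M - l g\<bar> = \<bar>real (?c g) - M * l g\<bar> / M"
      unfolding mG[OF that] by (simp only: abs_divide abs_of_nat)
    also have "\<dots> \<le> 1 / M" using c[of g] M by (intro divide_right_mono) linarith+
    finally show ?thesis .
  qed
  have sG: "(\<Sum>g\<in>?G. \<bar>?m g / M - l g\<bar>) \<le> card F / M"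
  proof -
    have "(\<Sum>g\<in>?G. \<bar>?m g / M - l g\<bar>) \<le> (\<Sum>g\<in>?G. 1 / M)" by (rule sum_mono) (rule G)
    also have "\<dots> \<le> (\<Sum>g\<in>F. 1 / M)" using F by (intro sum_mono2) auto
    finally show ?thesis by simp
  qed
  have "sum l F = l z + sum l ?G" using F by (rule sum.remove)
  then have "?m z / M - l z = (1 - sum l F) - (\<Sum>g\<in>?G. (?m g / M - l g))"
    using M by (simp add: mz mG sum_subtractf sum_divide_distrib[symmetric] diff_divide_distrib)
  also have "\<bar>\<dots>\<bar> \<le> (1 - sum l F) + (\<Sum>g\<in>?G. \<bar>?m g / M - l g\<bar>)"
    using l1[OF F(1)] sum_abs[of "\<lambda>g. ?m g / M - l g" ?G] by linarith
  finally have z: "\<bar>?m z / M - l z\<bar> \<le> (1 - sum l F) + card F / M" using sG by linarith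
  have out: "(\<Sum>g\<in>F' - F. \<bar>?m g / M - l g\<bar>) \<le> 1 - sum l F"
  proof -
    have "(\<Sum>g\<in>F' - F. \<bar>?m g / M - l g\<bar>) = sum l (F' - F)"
      using l0 by (intro sum.cong) (auto simp: round_mass_outside)
    moreover have "sum l (F' - F) + sum l F = sum l ((F' - F) \<union> F)"
      using F F' by (intro sum.union_disjoint[symmetric]) auto
    moreover have "sum l ((F' - F) \<union> F) \<le> 1" using F F' by (intro l1) auto
    ultimately show ?thesis by linarith
  qed
  have "(\<Sum>g\<in>F'. \<bar>?m g / M - l g\<bar>) \<le> (\<Sum>g\<in>F \<union> (F' - F). \<bar>?m g / M - l g\<bar>)"
    using F F' by (intro sum_mono2) auto
  also have "\<dots> = (\<Sum>g\<in>F. \<bar>?m g / M - l g\<bar>) + (\<Sum>g\<in>F' - F. \<bar>?m g / M - l g\<bar>)"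
    using F F' by (intro sum.union_disjoint) auto
  also have "(\<Sum>g\<in>F. \<bar>?m g / M - l g\<bar>) = \<bar>?m z / M - l z\<bar> + (\<Sum>g\<in>?G. \<bar>?m g / M - l g\<bar>)"
    using F by (rule sum.remove)
  finally show ?thesis using z sG out by simp
qed

section \<open>Almost equivariant integer masses over the boundary\<close>

context poisson_space
begin

lemma AE_quasi_invariant:
  assumes AE: "AE b in B0. P b" and P: "{b. P b} \<in> sets B0"
  shows "AE b in B0. P (a0 g b)"
proof -
  have c: "{b. \<not> P b} \<in> sets B0"
    using sets.compl_sets[OF P] by (simp add: set_diff_eq)
  then have "emeasure B0 {b. \<not> P b} = 0" using AE by (subst (asm) AE_iff_measurable[OF c]) auto
  then have "emeasure B0 (a0 g -` {b. \<not> P b}) = 0" by (rule quasi_invariant[OF c])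
  then show ?thesis
    using vimage_a0[OF c, of g] by (subst AE_iff_measurable[of "a0 g -` {b. \<not> P b}"]) auto
qed

text \<open>Reiter's condition for the boundary action, in integer form: \<open>m b\<close> is
  \<open>M\<close> times a probability vector, nearly equivariant under \<open>K\<close>. The last
  clause records that these vectors still preserve stationary measures on average. Walk length,
  finite support and denominator are chosen in this order, each depending on the previous
  one.\<close>

lemma integer_reiter:
  fixes \<epsilon> :: real
  assumes K: "finite K" and \<epsilon>: "\<epsilon> > 0"
  obtains F and M :: nat and m :: "'c \<Rightarrow> 'g \<Rightarrow> nat" where "finite F" "M > 0"
    "\<And>b. (\<Sum>g\<in>F. m b g) = M" "\<And>b g. g \<notin> F \<Longrightarrow> m b g = 0"
    "\<And>g. (\<lambda>b. m b g) \<in> measurable B0 (count_space UNIV)"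
    "\<And>k. k \<in> K \<Longrightarrow> (\<integral>b. (\<Sum>g\<in>F \<union> (\<lambda>g. k + g) ` F. \<bar>real (m b g) - real (m (a0 (- k) b) (- k + g))\<bar>) \<partial>B0) \<le> \<epsilon> * M"
    "\<And>(N :: 'y measure) a A. prob_space N \<Longrightarrow> measurable_action N a \<Longrightarrow> stationary \<mu> N a \<Longrightarrow> A \<in> sets N \<Longrightarrow>
       \<bar>(\<integral>b. (\<Sum>g\<in>F. m b g / M * measure N {y \<in> space N. a g y \<in> A}) \<partial>B0) - measure N A\<bar> \<le> \<epsilon>"
proof -
  interpret B: prob_space B0 by (rule prob_space_B0)
  have "\<forall>k\<in>K. \<exists>N0. \<forall>N\<ge>N0. (\<integral>\<^sup>+p. ennreal \<bar>avg_density N p - avg_density N (translate k p)\<bar> \<partial>CB) \<le> ennreal (\<epsilon>/4)"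
    using avg_density_almost_equivariant \<epsilon> by simp
  then obtain N0 where N0: "\<And>k N. k \<in> K \<Longrightarrow> N \<ge> N0 k \<Longrightarrow> (\<integral>\<^sup>+p. ennreal \<bar>avg_density N p - avg_density N (translate k p)\<bar> \<partial>CB) \<le> ennreal (\<epsilon>/4)"
    by metis
  define N where "N = Suc (\<Sum>k\<in>K. N0 k)"
  have "N > 0" by (simp add: N_def)
  have NN0: "N \<ge> N0 k" if "k \<in> K" for k
    using member_le_sum[OF that _ K, of N0] by (simp add: N_def)
  define l where "l b g = avg_density N (g, b)" for b g
  have l0: "0 \<le> l b g" for b g by (simp add: l_def avg_density_nonneg)
  have lm[measurable]: "(\<lambda>b. l b g) \<in> borel_measurable B0" for g
    unfolding l_def by measurable
  have lsum: "AE b in B0. (\<integral>\<^sup>+g. ennreal (l b g) \<partial>count_space UNIV) = 1"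
    unfolding l_def using avg_density_sum[OF \<open>N > 0\<close>] .
  have lsumm: "{b. (\<integral>\<^sup>+g. ennreal (l b g) \<partial>count_space UNIV) = 1} \<in> sets B0"
  proof -
    have "(\<lambda>b. \<integral>\<^sup>+g. ennreal (avg_density N (g, b)) \<partial>count_space UNIV) \<in> borel_measurable B0"
      by (rule measurable_nn_integral_group) measurable
    then have "{b \<in> space B0. (\<integral>\<^sup>+g. ennreal (avg_density N (g, b)) \<partial>count_space UNIV) = 1} \<in> sets B0"
      by measurable
    then show ?thesis by (simp add: l_def)
  qed
  have lsumk: "AE b in B0. (\<integral>\<^sup>+g. ennreal (l (a0 k b) g) \<partial>count_space UNIV) = 1" for k
    by (rule AE_quasi_invariant[OF lsum lsumm])
  define Fj where "Fj j = insert 0 {g::'g. to_nat g < j}" for j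
  have finFj: "finite (Fj j)" for j by (simp add: Fj_def finite_to_nat_less)
  note tail = count_space_mass_one[where l="l _", OF l0]
  have lim: "(\<lambda>j. \<integral>b. 1 - sum (l (a0 k b)) (Fj j) \<partial>B0) \<longlonglongrightarrow> (\<integral>b. 0 \<partial>B0)" for k
  proof (rule integral_dominated_convergence[where w="\<lambda>_. 1"])
    have [measurable]: "(\<lambda>b. l (a0 k b) g) \<in> borel_measurable B0" for g
      by (rule measurable_compose[OF measurable_a0 lm])
    show "(\<lambda>b. 1 - sum (l (a0 k b)) (Fj j)) \<in> borel_measurable B0" for j by measurable
    show "AE b in B0. (\<lambda>j. 1 - sum (l (a0 k b)) (Fj j)) \<longlonglongrightarrow> 0"
      using lsumk[of k] by (rule eventually_mono)
        (use tail(2)[where z=0] in \<open>auto simp: Fj_def intro!: tendsto_eq_intros\<close>)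
    show "AE b in B0. norm (1 - sum (l (a0 k b)) (Fj j)) \<le> 1" for j
      using lsumk[of k] by (rule eventually_mono) (use tail(1)[OF _ finFj] sum_nonneg[OF l0] in \<open>auto simp: abs_le_iff\<close>)
  qed auto
  \<comment> \<open>The rounding error is needed at \<open>b\<close> and at its translates
    \<open>a0 (- k) b\<close>. As \<open>B0\<close> need not be invariant, the tails at the
    translates are controlled separately. The bound \<epsilon>/16, used for
    \<open>card F / M\<close> as well, makes the integral of \<open>e\<close> at most
    \<epsilon>/4.\<close>
  have "eventually (\<lambda>j. \<forall>k\<in>insert 0 K. (\<integral>b. 1 - sum (l (a0 (- k) b)) (Fj j) \<partial>B0) < \<epsilon> / 16) sequentially"
  proof (intro eventually_ball_finite ballI)
    fix k
    show "\<forall>\<^sub>F j in sequentially. (\<integral>b. 1 - sum (l (a0 (- k) b)) (Fj j) \<partial>B0) < \<epsilon> / 16"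
      using order_tendstoD(2)[OF lim[of "- k"], of "\<epsilon> / 16"] \<epsilon> by simp
  qed (use K in simp)
  then obtain j where j: "\<And>k. k \<in> insert 0 K \<Longrightarrow> (\<integral>b. 1 - sum (l (a0 (- k) b)) (Fj j) \<partial>B0) < \<epsilon> / 16"
    using eventually_happens'[OF sequentially_bot] by blast
  define F where "F = Fj j"
  have F: "finite F" "0 \<in> F" using finFj by (simp_all add: F_def Fj_def)
  define M where "M = Suc (nat \<lceil>16 * card F / \<epsilon>\<rceil>)"
  have M: "M > 0" by (simp add: M_def)
  have "16 * card F / \<epsilon> \<le> M" unfolding M_def by linarith
  then have Me: "card F / M \<le> \<epsilon> / 16" using M \<epsilon> by (simp add: field_simps)
  define m where "m b = round_mass F 0 M (l b)" for b
  define e where "e b = 2 * (card F / M) + 2 * (1 - sum (l b) F)" for b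
  have err: "(\<Sum>g\<in>F'. \<bar>m b g / M - l b g\<bar>) \<le> e b" 
    if "(\<integral>\<^sup>+g. ennreal (l b g) \<partial>count_space UNIV) = 1" "finite F'" for b F'
    unfolding m_def e_def by (rule round_mass_error[OF F M l0 tail(1)[OF that(1)] that(2)])
  have mm[measurable]: "(\<lambda>b. m b g) \<in> measurable B0 (count_space UNIV)" for g
    unfolding m_def round_mass_def by measurable
  have mM: "(\<Sum>g\<in>F. m b g) = M" for b unfolding m_def by (rule sum_round_mass[OF F])
  have mle: "m b g \<le> M" for b g
    using mM[of b] member_le_sum[of g F "m b"] F by (cases "g \<in> F") (auto simp: m_def round_mass_outside)
  have em[measurable]: "e \<in> borel_measurable B0" unfolding e_def[abs_def] by measurable
  have ae[measurable]: "(\<lambda>b. e (a0 k b)) \<in> borel_measurable B0" for k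
    by (rule measurable_compose[OF measurable_a0 em])
  have am[measurable]: "(\<lambda>b. m (a0 k b) g) \<in> measurable B0 (count_space UNIV)" for k g
    by (rule measurable_compose[OF measurable_a0 mm])
  have al[measurable]: "(\<lambda>b. l (a0 k b) g) \<in> borel_measurable B0" for k g
    by (rule measurable_compose[OF measurable_a0 lm])
  have e: "(\<integral>\<^sup>+b. ennreal (e (a0 (- k) b)) \<partial>B0) \<le> ennreal (\<epsilon> / 4)" if k: "k \<in> insert 0 K" for k
  proof -
    have bd: "AE b in B0. 0 \<le> 1 - sum (l (a0 (- k) b)) F \<and> 1 - sum (l (a0 (- k) b)) F \<le> 1"
      using lsumk[of "- k"] by (rule eventually_mono) (use tail(1)[OF _ F(1)] sum_nonneg[OF l0] in auto)
    have int: "integrable B0 (\<lambda>b. 1 - sum (l (a0 (- k) b)) F)"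
    proof (rule B.integrable_const_bound[where B=1])
      show "AE b in B0. norm (1 - sum (l (a0 (- k) b)) F) \<le> 1" using bd by (rule eventually_mono) auto
    qed measurable
    then have int': "integrable B0 (\<lambda>b. e (a0 (- k) b))" unfolding e_def by (intro Bochner_Integration.integrable_add integrable_mult_right) auto
    have "(\<integral>b. e (a0 (- k) b) \<partial>B0) = 2 * (card F / M) + 2 * (\<integral>b. 1 - sum (l (a0 (- k) b)) F \<partial>B0)"
    proof -
      have "measure B0 UNIV = 1" using B.prob_space by simp
      then have "(\<integral>b. c + 2 * f b \<partial>B0) = c + 2 * (\<integral>b. f b \<partial>B0)" if "integrable B0 f" for f and c :: real
        using that by simp
      from this[OF int] show ?thesis unfolding e_def .
    qed
    also have "\<dots> \<le> \<epsilon> / 4" using j[OF k] Me unfolding F_def[symmetric] by argo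
    finally have "(\<integral>b. e (a0 (- k) b) \<partial>B0) \<le> \<epsilon> / 4" .
    moreover have "(\<integral>\<^sup>+b. ennreal (e (a0 (- k) b)) \<partial>B0) = ennreal (\<integral>b. e (a0 (- k) b) \<partial>B0)"
      by (rule nn_integral_eq_integral[OF int'], rule eventually_mono[OF bd]) (simp add: e_def)
    ultimately show ?thesis by (simp add: ennreal_leI)
  qed
  have e0: "(\<integral>\<^sup>+b. ennreal (e b) \<partial>B0) \<le> ennreal (\<epsilon> / 4)" using e[of 0] by simp
  have enn: "AE b in B0. 0 \<le> e b" 
    using lsum by (rule eventually_mono) (use tail(1)[OF _ F(1)] in \<open>auto simp: e_def\<close>)
  show ?thesis
  proof (rule that[OF F(1) M mM _ mm])
    show "m b g = 0" if "g \<notin> F" for b g using that by (simp add: m_def round_mass_outside)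
  next
    fix k assume k: "k \<in> K"
    \<comment> \<open>Outside \<open>?G\<close> both masses vanish: \<open>m b\<close> lives on
      \<open>F\<close> and the translated mass on the translate of \<open>F\<close> by
      \<open>k\<close>.\<close>
    let ?G = "F \<union> (\<lambda>g. k + g) ` F"
    let ?d = "\<lambda>b. (\<Sum>g\<in>?G. \<bar>real (m b g) - real (m (a0 (- k) b) (- k + g))\<bar>)"
    let ?D = "\<lambda>b. \<integral>\<^sup>+g. ennreal \<bar>l b g - l (a0 (- k) b) (- k + g)\<bar> \<partial>count_space UNIV"
    have finG: "finite ?G" using F by simp
    have dm[measurable]: "?d \<in> borel_measurable B0" by measurable
    have "AE b in B0. ennreal (?d b / M) \<le> ennreal (e b) + ?D b + ennreal (e (a0 (- k) b))"
      using lsum lsumk[of "- k"]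
    proof eventually_elim
      case (elim b)
      let ?t = "\<lambda>g. \<bar>l b g - l (a0 (- k) b) (- k + g)\<bar>"
      have "?d b / M = (\<Sum>g\<in>?G. \<bar>m b g / M - m (a0 (- k) b) (- k + g) / M\<bar>)"
        using M by (simp add: sum_divide_distrib diff_divide_distrib[symmetric])
      also have "\<dots> \<le> (\<Sum>g\<in>?G. \<bar>m b g / M - l b g\<bar> + ?t g + \<bar>m (a0 (- k) b) (- k + g) / M - l (a0 (- k) b) (- k + g)\<bar>)"
        by (intro sum_mono) linarith
      also have "\<dots> = (\<Sum>g\<in>?G. \<bar>m b g / M - l b g\<bar>) + sum ?t ?G + (\<Sum>g\<in>?G. \<bar>m (a0 (- k) b) (- k + g) / M - l (a0 (- k) b) (- k + g)\<bar>)"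
        by (simp add: sum.distrib)
      also have "(\<Sum>g\<in>?G. \<bar>m (a0 (- k) b) (- k + g) / M - l (a0 (- k) b) (- k + g)\<bar>) = 
         (\<Sum>g\<in>(\<lambda>g. - k + g) ` ?G. \<bar>m (a0 (- k) b) g / M - l (a0 (- k) b) g\<bar>)"
        by (subst sum.reindex) (auto simp: inj_on_def o_def)
      also have "\<dots> \<le> e (a0 (- k) b)" by (rule err[OF elim(2)]) (use finG in simp)
      also have "(\<Sum>g\<in>?G. \<bar>m b g / M - l b g\<bar>) \<le> e b" by (rule err[OF elim(1) finG])
      finally have le: "?d b / M \<le> e b + sum ?t ?G + e (a0 (- k) b)" by simp
      have pos: "0 \<le> e b" "0 \<le> e (a0 (- k) b)" 
        using tail(1)[OF elim(1) F(1)] tail(1)[OF elim(2) F(1)] by (simp_all add: e_def)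
      have "ennreal (sum ?t ?G) = (\<integral>\<^sup>+g. ennreal (?t g) * indicator ?G g \<partial>count_space UNIV)"
        using finG by (simp add: nn_integral_count_space_indicator[symmetric] nn_integral_count_space_finite sum_ennreal)
      also have "\<dots> \<le> (\<integral>\<^sup>+g. ennreal (?t g) \<partial>count_space UNIV)"
        by (intro nn_integral_mono) (auto simp: indicator_def)
      finally have t: "ennreal (sum ?t ?G) \<le> (\<integral>\<^sup>+g. ennreal (?t g) \<partial>count_space UNIV)" .
      have "ennreal (?d b / M) \<le> ennreal (e b + sum ?t ?G + e (a0 (- k) b))" using le by (rule ennreal_leI)
      also have "\<dots> = ennreal (e b) + ennreal (sum ?t ?G) + ennreal (e (a0 (- k) b))"
        using pos by (simp add: ennreal_plus sum_nonneg)
      also have "\<dots> \<le> ennreal (e b) + (\<integral>\<^sup>+g. ennreal (?t g) \<partial>count_space UNIV) + ennreal (e (a0 (- k) b))"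
        by (intro add_mono t order_refl)
      finally show ?case .
    qed
    then have "(\<integral>\<^sup>+b. ennreal (?d b / M) \<partial>B0) \<le> (\<integral>\<^sup>+b. ennreal (e b) + ?D b + ennreal (e (a0 (- k) b)) \<partial>B0)"
      by (rule nn_integral_mono_AE)
    also have "\<dots> = (\<integral>\<^sup>+b. ennreal (e b) \<partial>B0) + (\<integral>\<^sup>+b. ?D b \<partial>B0) + (\<integral>\<^sup>+b. ennreal (e (a0 (- k) b)) \<partial>B0)"
    proof -
      have [measurable]: "?D \<in> borel_measurable B0"
      proof -
        have "(\<lambda>p. ennreal \<bar>avg_density N p - avg_density N (translate k p)\<bar>) \<in> borel_measurable CB" by measurable
        from measurable_nn_integral_group[OF this] show ?thesis by (simp add: l_def translate_def)
      qed
      show ?thesis by (subst nn_integral_add, measurable)+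
    qed
    also have "(\<integral>\<^sup>+b. ?D b \<partial>B0) = 
        (\<integral>\<^sup>+p. ennreal \<bar>avg_density N p - avg_density N (translate k p)\<bar> \<partial>CB)"
      by (subst nn_integral_CB, measurable) (simp add: l_def translate_def)
    also have "(\<integral>\<^sup>+b. ennreal (e b) \<partial>B0) + \<dots> + (\<integral>\<^sup>+b. ennreal (e (a0 (- k) b)) \<partial>B0) \<le> ennreal (\<epsilon> / 4) + ennreal (\<epsilon> / 4) + ennreal (\<epsilon> / 4)"
      using k by (intro add_mono e0 e N0 NN0) auto
    also have "\<dots> \<le> ennreal \<epsilon>" using \<epsilon> by (simp add: ennreal_plus[symmetric] del: ennreal_plus)
    finally have "(\<integral>\<^sup>+b. ennreal (?d b / M) \<partial>B0) \<le> ennreal \<epsilon>" .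
    then have "(\<integral>b. ?d b / M \<partial>B0) \<le> \<epsilon>"
      using \<epsilon> by (subst integral_eq_nn_integral) (auto intro!: enn2real_leI sum_nonneg divide_nonneg_nonneg)
    then show "(\<integral>b. ?d b \<partial>B0) \<le> \<epsilon> * M" using M by (simp add: divide_le_eq)
  next
    fix Nm :: "'y measure" and a A
    assume Nm: "prob_space Nm" "measurable_action Nm a" "stationary \<mu> Nm a" "A \<in> sets Nm"
    interpret Nm: prob_space Nm by fact
    define q where "q g = measure Nm {y \<in> space Nm. a g y \<in> A}" for g
    have q: "0 \<le> q g" "q g \<le> 1" for g by (simp_all add: q_def)
    let ?X = "\<lambda>b. \<Sum>g\<in>F. m b g / M * q g"
      and ?Q = "\<lambda>b. \<integral>\<^sup>+g. ennreal (l b g) * ennreal (q g) \<partial>count_space UNIV"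
    have Xm[measurable]: "?X \<in> borel_measurable B0" by measurable
    have X1: "?X b \<le> 1" "0 \<le> ?X b" for b
    proof -
      have "?X b \<le> (\<Sum>g\<in>F. m b g / M)" using q by (intro sum_mono mult_left_le) auto
      also have "\<dots> = real (\<Sum>g\<in>F. m b g) / M" by (simp add: sum_divide_distrib)
      finally show "?X b \<le> 1" unfolding mM using M by simp
      show "0 \<le> ?X b" using q by (intro sum_nonneg) auto
    qed
    have intX: "integrable B0 ?X"
      by (rule B.integrable_const_bound[where B=1]) (use X1 in auto)
    have nnX: "(\<integral>\<^sup>+b. ennreal (?X b) \<partial>B0) = ennreal (\<integral>b. ?X b \<partial>B0)"
      using X1 by (intro nn_integral_eq_integral intX) auto
    have m: "(\<lambda>p. ennreal (avg_density N p) * ennreal (q (fst p))) \<in> borel_measurable CB"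
      using measurable_compose[OF measurable_fst, of "\<lambda>g. ennreal (q g)" "count_space UNIV" borel B0] by measurable
    have Y: "(\<integral>\<^sup>+b. ?Q b \<partial>B0) = ennreal (measure Nm A)"
    proof -
      have "(\<integral>\<^sup>+b. ?Q b \<partial>B0) = 
         (\<integral>\<^sup>+p. ennreal (avg_density N p) * ennreal (q (fst p)) \<partial>CB)"
        by (subst nn_integral_CB[OF m]) (simp add: l_def)
      also have "\<dots> = ennreal (measure Nm A)"
        using avg_density_stationary[OF Nm(2,3,4) \<open>N > 0\<close>] by (simp add: q_def Nm.emeasure_eq_measure)
      finally show ?thesis .
    qed
    \<comment> \<open>The second inequality costs \<open>2 * e b\<close>, since the rounding error
      and the tail mass outside \<open>F\<close> are each bounded by \<open>e b\<close>.\<close>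
    have pt: "AE b in B0. ennreal (?X b) \<le> ?Q b + ennreal (e b) \<and>
         ?Q b \<le> ennreal (?X b) + ennreal (2 * e b)"
      using lsum
    proof eventually_elim
      case (elim b)
      let ?L = "\<Sum>g\<in>F. l b g * q g"
      have L0: "0 \<le> ?L" using l0 q by (intro sum_nonneg) auto
      have t0: "0 \<le> 1 - sum (l b) F" using tail(1)[OF elim F(1)] by simp
      have "\<bar>?X b - ?L\<bar> \<le> (\<Sum>g\<in>F. \<bar>m b g / M - l b g\<bar>)"
      proof -
        have "?X b - ?L = (\<Sum>g\<in>F. (m b g / M - l b g) * q g)" by (simp add: sum_subtractf left_diff_distrib)
        also have "\<bar>\<dots>\<bar> \<le> (\<Sum>g\<in>F. \<bar>(m b g / M - l b g) * q g\<bar>)" by (rule sum_abs)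
        also have "\<dots> \<le> (\<Sum>g\<in>F. \<bar>m b g / M - l b g\<bar>)"
          using q by (intro sum_mono) (auto simp: abs_mult intro!: mult_left_le)
        finally show ?thesis .
      qed
      also have "\<dots> \<le> e b" by (rule err[OF elim F(1)])
      finally have XL: "\<bar>?X b - ?L\<bar> \<le> e b" .
      have eL: "ennreal ?L = (\<integral>\<^sup>+g. ennreal (l b g) * ennreal (q g) * indicator F g \<partial>count_space UNIV)"
        using F l0 q by (simp add: nn_integral_count_space_indicator[symmetric] nn_integral_count_space_finite sum_ennreal ennreal_mult'[symmetric])
      have 1: "ennreal ?L \<le> ?Q b"
        unfolding eL by (intro nn_integral_mono) (auto simp: indicator_def)
      have "?Q b \<le> 
          (\<integral>\<^sup>+g. ennreal (l b g) * ennreal (q g) * indicator F g + ennreal (l b g) * indicator (- F) g \<partial>count_space UNIV)"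
        using q l0 by (intro nn_integral_mono) (auto simp: indicator_def ennreal_mult'[symmetric] mult_left_le intro!: ennreal_leI)
      also have "\<dots> = ennreal ?L + ennreal (1 - sum (l b) F)"
        unfolding eL tail(3)[OF elim F(1), symmetric] by (rule nn_integral_add) auto
      finally have 2: "?Q b \<le> ennreal (?L + (1 - sum (l b) F))"
        using L0 t0 by (simp add: ennreal_plus)
      have e0: "0 \<le> e b" using t0 by (simp add: e_def)
      have te: "1 - sum (l b) F \<le> e b" 
        using t0 by (simp add: e_def) (smt (verit) divide_nonneg_nonneg of_nat_0_le_iff)
      have "ennreal (?X b) \<le> ennreal (?L + e b)" using XL by (intro ennreal_leI) linarith
      also have "\<dots> = ennreal ?L + ennreal (e b)" using L0 e0 by (simp add: ennreal_plus)
      also have "\<dots> \<le> ?Q b + ennreal (e b)"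
        by (intro add_mono 1 order_refl)
      finally have A: "ennreal (?X b) \<le> ?Q b + ennreal (e b)" .
      note 2
      also have "ennreal (?L + (1 - sum (l b) F)) \<le> ennreal (?X b + 2 * e b)" using XL te by (intro ennreal_leI) linarith
      also have "\<dots> = ennreal (?X b) + ennreal (2 * e b)" using X1 e0 by (simp add: ennreal_plus)
      finally show ?case using A by blast
    qed
    have Ym[measurable]: "?Q \<in> borel_measurable B0"
      using measurable_nn_integral_group[OF m] by (simp add: l_def)
    have "ennreal (\<integral>b. ?X b \<partial>B0) \<le> (\<integral>\<^sup>+b. ?Q b + ennreal (e b) \<partial>B0)"
      unfolding nnX[symmetric] by (rule nn_integral_mono_AE, rule eventually_mono[OF pt]) blast
    also have "\<dots> = ennreal (measure Nm A) + (\<integral>\<^sup>+b. ennreal (e b) \<partial>B0)"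
      by (subst nn_integral_add) (auto simp: Y)
    also have "\<dots> \<le> ennreal (measure Nm A) + ennreal (\<epsilon> / 4)" by (intro add_mono e0 order_refl)
    also have "\<dots> = ennreal (measure Nm A + \<epsilon> / 4)" using \<epsilon> by (simp add: ennreal_plus)
    finally have up: "(\<integral>b. ?X b \<partial>B0) \<le> measure Nm A + \<epsilon> / 4"
      using \<epsilon> by (subst (asm) ennreal_le_iff) (auto intro!: add_nonneg_nonneg)
    have "ennreal (measure Nm A) \<le> (\<integral>\<^sup>+b. ennreal (?X b) + ennreal (2 * e b) \<partial>B0)"
      unfolding Y[symmetric] by (rule nn_integral_mono_AE, rule eventually_mono[OF pt]) blast
    also have "\<dots> = ennreal (\<integral>b. ?X b \<partial>B0) + (\<integral>\<^sup>+b. ennreal (2 * e b) \<partial>B0)"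
      unfolding nnX[symmetric] by (rule nn_integral_add; measurable)
    also have "(\<integral>\<^sup>+b. ennreal (2 * e b) \<partial>B0) = 2 * (\<integral>\<^sup>+b. ennreal (e b) \<partial>B0)"
      by (subst nn_integral_cmult[symmetric]) (auto intro!: nn_integral_cong simp: ennreal_mult' )
    also have "ennreal (\<integral>b. ?X b \<partial>B0) + 2 * (\<integral>\<^sup>+b. ennreal (e b) \<partial>B0) \<le> ennreal (\<integral>b. ?X b \<partial>B0) + 2 * ennreal (\<epsilon> / 4)"
      by (intro add_mono mult_left_mono e0 order_refl) auto
    also have "2 * ennreal (\<epsilon> / 4) = ennreal (\<epsilon> / 2)"
      using ennreal_mult'[of 2 "\<epsilon> / 4"] by simp
    also have "ennreal (\<integral>b. ?X b \<partial>B0) + ennreal (\<epsilon> / 2) = ennreal ((\<integral>b. ?X b \<partial>B0) + \<epsilon> / 2)"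
      using \<epsilon> X1 by (intro ennreal_plus[symmetric] integral_nonneg) auto
    finally have "measure Nm A \<le> (\<integral>b. ?X b \<partial>B0) + \<epsilon> / 2"
      using \<epsilon> X1 by (subst (asm) ennreal_le_iff) (auto intro!: add_nonneg_nonneg integral_nonneg)
    then show "\<bar>(\<integral>b. (\<Sum>g\<in>F. m b g / M * measure Nm {y \<in> space Nm. a g y \<in> A}) \<partial>B0) - measure Nm A\<bar> \<le> \<epsilon>"
      using up \<epsilon> unfolding q_def by linarith
  qed
qed

end

section \<open>Leaders of random rankings\<close>

definition rankings :: "'j set \<Rightarrow> ('j \<Rightarrow> nat) set" where
  "rankings J = {r \<in> J \<rightarrow>\<^sub>E {..<card J}. inj_on r J}"

definition leader :: "('j \<Rightarrow> nat) \<Rightarrow> 'j set \<Rightarrow> 'j" where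
  "leader r T = arg_min_on r T"

text \<open>Expectation for a uniformly random ranking; as a finite average it avoids a further
  probability space.\<close>

definition rank_avg :: "'j set \<Rightarrow> (('j \<Rightarrow> nat) \<Rightarrow> real) \<Rightarrow> real" where
  "rank_avg J f = (\<Sum>r\<in>rankings J. f r) / real (card (rankings J))"

lemma finite_rankings: "finite J \<Longrightarrow> finite (rankings J)"
  by (rule finite_subset[of _ "J \<rightarrow>\<^sub>E {..<card J}"]) (auto simp: rankings_def intro: finite_PiE)

lemma rankings_nonempty:
  assumes "finite J"
  shows "rankings J \<noteq> {}"
proof -
  obtain h where "bij_betw h J {0..<card J}" using ex_bij_betw_finite_nat[OF assms] by blast
  then have "restrict h J \<in> rankings J"
    by (auto simp: rankings_def bij_betw_def inj_on_def)
  then show ?thesis by blast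
qed

lemma card_rankings_pos: "finite J \<Longrightarrow> 0 < card (rankings J)"
  using finite_rankings rankings_nonempty by (metis card_gt_0_iff)

lemma leader_in: "finite T \<Longrightarrow> T \<noteq> {} \<Longrightarrow> leader r T \<in> T"
  unfolding leader_def by (rule arg_min_if_finite)

lemma leader_le: "finite T \<Longrightarrow> i \<in> T \<Longrightarrow> r (leader r T) \<le> r i"
  unfolding leader_def by (metis arg_min_least emptyE)

lemma leader_eqI:
  assumes "r \<in> rankings J" "finite J" "T \<subseteq> J" "j \<in> T" "\<And>i. i \<in> T \<Longrightarrow> r j \<le> r i"
  shows "leader r T = j"
proof -
  have fin: "finite T" using assms finite_subset by blast
  have "r (leader r T) = r j"
    using leader_le[OF fin assms(4), of r] assms(5)[OF leader_in[OF fin, of r]] assms(4) by force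
  moreover have "inj_on r J" "leader r T \<in> J" "j \<in> J"
    using assms leader_in[OF fin, of r] by (auto simp: rankings_def)
  ultimately show ?thesis by (meson inj_onD)
qed

lemma leader_superset:
  assumes "r \<in> rankings J" "finite J" "T \<subseteq> U" "U \<subseteq> J" "leader r U \<in> T"
  shows "leader r T = leader r U"
  using assms leader_le[of U _ r] finite_subset[of U J] by (intro leader_eqI[of r J]) auto

lemma rankings_comp_transpose:
  assumes "r \<in> rankings J" "i \<in> J" "j \<in> J"
  shows "r \<circ> Transposition.transpose i j \<in> rankings J"
proof -
  have "inj_on (r \<circ> Transposition.transpose i j) J"
    using assms by (intro comp_inj_on) (auto simp: rankings_def)
  moreover have "Transposition.transpose i j k \<in> J \<longleftrightarrow> k \<in> J" for k
    using assms by (auto simp: Transposition.transpose_def)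
  ultimately show ?thesis using assms by (auto simp: rankings_def PiE_iff extensional_def)
qed

lemma leader_comp_transpose:
  assumes "r \<in> rankings J" "finite J" "T \<subseteq> J" "T \<noteq> {}" "i \<in> T" "j \<in> T"
  shows "leader (r \<circ> Transposition.transpose i j) T = Transposition.transpose i j (leader r T)"
proof (rule leader_eqI[OF rankings_comp_transpose])
  have fin: "finite T" using assms finite_subset by blast
  have t: "Transposition.transpose i j k \<in> T \<longleftrightarrow> k \<in> T" for k
    using assms by (auto simp: Transposition.transpose_def)
  show "Transposition.transpose i j (leader r T) \<in> T" using leader_in[OF fin] t assms by blast
  show "(r \<circ> Transposition.transpose i j) (Transposition.transpose i j (leader r T)) \<le> (r \<circ> Transposition.transpose i j) k" if "k \<in> T" for k
    using leader_le[OF fin, of "Transposition.transpose i j k" r] t that by simp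
qed (use assms in auto)

lemma leader_comp_transpose_disjoint:
  assumes "r \<in> rankings J" "finite J" "T \<subseteq> J" "T \<noteq> {}" "i \<in> J" "j \<in> J" "i \<notin> T" "j \<notin> T"
  shows "leader (r \<circ> Transposition.transpose i j) T = leader r T"
proof (rule leader_eqI[OF rankings_comp_transpose])
  have fin: "finite T" using assms finite_subset by blast
  have t: "Transposition.transpose i j k = k" if "k \<in> T" for k
    using assms that by (auto simp: Transposition.transpose_def)
  show "leader r T \<in> T" using leader_in[OF fin] assms by blast
  show "(r \<circ> Transposition.transpose i j) (leader r T) \<le> (r \<circ> Transposition.transpose i j) k" if "k \<in> T" for k
    using leader_le[OF fin that, of r] leader_in[OF fin, of r] t that assms by simp
qed (use assms in auto)

text \<open>Exchanging two elements of \<open>T\<close> in a ranking exchanges them as leaders, so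
  all elements of \<open>T\<close> lead equally often. A general \<open>Q\<close> is allowed so that
  the leader of a disjoint set may be prescribed.\<close>

lemma card_leader_eq:
  assumes "finite J" "T \<subseteq> J" "Q \<subseteq> rankings J"
    and Q: "\<And>r i k. r \<in> Q \<Longrightarrow> i \<in> T \<Longrightarrow> k \<in> T \<Longrightarrow> r \<circ> Transposition.transpose i k \<in> Q"
    and "j \<in> T"
  shows "card {r \<in> Q. leader r T = j} * card T = card Q"
proof -
  have finQ: "finite Q" using finite_rankings[OF assms(1)] assms(3) finite_subset by blast
  have finT: "finite T" using assms finite_subset by blast
  have le: "card {r \<in> Q. leader r T = i} \<le> card {r \<in> Q. leader r T = k}" if "i \<in> T" "k \<in> T" for i k
  proof (rule card_inj_on_le)
    have inv: "r \<circ> Transposition.transpose i k \<circ> Transposition.transpose i k = r" for r :: "'a \<Rightarrow> nat" by (simp add: fun_eq_iff)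
    show "inj_on (\<lambda>r. r \<circ> Transposition.transpose i k) {r \<in> Q. leader r T = i}"
      by (rule inj_on_inverseI[where g="\<lambda>r. r \<circ> Transposition.transpose i k"]) (simp add: inv)
    have "leader (r \<circ> Transposition.transpose i k) T = k" if "r \<in> Q" "leader r T = i" for r
      using leader_comp_transpose[of r J T i k] that \<open>i \<in> T\<close> \<open>k \<in> T\<close> assms(1-3) by auto
    then show "(\<lambda>r. r \<circ> Transposition.transpose i k) ` {r \<in> Q. leader r T = i} \<subseteq> {r \<in> Q. leader r T = k}"
      using Q that by auto
    show "finite {r \<in> Q. leader r T = k}" using finQ by simp
  qed
  have "card Q = card (\<Union>i\<in>T. {r \<in> Q. leader r T = i})"
    using leader_in[OF finT] \<open>j \<in> T\<close> by (intro arg_cong[where f=card]) auto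
  also have "\<dots> = (\<Sum>i\<in>T. card {r \<in> Q. leader r T = i})"
    using finQ finT by (intro card_UN_disjoint) auto
  also have "\<dots> = (\<Sum>i\<in>T. card {r \<in> Q. leader r T = j})"
    using le \<open>j \<in> T\<close> by (intro sum.cong refl le_antisym) auto
  finally show ?thesis by simp
qed

lemma sum_leader:
  fixes f :: "'j \<Rightarrow> real"
  assumes J: "finite J" "T \<subseteq> J" "T \<noteq> {}" "Q \<subseteq> rankings J"
    and Q: "\<And>r i k. r \<in> Q \<Longrightarrow> i \<in> T \<Longrightarrow> k \<in> T \<Longrightarrow> r \<circ> Transposition.transpose i k \<in> Q"
  shows "(\<Sum>r\<in>Q. f (leader r T)) = card Q * (sum f T / card T)"
proof -
  have fin: "finite T" "finite Q" using J finite_rankings[OF J(1)] finite_subset by blast+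
  have pos: "card T > 0" using fin J by (simp add: card_gt_0_iff)
  have "(\<Sum>r\<in>Q. f (leader r T)) = (\<Sum>j\<in>T. \<Sum>r\<in>{r \<in> Q. leader r T = j}. f (leader r T))"
    using leader_in[OF fin(1) J(3)] fin by (intro sum.group[symmetric]) auto
  also have "\<dots> = (\<Sum>j\<in>T. (card Q / card T) * f j)"
  proof (rule sum.cong[OF refl])
    fix j assume j: "j \<in> T"
    have "card {r \<in> Q. leader r T = j} * card T = card Q"
      by (rule card_leader_eq[OF J(1,2,4) Q j])
    then have "real (card {r \<in> Q. leader r T = j}) = card Q / card T"
      using pos by (simp add: eq_divide_eq of_nat_mult[symmetric] del: of_nat_mult)
    then show "(\<Sum>r\<in>{r \<in> Q. leader r T = j}. f (leader r T)) = (card Q / card T) * f j" by simp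
  qed
  also have "\<dots> = card Q * (sum f T / card T)"
    by (simp only: sum_distrib_left[symmetric]) simp
  finally show ?thesis .
qed

lemma rank_avg_leader:
  fixes f :: "'j \<Rightarrow> real"
  assumes J: "finite J" "T \<subseteq> J" "T \<noteq> {}"
  shows "rank_avg J (\<lambda>r. f (leader r T)) = (\<Sum>j\<in>T. f j) / card T"
proof -
  have "(\<Sum>r\<in>rankings J. f (leader r T)) = card (rankings J) * (sum f T / card T)"
    using J by (intro sum_leader rankings_comp_transpose) auto
  then show ?thesis using card_rankings_pos[OF J(1)] by (simp add: rank_avg_def)
qed

text \<open>Independence: exchanging elements of \<open>T\<close> does not affect the leader of the
  disjoint set \<open>T'\<close>, so the leader of \<open>T\<close> stays uniform when that leader
  is prescribed.\<close>

lemma rank_avg_leader2: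
  fixes f g :: "'j \<Rightarrow> real"
  assumes J: "finite J" "T \<subseteq> J" "T' \<subseteq> J" "T \<noteq> {}" "T' \<noteq> {}" "T \<inter> T' = {}"
  shows "rank_avg J (\<lambda>r. f (leader r T) * g (leader r T')) =
         ((\<Sum>j\<in>T. f j) / card T) * ((\<Sum>j\<in>T'. g j) / card T')"
proof -
  let ?Q = "\<lambda>j'. {r \<in> rankings J. leader r T' = j'}"
  have fin: "finite T'" "finite (rankings J)" using J finite_subset finite_rankings by blast+
  note group = sum.group[OF fin(2) fin(1), of "\<lambda>r. leader r T'", symmetric]
  have T': "(\<lambda>r. leader r T') ` rankings J \<subseteq> T'" using leader_in[OF fin(1) J(5)] by auto
  have Q: "(\<Sum>r\<in>?Q j'. f (leader r T)) = card (?Q j') * (sum f T / card T)" for j'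
  proof (rule sum_leader[OF J(1,2,4)])
    fix r i k assume r: "r \<in> ?Q j'" "i \<in> T" "k \<in> T"
    then have "i \<in> J" "k \<in> J" "i \<notin> T'" "k \<notin> T'" using J by auto
    then show "r \<circ> Transposition.transpose i k \<in> ?Q j'"
      using r rankings_comp_transpose[of r J i k] leader_comp_transpose_disjoint[of r J T' i k] J by auto
  qed auto
  have "(\<Sum>r\<in>rankings J. f (leader r T) * g (leader r T')) = (\<Sum>j'\<in>T'. (\<Sum>r\<in>?Q j'. f (leader r T)) * g j')"
    by (simp add: group[OF T'] sum_distrib_right)
  also have "\<dots> = (sum f T / card T) * (\<Sum>j'\<in>T'. \<Sum>r\<in>?Q j'. g (leader r T'))"
    unfolding Q sum_distrib_left by (intro sum.cong refl) simp
  also have "\<dots> = (sum f T / card T) * (\<Sum>r\<in>rankings J. g (leader r T'))"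
    by (simp only: group[OF T'])
  finally have "rank_avg J (\<lambda>r. f (leader r T) * g (leader r T')) = (sum f T / card T) * rank_avg J (\<lambda>r. g (leader r T'))"
    by (simp only: rank_avg_def times_divide_eq_right)
  then show ?thesis unfolding rank_avg_leader[OF J(1,3,5)] .
qed

text \<open>If the leader of the union lies in both sets, it leads both. That leader is uniform on
  the union, and dividing by \<open>card T\<close> instead of the size of the union only weakens the
  bound.\<close>

lemma rank_avg_leader_neq:
  assumes J: "finite J" "T \<subseteq> J" "T' \<subseteq> J" "T \<noteq> {}"
  shows "rank_avg J (\<lambda>r. of_bool (leader r T \<noteq> leader r T')) \<le> card ((T - T') \<union> (T' - T)) / card T"
proof -
  let ?U = "T \<union> T'"
  have fin: "finite T" "finite T'" using J finite_subset by blast+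
  have "rank_avg J (\<lambda>r. of_bool (leader r T \<noteq> leader r T')) \<le> rank_avg J (\<lambda>r. of_bool (leader r ?U \<notin> T \<inter> T'))"
    unfolding rank_avg_def
  proof (intro divide_right_mono sum_mono)
    fix r assume "r \<in> rankings J"
    then show "(of_bool (leader r T \<noteq> leader r T') :: real) \<le> of_bool (leader r ?U \<notin> T \<inter> T')"
      using leader_superset[of r J T ?U] leader_superset[of r J T' ?U] J by auto
  qed simp
  also have "\<dots> = (\<Sum>j\<in>?U. of_bool (j \<notin> T \<inter> T')) / card ?U"
    using J by (intro rank_avg_leader) auto
  also have "(\<Sum>j\<in>?U. of_bool (j \<notin> T \<inter> T')) = real (card ((T - T') \<union> (T' - T)))"
    using fin by (subst sum_of_bool_eq) (auto intro!: arg_cong[where f=card])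
  also have "\<dots> / card ?U \<le> \<dots> / card T"
    using fin J by (intro divide_left_mono) (auto intro!: card_mono mult_pos_pos simp: card_gt_0_iff)
  finally show ?thesis .
qed

section \<open>Second moment of the sampling scheme\<close>

lemma integral_PiM_two_components:
  fixes f g :: "'y \<Rightarrow> real"
  assumes \<eta>: "prob_space \<eta>" and J: "finite J" "i \<in> J" "j \<in> J" "i \<noteq> j"
    and f: "integrable \<eta> f" and g: "integrable \<eta> g"
  shows "(\<integral>y. f (y i) * g (y j) \<partial>PiM J (\<lambda>_. \<eta>)) = (\<integral>y. f y \<partial>\<eta>) * (\<integral>y. g y \<partial>\<eta>)"
proof -
  interpret \<eta>: prob_space \<eta> by fact
  interpret P: product_sigma_finite "\<lambda>_. \<eta>" ..
  let ?h = "\<lambda>k. if k = i then f else if k = j then g else (\<lambda>_. 1)"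
  have split: "prod u J = u i * u j" if "\<And>k. k \<noteq> i \<Longrightarrow> k \<noteq> j \<Longrightarrow> u k = 1" for u :: "_ \<Rightarrow> real"
  proof -
    have "prod u J = prod u {i, j}"
      using J that by (intro prod.mono_neutral_right) auto
    then show ?thesis using J by simp
  qed
  have "(\<integral>y. (\<Prod>k\<in>J. ?h k (y k)) \<partial>PiM J (\<lambda>_. \<eta>)) = (\<Prod>k\<in>J. (\<integral>y. ?h k y \<partial>\<eta>))"
    using J f g by (intro P.product_integral_prod) auto
  moreover have "(\<Prod>k\<in>J. ?h k (y k)) = f (y i) * g (y j)" for y
    using J by (subst split) auto
  moreover have "(\<Prod>k\<in>J. (\<integral>y. ?h k y \<partial>\<eta>)) = (\<integral>y. f y \<partial>\<eta>) * (\<integral>y. g y \<partial>\<eta>)"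
    using J by (subst split) (auto simp: \<eta>.prob_space)
  ultimately show ?thesis by simp
qed

lemma rank_avg_mono:
  assumes "\<And>r. r \<in> rankings J \<Longrightarrow> f r \<le> g r"
  shows "rank_avg J f \<le> rank_avg J g"
  unfolding rank_avg_def by (intro divide_right_mono sum_mono assms) auto

lemma rank_avg_sum: "rank_avg J (\<lambda>r. \<Sum>i\<in>I. f i r) = (\<Sum>i\<in>I. rank_avg J (f i))"
  unfolding rank_avg_def by (subst sum.swap) (simp add: sum_divide_distrib)

lemma rank_avg_cmult: "rank_avg J (\<lambda>r. c * f r) = c * rank_avg J f"
  unfolding rank_avg_def by (simp add: sum_distrib_left[symmetric])

lemma rank_avg_const: "finite J \<Longrightarrow> rank_avg J (\<lambda>r. c) = c"
  using card_rankings_pos[of J] by (simp add: rank_avg_def)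

lemma rank_avg_less_exists:
  assumes "finite J" "rank_avg J f < c"
  shows "\<exists>r\<in>rankings J. f r < c"
proof (rule ccontr)
  assume "\<not> ?thesis"
  then have "rank_avg J (\<lambda>_. c) \<le> rank_avg J f" by (intro rank_avg_mono) (auto simp: not_less)
  then show False using assms rank_avg_const[of J c] by simp
qed

text \<open>Every \<open>D\<close> reads the label \<open>y\<close> of its highest ranked token; samples read by
  \<open>D\<close> and \<open>D'\<close> with disjoint token sets are independent.\<close>

lemma sampling_second_moment:
  fixes w :: "'d \<Rightarrow> real" and T :: "'d \<Rightarrow> 'j set" and E :: "'d \<Rightarrow> 'j \<Rightarrow> 'y set"
  assumes \<eta>: "prob_space \<eta>" and J: "finite J" and w: "\<And>D. D \<in> I \<Longrightarrow> 0 \<le> w D" "sum w I = 1"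
    and T: "\<And>D. D \<in> I \<Longrightarrow> T D \<subseteq> J" "\<And>D. D \<in> I \<Longrightarrow> T D \<noteq> {}"
    and E: "\<And>D j. D \<in> I \<Longrightarrow> j \<in> J \<Longrightarrow> E D j \<in> sets \<eta>"
    and c: "0 \<le> c" "c \<le> 1"
  shows "rank_avg J (\<lambda>r. \<integral>y. ((\<Sum>D\<in>I. w D * indicator (E D (leader r (T D))) (y (leader r (T D)))) - c)\<^sup>2 \<partial>PiM J (\<lambda>_. \<eta>))
    \<le> ((\<Sum>D\<in>I. w D * ((\<Sum>j\<in>T D. measure \<eta> (E D j)) / card (T D))) - c)\<^sup>2
      + 2 * (\<Sum>D\<in>I. \<Sum>D'\<in>I. (if T D \<inter> T D' \<noteq> {} then w D * w D' else 0))"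
proof -
  interpret \<eta>: prob_space \<eta> by fact
  interpret P: prob_space "PiM J (\<lambda>_. \<eta>)" by (rule prob_space_PiM) (rule \<eta>)
  let ?P = "PiM J (\<lambda>_. \<eta>)"
  define L where "L r D = leader r (T D)" for r :: "'j \<Rightarrow> nat" and D
  \<comment> \<open>Centred at the target \<open>c\<close> rather than at the mean: as the weights
    sum to 1, the deviation is a weighted sum of the \<open>z\<close>, and \<open>R D\<close>
    collects the bias that remains.\<close>
  define z where "z D j v = indicator (E D j) v - c" for D j and v :: 'y
  define \<rho> where "\<rho> D j = measure \<eta> (E D j) - c" for D j
  define R where "R D = (\<Sum>j\<in>T D. \<rho> D j) / card (T D)" for D
  have finT: "finite (T D)" if "D \<in> I" for D using T(1)[OF that] J finite_subset by blast
  have LT: "L r D \<in> T D" if "D \<in> I" for r D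
    unfolding L_def using leader_in[OF finT[OF that] T(2)[OF that]] .
  have LJ: "L r D \<in> J" if "D \<in> I" for r D using LT[OF that] T(1)[OF that] by auto
  have z1: "\<bar>z D j v\<bar> \<le> 1" for D j v using c by (auto simp: z_def indicator_def)
  have zz: "\<bar>z D i u * z D' j v\<bar> \<le> 1" for D i u D' j v
    unfolding abs_mult by (intro mult_le_one z1) simp
  have zint: "integrable \<eta> (z D j)" if "D \<in> I" "j \<in> J" for D j
    using E[OF that] z1 by (intro \<eta>.integrable_const_bound[where B=1]) (auto simp: z_def[abs_def])
  have zexp: "(\<integral>v. z D j v \<partial>\<eta>) = \<rho> D j" if "D \<in> I" "j \<in> J" for D j
  proof -
    have "integrable \<eta> (indicator (E D j) :: 'y \<Rightarrow> real)"
      using E[OF that] by (intro \<eta>.integrable_const_bound[where B=1]) auto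
    then show ?thesis using E[OF that] by (simp add: z_def \<rho>_def \<eta>.prob_space)
  qed
  have comp: "(\<lambda>y. z D j (y j)) \<in> borel_measurable ?P" if "D \<in> I" "j \<in> J" for D j
    by (rule measurable_compose[OF measurable_component_singleton[OF that(2)]])
       (use zint[OF that] in auto)
  have \<rho>1: "\<bar>\<rho> D j\<bar> \<le> 1" for D j 
  proof -
    have "0 \<le> measure \<eta> (E D j)" "measure \<eta> (E D j) \<le> 1" by simp_all
    then show ?thesis using c unfolding \<rho>_def by linarith
  qed
  have R1: "\<bar>R D\<bar> \<le> 1" if "D \<in> I" for D
  proof -
    have "\<bar>\<Sum>j\<in>T D. \<rho> D j\<bar> \<le> (\<Sum>j\<in>T D. 1)" by (rule order_trans[OF sum_abs sum_mono]) (rule \<rho>1)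
    then show ?thesis using finT[OF that] T(2)[OF that] by (simp add: R_def card_gt_0_iff)
  qed
  let ?cross = "\<lambda>r D D'. \<integral>y. z D (L r D) (y (L r D)) * z D' (L r D') (y (L r D')) \<partial>?P"
  have prodint: "integrable ?P (\<lambda>y. z D (L r D) (y (L r D)) * z D' (L r D') (y (L r D')))" if "D \<in> I" "D' \<in> I" for r D D'
    using comp[OF that(1) LJ[OF that(1)]] comp[OF that(2) LJ[OF that(2)]] zz
    by (intro P.integrable_const_bound[where B=1]) auto
  have sq: "(\<integral>y. ((\<Sum>D\<in>I. w D * indicator (E D (L r D)) (y (L r D))) - c)\<^sup>2 \<partial>?P) = (\<Sum>D\<in>I. \<Sum>D'\<in>I. w D * w D' * ?cross r D D')" for r
  proof -
    have "(\<Sum>D\<in>I. w D * indicator (E D (L r D)) (y (L r D))) - c = (\<Sum>D\<in>I. w D * z D (L r D) (y (L r D)))" for y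
    proof -
      have "(\<Sum>D\<in>I. w D * z D (L r D) (y (L r D))) = (\<Sum>D\<in>I. w D * indicator (E D (L r D)) (y (L r D))) - sum w I * c"
        by (simp add: z_def right_diff_distrib sum_subtractf sum_distrib_right)
      then show ?thesis by (simp add: w)
    qed
    then have "((\<Sum>D\<in>I. w D * indicator (E D (L r D)) (y (L r D))) - c)\<^sup>2 = 
       (\<Sum>D\<in>I. \<Sum>D'\<in>I. w D * w D' * (z D (L r D) (y (L r D)) * z D' (L r D') (y (L r D'))))" for y
      by (simp add: power2_eq_square sum_product mult_ac)
    then show ?thesis
      using prodint by (simp add: Bochner_Integration.integral_sum)
  qed
  have disj: "?cross r D D' = \<rho> D (L r D) * \<rho> D' (L r D')" if "D \<in> I" "D' \<in> I" "T D \<inter> T D' = {}" for r D D'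
  proof -
    have "L r D \<noteq> L r D'" using LT[OF that(1)] LT[OF that(2)] that(3) by (metis disjoint_iff)
    then have "?cross r D D' = (\<integral>v. z D (L r D) v \<partial>\<eta>) * (\<integral>v. z D' (L r D') v \<partial>\<eta>)"
      using that by (intro integral_PiM_two_components \<eta> J LJ zint) auto
    then show ?thesis using that by (simp add: zexp LJ)
  qed
  have le1: "?cross r D D' \<le> 1" if "D \<in> I" "D' \<in> I" for r D D'
  proof -
    have "?cross r D D' \<le> (\<integral>y. 1 \<partial>?P)"
      by (intro integral_mono prodint that) (auto intro: abs_le_D1[OF zz])
    then show ?thesis by (simp add: P.prob_space)
  qed
  \<comment> \<open>Overlapping pairs get the trivial bound 1, which is at most
    \<open>R D * R D' + 2\<close>. In this form the products over all pairs complete to the square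
    of the total bias.\<close>
  have pair_bound: "rank_avg J (\<lambda>r. w D * w D' * ?cross r D D') \<le> 
     w D * w D' * (R D * R D') + 2 * (if T D \<inter> T D' \<noteq> {} then w D * w D' else 0)" if "D \<in> I" "D' \<in> I" for D D'
  proof (cases "T D \<inter> T D' = {}")
    case True
    have "rank_avg J (\<lambda>r. w D * w D' * ?cross r D D') = w D * w D' * rank_avg J (\<lambda>r. \<rho> D (L r D) * \<rho> D' (L r D'))"
      unfolding rank_avg_cmult using disj[OF that True] by simp
    also have "rank_avg J (\<lambda>r. \<rho> D (L r D) * \<rho> D' (L r D')) = R D * R D'"
      unfolding L_def R_def using that True T by (intro rank_avg_leader2 J) auto
    finally show ?thesis using True by simp
  next
    case False
    have ww: "0 \<le> w D * w D'" using w that by simp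
    have "rank_avg J (\<lambda>r. w D * w D' * ?cross r D D') \<le> rank_avg J (\<lambda>r. w D * w D' * 1)"
      by (intro rank_avg_mono mult_left_mono le1 that ww)
    also have "\<dots> = w D * w D'" using rank_avg_const[OF J] by simp
    also have "\<dots> \<le> w D * w D' * (R D * R D' + 2)"
    proof -
      have "\<bar>R D * R D'\<bar> \<le> 1" using R1 that by (simp add: abs_mult mult_le_one)
      then show ?thesis using mult_left_mono[OF _ ww, of 1 "R D * R D' + 2"] by simp
    qed
    finally show ?thesis using False by (simp add: distrib_left)
  qed
  have "rank_avg J (\<lambda>r. \<integral>y. ((\<Sum>D\<in>I. w D * indicator (E D (L r D)) (y (L r D))) - c)\<^sup>2 \<partial>?P)
    = (\<Sum>D\<in>I. \<Sum>D'\<in>I. rank_avg J (\<lambda>r. w D * w D' * ?cross r D D'))"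
    unfolding sq rank_avg_sum ..
  also have "\<dots> \<le> (\<Sum>D\<in>I. \<Sum>D'\<in>I. w D * w D' * (R D * R D') + 2 * (if T D \<inter> T D' \<noteq> {} then w D * w D' else 0))"
    by (intro sum_mono pair_bound)
  also have "\<dots> = (\<Sum>D\<in>I. w D * R D)\<^sup>2 + 2 * (\<Sum>D\<in>I. \<Sum>D'\<in>I. (if T D \<inter> T D' \<noteq> {} then w D * w D' else 0))"
    by (simp add: sum.distrib sum_distrib_left power2_eq_square sum_product mult_ac)
  also have "(\<Sum>D\<in>I. w D * R D) = (\<Sum>D\<in>I. w D * ((\<Sum>j\<in>T D. measure \<eta> (E D j)) / card (T D))) - c"
  proof -
    have "R D = (\<Sum>j\<in>T D. measure \<eta> (E D j)) / card (T D) - c" if "D \<in> I" for D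
      using finT[OF that] T(2)[OF that] by (simp add: R_def \<rho>_def sum_subtractf diff_divide_distrib card_gt_0_iff)
    then have "(\<Sum>D\<in>I. w D * R D) = (\<Sum>D\<in>I. w D * ((\<Sum>j\<in>T D. measure \<eta> (E D j)) / card (T D))) - sum w I * c"
      by (simp add: right_diff_distrib sum_subtractf sum_distrib_right)
    then show ?thesis by (simp add: w)
  qed
  finally show ?thesis unfolding L_def .
qed

text \<open>Chebyshev for each \<open>A\<close> and Markov for \<open>bad\<close> are merged into
  one quantity \<open>?W\<close> whose average is below 1. A ranking with \<open>?W r < 1\<close> is
  fixed first, and then a point \<open>y\<close> at which the sum of the squared deviations over all
  \<open>A\<close> is below the square of \<epsilon>.\<close>

lemma sampling_exists:
  fixes w :: "'d \<Rightarrow> real" and T :: "'d \<Rightarrow> 'j set" and E :: "'i \<Rightarrow> 'd \<Rightarrow> 'j \<Rightarrow> 'y set"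
    and \<delta> \<kappa> \<beta> \<epsilon> :: real
  assumes \<eta>: "prob_space \<eta>" and J: "finite J" and w: "\<And>D. D \<in> I \<Longrightarrow> 0 \<le> w D" "sum w I = 1"
    and T: "\<And>D. D \<in> I \<Longrightarrow> T D \<subseteq> J" "\<And>D. D \<in> I \<Longrightarrow> T D \<noteq> {}"
    and E: "\<And>A D j. A \<in> AA \<Longrightarrow> D \<in> I \<Longrightarrow> j \<in> J \<Longrightarrow> E A D j \<in> sets \<eta>"
    and c: "\<And>A. A \<in> AA \<Longrightarrow> 0 \<le> c A" "\<And>A. A \<in> AA \<Longrightarrow> c A \<le> 1"
    and mean: "\<And>A. A \<in> AA \<Longrightarrow> \<bar>(\<Sum>D\<in>I. w D * ((\<Sum>j\<in>T D. measure \<eta> (E A D j)) / card (T D))) - c A\<bar> \<le> \<delta>"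
    and overlap: "(\<Sum>D\<in>I. \<Sum>D'\<in>I. (if T D \<inter> T D' \<noteq> {} then w D * w D' else 0)) \<le> \<kappa>"
    and bad: "\<And>r. r \<in> rankings J \<Longrightarrow> 0 \<le> bad r" "rank_avg J bad \<le> \<beta>"
    and \<epsilon>: "\<epsilon> > 0" and small: "card AA * (\<delta>\<^sup>2 + 2 * \<kappa>) / \<epsilon>\<^sup>2 + \<beta> / \<epsilon> < 1" and AA: "finite AA"
  shows "\<exists>r\<in>rankings J. \<exists>y\<in>space (PiM J (\<lambda>_. \<eta>)). bad r < \<epsilon> \<and>
    (\<forall>A\<in>AA. \<bar>(\<Sum>D\<in>I. w D * indicator (E A D (leader r (T D))) (y (leader r (T D)))) - c A\<bar> < \<epsilon>)"
proof -
  interpret \<eta>: prob_space \<eta> by fact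
  interpret P: prob_space "PiM J (\<lambda>_. \<eta>)" by (rule prob_space_PiM) (rule \<eta>)
  let ?P = "PiM J (\<lambda>_. \<eta>)"
  let ?S = "\<lambda>A r y. \<Sum>D\<in>I. w D * indicator (E A D (leader r (T D))) (y (leader r (T D)))"
  let ?X = "\<lambda>A r y. ?S A r y - c A"
  let ?V = "\<lambda>A r. (\<integral>y. (?X A r y)\<^sup>2 \<partial>?P)"
  have V: "rank_avg J (?V A) \<le> \<delta>\<^sup>2 + 2 * \<kappa>" if A: "A \<in> AA" for A
  proof -
    have "rank_avg J (?V A) \<le> ((\<Sum>D\<in>I. w D * ((\<Sum>j\<in>T D. measure \<eta> (E A D j)) / card (T D))) - c A)\<^sup>2
      + 2 * (\<Sum>D\<in>I. \<Sum>D'\<in>I. (if T D \<inter> T D' \<noteq> {} then w D * w D' else 0))"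
      using A by (intro sampling_second_moment \<eta> J w T E c)
    also have "\<dots> \<le> \<delta>\<^sup>2 + 2 * \<kappa>"
    proof (intro add_mono mult_left_mono overlap)
      show "((\<Sum>D\<in>I. w D * ((\<Sum>j\<in>T D. measure \<eta> (E A D j)) / card (T D))) - c A)\<^sup>2 \<le> \<delta>\<^sup>2"
        using mean[OF A] by (intro power2_le_iff_abs_le[THEN iffD2]) (auto intro: order_trans[OF abs_ge_zero])
    qed simp
    finally show ?thesis .
  qed
  let ?W = "\<lambda>r. (1 / \<epsilon>\<^sup>2) * (\<Sum>A\<in>AA. ?V A r) + (1 / \<epsilon>) * bad r"
  have "rank_avg J ?W = (1 / \<epsilon>\<^sup>2) * (\<Sum>A\<in>AA. rank_avg J (?V A)) + (1 / \<epsilon>) * rank_avg J bad"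
    unfolding rank_avg_sum[symmetric] rank_avg_cmult[symmetric]
    by (simp add: rank_avg_def sum.distrib add_divide_distrib)
  also have "\<dots> \<le> (1 / \<epsilon>\<^sup>2) * (\<Sum>A\<in>AA. \<delta>\<^sup>2 + 2 * \<kappa>) + (1 / \<epsilon>) * \<beta>"
    using \<epsilon> by (intro add_mono mult_left_mono sum_mono V bad) auto
  also have "\<dots> < 1" using small by simp
  finally obtain r where r: "r \<in> rankings J" "?W r < 1" using rank_avg_less_exists[OF J] by blast
  have Vnn: "0 \<le> ?V A r" for A by simp
  have badr: "bad r < \<epsilon>"
  proof -
    have "(1 / \<epsilon>) * bad r \<le> ?W r" using \<epsilon> by (simp add: sum_nonneg)
    then have "(1 / \<epsilon>) * bad r < 1" using r by linarith
    then show ?thesis using \<epsilon> by (simp add: field_simps)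
  qed
  have sumV: "(\<Sum>A\<in>AA. ?V A r) < \<epsilon>\<^sup>2"
  proof -
    have "0 \<le> (1 / \<epsilon>) * bad r" using \<epsilon> bad(1)[OF r(1)] by simp
    then have "(1 / \<epsilon>\<^sup>2) * (\<Sum>A\<in>AA. ?V A r) < 1" using r by linarith
    then show ?thesis using \<epsilon> by (simp add: field_simps)
  qed
  have Lm: "leader r (T D) \<in> J" if "D \<in> I" for D
    using leader_in[of "T D" r] T[OF that] finite_subset[OF T(1)[OF that] J] by blast
  have Xm[measurable]: "?X A r \<in> borel_measurable ?P" if "A \<in> AA" for A
  proof -
    have "(\<lambda>y. w D * indicator (E A D (leader r (T D))) (y (leader r (T D))) :: real) \<in> borel_measurable ?P" if "D \<in> I" for D
      using E[OF \<open>A \<in> AA\<close> that Lm[OF that]]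
      by (intro borel_measurable_times borel_measurable_const measurable_compose[OF measurable_component_singleton[OF Lm[OF that]]]) simp
    then show ?thesis by (intro borel_measurable_diff borel_measurable_sum borel_measurable_const)
  qed
  have X1: "\<bar>?X A r y\<bar> \<le> 1" if "A \<in> AA" for A y
  proof -
    have "?S A r y \<le> (\<Sum>D\<in>I. w D)"
      using w by (intro sum_mono) (auto simp: indicator_def)
    moreover have "0 \<le> ?S A r y"
      using w by (intro sum_nonneg) (auto simp: indicator_def)
    ultimately show ?thesis using c[OF that] w by linarith
  qed
  have Xint: "integrable ?P (\<lambda>y. (?X A r y)\<^sup>2)" if "A \<in> AA" for A
    using X1[OF that] Xm[OF that] by (intro P.integrable_const_bound[where B=1]) (auto simp: abs_square_le_1)
  have "\<exists>y\<in>space ?P. (\<Sum>A\<in>AA. (?X A r y)\<^sup>2) < \<epsilon>\<^sup>2"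
  proof (rule ccontr)
    assume "\<not> ?thesis"
    then have ge: "\<epsilon>\<^sup>2 \<le> (\<Sum>A\<in>AA. (?X A r y)\<^sup>2)" if "y \<in> space ?P" for y using that by (auto simp: not_less)
    have "\<epsilon>\<^sup>2 = (\<integral>y. \<epsilon>\<^sup>2 \<partial>?P)" by (simp add: P.prob_space)
    also have "\<dots> \<le> (\<integral>y. (\<Sum>A\<in>AA. (?X A r y)\<^sup>2) \<partial>?P)"
      using Xint by (intro integral_mono ge) auto
    also have "\<dots> = (\<Sum>A\<in>AA. ?V A r)" using Xint by (simp add: Bochner_Integration.integral_sum)
    finally show False using sumV by simp
  qed
  then obtain y where y: "y \<in> space ?P" "(\<Sum>A\<in>AA. (?X A r y)\<^sup>2) < \<epsilon>\<^sup>2" by blast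
  have "\<bar>?X A r y\<bar> < \<epsilon>" if "A \<in> AA" for A
  proof -
    have "(?X A r y)\<^sup>2 \<le> (\<Sum>A\<in>AA. (?X A r y)\<^sup>2)" using AA that by (intro member_le_sum) auto
    then have "(?X A r y)\<^sup>2 < \<epsilon>\<^sup>2" using y by linarith
    then have "\<bar>?X A r y\<bar>\<^sup>2 < \<epsilon>\<^sup>2" by simp
    then show ?thesis using \<epsilon> power2_less_imp_less[of "\<bar>?X A r y\<bar>" \<epsilon>] by simp
  qed
  then show ?thesis using r(1) y(1) badr by blast
qed

section \<open>Codes, partitions and atoms\<close>

text \<open>Makes \<open>nat \<Rightarrow> bool\<close> second countable, so that Borel
  measurability into its countable powers can be checked coordinatewise.\<close>

instance bool :: second_countable_topology
proof
  have "open A = generate_topology (UNIV :: bool set set) A" for A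
    using discrete_topology_class.open_discrete[of A] generate_topology.Basis[of A UNIV] by blast
  then have "open = generate_topology (UNIV :: bool set set)" by blast
  moreover have "countable (UNIV :: bool set set)" by (simp add: countable_finite)
  ultimately show "\<exists>B :: bool set set. countable B \<and> open = generate_topology B" by blast
qed

lemma pred_imp_borel_measurable: "Measurable.pred M P \<Longrightarrow> P \<in> borel_measurable M"
  using measurable_compose[of P M "count_space UNIV" "\<lambda>x. x" borel] by simp

lemma borel_measurable_imp_pred:
  assumes "P \<in> borel_measurable M"
  shows "Measurable.pred M P"
proof (unfold pred_def)
  from measurable_sets[OF assms, of "{True}"] show "{x \<in> space M. P x} \<in> sets M"
    by (simp add: vimage_def Int_def conj_commute)
qed

text \<open>The code lists which balls of radius 1/(j+1) around a dense sequence contain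
  \<open>b\<close>. For each \<open>j\<close> the first listed centre approximates \<open>b\<close>,
  and the limit is an explicit Borel left inverse, so images of injective Borel maps never have to
  be discussed.\<close>

lemma borel_code_exists:
  "\<exists>(code :: 'b::polish_space \<Rightarrow> nat \<Rightarrow> bool) decode. code \<in> borel_measurable borel \<and>
     decode \<in> borel_measurable borel \<and> (\<forall>b. decode (code b) = b)"
proof -
  obtain D :: "'b set" where D: "countable D" "\<And>X. open X \<Longrightarrow> X \<noteq> {} \<Longrightarrow> \<exists>d\<in>D. d \<in> X"
    using countable_dense_exists by blast
  have "D \<noteq> {}" using D(2)[of UNIV] by auto
  define d where "d = from_nat_into D"
  have dense: "\<exists>i. dist b (d i) < e" if "e > 0" for b e
  proof -
    have "\<exists>x\<in>D. x \<in> ball b e" using that by (intro D(2)) auto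
    then show ?thesis using range_from_nat_into[OF \<open>D \<noteq> {}\<close> D(1)] by (auto simp: d_def) (metis rangeE)
  qed
  define code where "code b n = (dist b (d (fst (prod_decode n))) < 1 / real (Suc (snd (prod_decode n))))" for b n
  define near where "near c j = d (LEAST i. c (prod_encode (i, j)))" for c :: "nat \<Rightarrow> bool" and j
  have code: "dist b (near (code b) j) < 1 / real (Suc j)" for b j
  proof -
    have "\<exists>i. code b (prod_encode (i, j))" using dense[of "1 / real (Suc j)" b] by (simp add: code_def)
    then have "code b (prod_encode (LEAST i. code b (prod_encode (i, j)), j))" by (rule LeastI_ex)
    then show ?thesis by (simp add: code_def near_def)
  qed
  have coord: "Measurable.pred borel (\<lambda>c :: nat \<Rightarrow> bool. c n)" for n
    by (rule borel_measurable_imp_pred) (rule measurable_product_coordinates)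
  have near_m[measurable]: "(\<lambda>c. near c j) \<in> borel_measurable borel" for j
  proof -
    have "(\<lambda>c :: nat \<Rightarrow> bool. LEAST i. c (prod_encode (i, j))) \<in> measurable borel (count_space UNIV)"
      using coord by (intro measurable_Least) auto
    then show ?thesis unfolding near_def by (rule measurable_compose) simp
  qed
  \<comment> \<open>An arbitrary bit sequence need not be a code. Replacing non-Cauchy sequences by
    a constant one makes \<open>decode\<close> a limit of Borel functions everywhere.\<close>
  define lims where "lims c j = (if Cauchy (near c) then near c j else d 0)" for c j
  have lims_m[measurable]: "(\<lambda>c. lims c j) \<in> borel_measurable borel" for j
    unfolding lims_def by measurable
  define decode where "decode c = lim (lims c)" for c
  have "convergent (lims c)" for c
    unfolding lims_def by (cases "Cauchy (near c)") (auto simp: Cauchy_convergent_iff convergent_const)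
  then have lim: "lims c \<longlonglongrightarrow> decode c" for c
    by (simp add: decode_def convergent_LIMSEQ_iff)
  have "decode \<in> borel_measurable borel"
    by (rule borel_measurable_LIMSEQ_metric[OF lims_m lim])
  moreover have "code \<in> borel_measurable borel"
  proof (rule measurable_coordinatewise_then_product, rule pred_imp_borel_measurable)
    show "Measurable.pred borel (\<lambda>b. code b n)" for n
      unfolding code_def by measurable
  qed
  moreover have "decode (code b) = b" for b
  proof -
    have nb: "near (code b) \<longlonglongrightarrow> b"
    proof (rule metric_tendsto_imp_tendsto[OF LIMSEQ_Suc[OF lim_1_over_n]])
      show "\<forall>\<^sub>F j in sequentially. dist (near (code b) j) b \<le> dist (1 / real (Suc j)) 0"
        using code[of b] by (auto intro!: always_eventually less_imp_le simp: dist_commute dist_real_def)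
    qed
    then have "Cauchy (near (code b))" by (rule LIMSEQ_imp_Cauchy)
    then have "lims (code b) = near (code b)" by (simp add: lims_def fun_eq_iff)
    then show ?thesis using nb by (simp add: decode_def limI)
  qed
  ultimately show ?thesis by blast
qed

section \<open>Finite partitions into cells by the first bits of a code\<close>

definition piece :: "('b \<Rightarrow> nat \<Rightarrow> bool) \<Rightarrow> nat \<Rightarrow> 'b \<Rightarrow> nat set" where
  "piece code r b = {i. i < r \<and> code b i}"

lemma piece_in_Pow: "piece code r b \<in> Pow {..<r}"
  by (auto simp: piece_def)

lemma piece_eq_antimono: "piece code r x = piece code r y \<Longrightarrow> s \<le> r \<Longrightarrow> piece code s x = piece code s y"
  for s r :: nat
proof -
  assume "s \<le> r"
  then have "piece code s b = piece code r b \<inter> {..<s}" for b by (auto simp: piece_def)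
  then show "piece code r x = piece code r y \<Longrightarrow> piece code s x = piece code s y" by simp
qed

lemma piece_eq_all:
  assumes "\<And>r. piece code r x = piece code r y"
  shows "code x = code y"
proof
  fix n
  show "code x n = code y n" using assms[of "Suc n"] by (auto simp: piece_def set_eq_iff)
qed

lemma measurable_piece:
  assumes "code \<in> borel_measurable M"
  shows "piece code r \<in> measurable M (count_space (Pow {..<r}))"
proof (rule measurable_count_space_eq2[THEN iffD2], simp, intro conjI ballI)
  have p: "Measurable.pred M (\<lambda>b. code b n)" for n
    using measurable_compose[OF assms measurable_product_coordinates] by (rule borel_measurable_imp_pred)
  show "piece code r \<in> space M \<rightarrow> Pow {..<r}" by (rule Pi_I) (rule piece_in_Pow)
  fix P assume P: "P \<in> Pow {..<r}"
  have "piece code r b = P \<longleftrightarrow> (\<forall>i\<in>{..<r}. code b i = (i \<in> P))" for b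
    using P unfolding piece_def set_eq_iff Pow_iff subset_iff by blast
  then have "piece code r -` {P} \<inter> space M = {b \<in> space M. \<forall>i\<in>{..<r}. code b i = (i \<in> P)}"
    unfolding vimage_def by blast
  also have "\<dots> \<in> sets M" using p by measurable
  finally show "piece code r -` {P} \<inter> space M \<in> sets M" .
qed

lemma sets_piece_eq:
  assumes [measurable]: "code \<in> borel_measurable M"
  shows "{b \<in> space M. piece code r b = P} \<in> sets M"
proof (cases "P \<in> Pow {..<r}")
  case True
  have "{b \<in> space M. piece code r b = P} = piece code r -` {P} \<inter> space M" by auto
  also have "\<dots> \<in> sets M" using True by (intro measurable_sets[OF measurable_piece[OF assms]]) auto
  finally show ?thesis .
next
  case False
  then have "piece code r b \<noteq> P" for b using piece_in_Pow[of code r b] by (cases "piece code r b = P") simp_all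
  then show ?thesis by simp
qed

lemma sets_pieces_agree:
  assumes f: "f \<in> measurable M N" and g: "g \<in> measurable M N" and code: "code \<in> borel_measurable N"
  shows "{b \<in> space M. piece code r (f b) = piece code r (g b)} \<in> sets M"
proof -
  have p: "Measurable.pred N (\<lambda>b. code b n)" for n
    using measurable_compose[OF code measurable_product_coordinates] by (rule borel_measurable_imp_pred)
  have [measurable]: "Measurable.pred M (\<lambda>b. code (f b) n)" "Measurable.pred M (\<lambda>b. code (g b) n)" for n
    using measurable_compose[OF f p] measurable_compose[OF g p] by auto
  have "{b \<in> space M. piece code r (f b) = piece code r (g b)} = {b \<in> space M. \<forall>i\<in>{..<r}. code (f b) i = code (g b) i}"
    by (auto simp: piece_def set_eq_iff)
  also have "\<dots> \<in> sets M" by measurable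
  finally show ?thesis .
qed

text \<open>The events that the first \<open>r\<close> bits agree decrease to the event
  \<open>f b = g b\<close>, which is null, and the measure is continuous from above.\<close>

lemma pieces_separate:
  assumes M: "prob_space M" and f: "f \<in> measurable M N" and g: "g \<in> measurable M N"
    and code: "code \<in> borel_measurable N" and inj: "inj code"
    and AE: "AE b in M. f b \<noteq> g b"
  shows "(\<lambda>r. measure M {b \<in> space M. piece code r (f b) = piece code r (g b)}) \<longlonglongrightarrow> 0"
proof -
  interpret prob_space M by fact
  let ?A = "\<lambda>r. {b \<in> space M. piece code r (f b) = piece code r (g b)}"
  have A: "?A r \<in> sets M" for r by (rule sets_pieces_agree[OF f g code])
  have "(\<lambda>r. measure M (?A r)) \<longlonglongrightarrow> measure M (\<Inter>r. ?A r)"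
  proof (rule finite_Lim_measure_decseq)
    show "range ?A \<subseteq> events" using A by auto
    show "decseq ?A" unfolding decseq_def by (intro allI impI Collect_mono conj_mono imp_refl) (rule piece_eq_antimono)
  qed
  moreover have sub: "(\<Inter>r. ?A r) \<subseteq> {b \<in> space M. f b = g b}"
  proof
    fix b assume "b \<in> (\<Inter>r. ?A r)"
    then have "b \<in> space M" "code (f b) = code (g b)" by (auto intro: piece_eq_all)
    then show "b \<in> {b \<in> space M. f b = g b}" using injD[OF inj] by auto
  qed
  have "AE b in M. b \<notin> (\<Inter>r. ?A r)" using AE by (rule eventually_mono) (use sub in blast)
  then have "measure M (\<Inter>r. ?A r) = 0"
    using A by (subst prob_eq_0) auto
  ultimately show ?thesis by simp
qed

text \<open>A cell of measure \<open>q\<close> contributes \<open>q\<^sup>2\<close> to the probability that two independent points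
  share a cell.\<close>

lemma pieces_small:
  assumes M: "prob_space M" and code: "code \<in> borel_measurable M" and inj: "inj code"
    and atomless: "\<And>x. {x} \<in> sets M" "\<And>x. measure M {x} = 0" and "\<delta> > 0"
  shows "\<exists>r0. \<forall>r\<ge>r0. \<forall>P. measure M {b \<in> space M. piece code r b = P} \<le> \<delta>"
proof -
  interpret prob_space M by fact
  interpret MM: pair_prob_space M M ..
  have ne: "AE p in M \<Otimes>\<^sub>M M. fst p \<noteq> snd p"
  proof -
    have s: "{p \<in> space (M \<Otimes>\<^sub>M M). fst p \<noteq> snd p} \<in> sets (M \<Otimes>\<^sub>M M)"
    proof -
      have p: "Measurable.pred M (\<lambda>b. code b n)" for n
        using measurable_compose[OF code measurable_product_coordinates] by (rule borel_measurable_imp_pred)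
      have [measurable]: "Measurable.pred (M \<Otimes>\<^sub>M M) (\<lambda>p. code (fst p) n)" "Measurable.pred (M \<Otimes>\<^sub>M M) (\<lambda>p. code (snd p) n)" for n
        using measurable_compose[OF measurable_fst p] measurable_compose[OF measurable_snd p] by auto
      have "{p \<in> space (M \<Otimes>\<^sub>M M). fst p \<noteq> snd p} = {p \<in> space (M \<Otimes>\<^sub>M M). \<exists>n. code (fst p) n \<noteq> code (snd p) n}"
        using injD[OF inj] by (auto simp: fun_eq_iff)
      also have "\<dots> \<in> sets (M \<Otimes>\<^sub>M M)" by measurable
      finally show ?thesis .
    qed
    have "AE y in M. x \<noteq> y" for x
    proof -
      have "AE y in M. y \<notin> {x}" using atomless[of x] by (subst (asm) prob_eq_0) auto
      then show ?thesis by (rule eventually_mono) auto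
    qed
    then show ?thesis using s by (intro MM.AE_pair_measure) auto
  qed
  have "(\<lambda>r. measure (M \<Otimes>\<^sub>M M) {p \<in> space (M \<Otimes>\<^sub>M M). piece code r (fst p) = piece code r (snd p)}) \<longlonglongrightarrow> 0"
    by (rule pieces_separate[OF MM.prob_space_axioms measurable_fst measurable_snd code inj ne])
  then have "eventually (\<lambda>r. measure (M \<Otimes>\<^sub>M M) {p \<in> space (M \<Otimes>\<^sub>M M). piece code r (fst p) = piece code r (snd p)} < \<delta>\<^sup>2) sequentially"
    using \<open>\<delta> > 0\<close> by (intro order_tendstoD(2)[of _ 0]) auto
  then obtain r0 where r0: "\<And>r. r \<ge> r0 \<Longrightarrow> measure (M \<Otimes>\<^sub>M M) {p \<in> space (M \<Otimes>\<^sub>M M). piece code r (fst p) = piece code r (snd p)} < \<delta>\<^sup>2"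
    by (auto simp: eventually_sequentially)
  have "measure M {b \<in> space M. piece code r b = P} \<le> \<delta>" if "r \<ge> r0" for r P
  proof -
    let ?C = "{b \<in> space M. piece code r b = P}"
    have C: "?C \<in> sets M" by (rule sets_piece_eq[OF code])
    have "(measure M ?C)\<^sup>2 = measure (M \<Otimes>\<^sub>M M) (?C \<times> ?C)"
      by (simp add: power2_eq_square measure_def emeasure_pair_measure_Times[OF C C] enn2real_mult)
    also have "\<dots> \<le> measure (M \<Otimes>\<^sub>M M) {p \<in> space (M \<Otimes>\<^sub>M M). piece code r (fst p) = piece code r (snd p)}"
      by (intro MM.P.finite_measure_mono sets_pieces_agree[OF measurable_fst measurable_snd code]) (auto simp: space_pair_measure)
    also have "\<dots> < \<delta>\<^sup>2" by (rule r0[OF that])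
    finally have "measure M ?C < \<delta>" by (rule power2_less_imp_less) (use \<open>\<delta> > 0\<close> in linarith)
    then show ?thesis by (rule less_imp_le)
  qed
  then show ?thesis by blast
qed

text \<open>Maximum principle. If there were atoms, the heaviest ones would form a nonempty finite
  set, which stationarity makes invariant. An infinite group acting on a finite set has a nontrivial
  element fixing a given point, contrary to freeness.\<close>

lemma free_stationary_atomless:
  fixes \<nu> :: "'b measure" and a :: "'g::group_add \<Rightarrow> 'b \<Rightarrow> 'b"
  assumes inf: "infinite (UNIV :: 'g set)" and gen: "semigroup_gen (set_pmf \<mu>) = UNIV"
    and prob: "prob_space \<nu>" and sing: "\<And>x. {x} \<in> sets \<nu>" and act: "measurable_action \<nu> a"
    and stat: "stationary \<mu> \<nu> a" and free: "essentially_free \<nu> a"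
  shows "measure \<nu> {x} = 0"
proof (rule ccontr)
  interpret prob_space \<nu> by fact
  have sp: "x \<in> space \<nu>" for x using sets.sets_into_space[OF sing[of x]] by auto
  have a0: "a 0 y = y" and aadd: "a (g + h) y = a g (a h y)" for g h y
    using act sp by (auto simp: measurable_action_def)
  have acan: "a g (a (- g) y) = y" "a (- g) (a g y) = y" for g y
    using aadd[of g "- g" y] aadd[of "- g" g y] a0 by simp_all
  define v where "v y = measure \<nu> {y}" for y
  assume "measure \<nu> {x} \<noteq> 0"
  then have vx: "v x > 0" unfolding v_def using measure_nonneg[of \<nu> "{x}"] by linarith
  have fin: "finite {y. v y \<ge> c}" if "c > 0" for c
  proof (rule ccontr)
    assume "infinite {y. v y \<ge> c}"
    then obtain S where S: "S \<subseteq> {y. v y \<ge> c}" "finite S" "card S = Suc (nat \<lceil>1 / c\<rceil>)"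
      using infinite_arbitrarily_large by blast
    have "1 / c < real (card S)" unfolding S(3) by linarith
    then have "1 < c * real (card S)" using that by (simp add: field_simps)
    also have "\<dots> = (\<Sum>y\<in>S. c)" by simp
    also have "\<dots> \<le> (\<Sum>y\<in>S. v y)" using S by (intro sum_mono) auto
    also have "\<dots> = measure \<nu> S" unfolding v_def using S sing by (intro finite_measure_eq_sum_singleton[symmetric]) auto
    also have "\<dots> \<le> 1" by simp
    finally show False by simp
  qed
  define t where "t = Max (v ` {y. v y \<ge> v x})"
  have tin: "t \<in> v ` {y. v y \<ge> v x}" unfolding t_def using fin[OF vx] by (intro Max_in) auto
  then have t0: "t > 0" using vx by auto
  have tmax: "v y \<le> t" for y
  proof (cases "v y \<ge> v x")
    case True then show ?thesis unfolding t_def using fin[OF vx] by (intro Max_ge) auto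
  next
    case False
    then show ?thesis using tin by auto
  qed
  define S where "S = {y. v y = t}"
  have finS: "finite S" using fin[OF t0] by (rule finite_subset[rotated]) (auto simp: S_def)
  obtain z where z: "z \<in> S" using tin by (auto simp: S_def)
  \<comment> \<open>The maximal mass \<open>t\<close> at \<open>y\<close> is an average over
    \<open>g\<close> of masses that are at most \<open>t\<close>, so all of these equal
    \<open>t\<close>.\<close>
  have supp: "a (- g) y \<in> S" if g: "g \<in> set_pmf \<mu>" and y: "y \<in> S" for g y
  proof -
    have eq: "{x \<in> space \<nu>. a g x \<in> {y}} = {a (- g) y}" for g using sp acan by auto
    have "emeasure \<nu> {y} = (\<integral>\<^sup>+g. emeasure \<nu> {a (- g) y} \<partial>measure_pmf \<mu>)"
      using stat sing unfolding stationary_def eq[symmetric] by blast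
    then have "ennreal t = (\<integral>\<^sup>+g. ennreal (v (a (- g) y)) \<partial>measure_pmf \<mu>)"
      using y by (simp add: emeasure_eq_measure v_def S_def)
    also have "\<dots> = ennreal (\<integral>g. v (a (- g) y) \<partial>measure_pmf \<mu>)"
      by (intro nn_integral_eq_integral measure_pmf.integrable_const_bound[where B=1]) (auto simp: v_def)
    finally have "t = (\<integral>g. v (a (- g) y) \<partial>measure_pmf \<mu>)"
      using t0 by (subst (asm) ennreal_inj) (auto simp: v_def)
    moreover have int: "integrable (measure_pmf \<mu>) (\<lambda>g. v (a (- g) y))"
      by (intro measure_pmf.integrable_const_bound[where B=1]) (auto simp: v_def)
    ultimately have "(\<integral>g. t - v (a (- g) y) \<partial>measure_pmf \<mu>) = 0" by simp
    moreover have "integrable (measure_pmf \<mu>) (\<lambda>g. t - v (a (- g) y))"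
      by (rule Bochner_Integration.integrable_diff[OF _ int]) simp
    ultimately have "AE g in measure_pmf \<mu>. t - v (a (- g) y) = 0"
      using tmax by (subst (asm) integral_nonneg_eq_0_iff_AE) auto
    then show ?thesis using g by (auto simp: AE_measure_pmf_iff S_def)
  qed
  have all: "\<forall>y\<in>S. a g y \<in> S" for g
  proof -
    have "g \<in> semigroup_gen (set_pmf \<mu>)" using gen by simp
    then show ?thesis
    proof induction
      case (base g)
      \<comment> \<open>Only translates by inverses are known to stay in \<open>S\<close>;
        finiteness turns the inclusion into an equality, which yields the translates by
        \<open>g\<close> themselves.\<close>
      have "a (- g) ` S = S"
        using supp[OF base] acan by (intro card_subset_eq finS card_image) (auto simp: inj_on_def, metis acan)
      then show ?case using acan by (metis imageE)
    next
      case (mult g h) then show ?case by (simp add: aadd)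
    qed
  qed
  have "\<not> inj_on (\<lambda>g. a g z) UNIV"
  proof
    assume "inj_on (\<lambda>g. a g z) UNIV"
    moreover have "finite (range (\<lambda>g. a g z))" using all z by (intro finite_subset[OF _ finS]) auto
    ultimately show False using inf finite_imageD by blast
  qed
  then obtain g h where gh: "a g z = a h z" "g \<noteq> h" by (auto simp: inj_on_def)
  have "a (- h + g) z = z" using gh(1) by (simp add: aadd acan)
  moreover have "- h + g \<noteq> 0" using gh(2) by (metis add.right_neutral add_minus_cancel)
  ultimately have "AE y in \<nu>. y \<notin> {z}"
    using free by (auto simp: essentially_free_def elim!: eventually_mono allE[of _ "- h + g"])
  then have "measure \<nu> {z} = 0" using sing by (subst prob_eq_0) auto
  then show False using z t0 by (simp add: S_def v_def)
qed

section \<open>Free extensions of the Poisson boundary\<close>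

lemma integral_finite_range:
  fixes \<rho> :: "'d \<Rightarrow> real"
  assumes M: "prob_space M" and f: "f \<in> measurable M (count_space I)" and I: "finite I"
  shows "(\<integral>x. \<rho> (f x) \<partial>M) = (\<Sum>D\<in>I. measure M {x \<in> space M. f x = D} * \<rho> D)"
    and "integrable M (\<lambda>x. \<rho> (f x))"
    and "D \<in> I \<Longrightarrow> {x \<in> space M. f x = D} \<in> sets M"
proof -
  interpret prob_space M by fact
  have s: "{x \<in> space M. f x = D} \<in> sets M" if "D \<in> I" for D
    using measurable_sets[OF f, of "{D}"] that by (simp add: vimage_def Int_def conj_commute)
  then show "D \<in> I \<Longrightarrow> {x \<in> space M. f x = D} \<in> sets M" .
  have eq: "\<rho> (f x) = (\<Sum>D\<in>I. indicator {x \<in> space M. f x = D} x * \<rho> D)" if "x \<in> space M" for x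
  proof -
    have "f x \<in> I" using measurable_space[OF f that] by simp
    then have "(\<Sum>D\<in>I. indicator {x \<in> space M. f x = D} x * \<rho> D) = (\<Sum>D\<in>I. if f x = D then \<rho> D else 0)"
      using that by (intro sum.cong) (auto simp: indicator_def)
    then show ?thesis using \<open>f x \<in> I\<close> I by simp
  qed
  have int: "integrable M (\<lambda>x. indicator {x \<in> space M. f x = D} x * \<rho> D)" if "D \<in> I" for D
    using s[OF that] by (intro integrable_mult_left integrable_real_indicator) (auto simp: emeasure_eq_measure)
  have "integrable M (\<lambda>x. \<Sum>D\<in>I. indicator {x \<in> space M. f x = D} x * \<rho> D)"
    by (rule Bochner_Integration.integrable_sum) (rule int)
  then show "integrable M (\<lambda>x. \<rho> (f x))"
    by (rule Bochner_Integration.integrable_cong[THEN iffD1, rotated 2]) (simp_all add: eq)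
  have "(\<integral>x. \<rho> (f x) \<partial>M) = (\<integral>x. (\<Sum>D\<in>I. indicator {x \<in> space M. f x = D} x * \<rho> D) \<partial>M)"
    by (rule Bochner_Integration.integral_cong) (simp_all add: eq)
  also have "\<dots> = (\<Sum>D\<in>I. measure M {x \<in> space M. f x = D} * \<rho> D)"
    using int s by (simp add: Bochner_Integration.integral_sum)
  finally show "(\<integral>x. \<rho> (f x) \<partial>M) = (\<Sum>D\<in>I. measure M {x \<in> space M. f x = D} * \<rho> D)" .
qed

text \<open>For comparing the tokens of a point with those of its translate. The map \<phi> may
  identify pairs: the symmetric difference of the images still comes from that of the sets of pairs,
  and two initial segments differ in as many elements as their lengths do.\<close>

lemma card_image_Sigma_diff:
  fixes n0 n1 :: "'g \<Rightarrow> nat"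
  assumes G: "finite G"
  shows "card ((\<phi> ` (SIGMA g:G. {..<n0 g}) - \<phi> ` (SIGMA g:G. {..<n1 g})) \<union> (\<phi> ` (SIGMA g:G. {..<n1 g}) - \<phi> ` (SIGMA g:G. {..<n0 g})))
    \<le> (\<Sum>g\<in>G. nat \<bar>int (n0 g) - int (n1 g)\<bar>)"
proof -
  let ?S = "SIGMA g:G. ({..<n0 g} - {..<n1 g}) \<union> ({..<n1 g} - {..<n0 g})"
  have "card ((\<phi> ` (SIGMA g:G. {..<n0 g}) - \<phi> ` (SIGMA g:G. {..<n1 g})) \<union> (\<phi> ` (SIGMA g:G. {..<n1 g}) - \<phi> ` (SIGMA g:G. {..<n0 g})))
    \<le> card (\<phi> ` ?S)"
  proof (rule card_mono)
    have sub: "\<phi> ` X - \<phi> ` Y \<subseteq> \<phi> ` ?S" if "X - Y \<subseteq> ?S" for X Y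
      using image_diff_subset[of \<phi> X Y] image_mono[OF that, of \<phi>] by (rule subset_trans)
    show "(\<phi> ` (SIGMA g:G. {..<n0 g}) - \<phi> ` (SIGMA g:G. {..<n1 g})) \<union> (\<phi> ` (SIGMA g:G. {..<n1 g}) - \<phi> ` (SIGMA g:G. {..<n0 g})) \<subseteq> \<phi> ` ?S"
      by (intro Un_least sub) auto
  qed (use G in simp)
  also have "\<dots> \<le> card ?S" using G by (intro card_image_le) auto
  also have "\<dots> = (\<Sum>g\<in>G. card (({..<n0 g} - {..<n1 g}) \<union> ({..<n1 g} - {..<n0 g})))"
    using G by (intro card_SigmaI) auto
  also have "\<dots> = (\<Sum>g\<in>G. nat \<bar>int (n0 g) - int (n1 g)\<bar>)"
  proof (rule sum.cong[OF refl])
    fix g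
    have "({..<n0 g} - {..<n1 g}) \<union> ({..<n1 g} - {..<n0 g}) = {min (n0 g) (n1 g)..<max (n0 g) (n1 g)}"
      by auto
    then show "card (({..<n0 g} - {..<n1 g}) \<union> ({..<n1 g} - {..<n0 g})) = nat \<bar>int (n0 g) - int (n1 g)\<bar>"
      by simp
  qed
  finally show ?thesis .
qed

lemma measurable_shift_act:
  "shift_act (g :: 'g::{group_add,countable}) \<in> measurable borel (borel :: ('g \<Rightarrow> nat \<Rightarrow> bool) measure)"
  unfolding shift_act_def by (rule measurable_coordinatewise_then_product) (rule measurable_product_coordinates)

lemma measurable_action_shift:
  fixes \<eta> :: "('g::{group_add,countable} \<Rightarrow> nat \<Rightarrow> bool) measure"
  assumes "sets \<eta> = sets borel"
  shows "measurable_action \<eta> shift_act"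
  unfolding measurable_action_def
proof (intro conjI allI ballI)
  show "shift_act g \<in> measurable \<eta> \<eta>" for g
    using measurable_shift_act measurable_cong_sets[OF assms assms] by blast
  show "shift_act 0 x = x" for x :: "'g \<Rightarrow> nat \<Rightarrow> bool"
    by (simp add: shift_act_def)
  show "shift_act (g + h) x = shift_act g (shift_act h x)" for g h and x :: "'g \<Rightarrow> nat \<Rightarrow> bool"
    by (simp only: shift_act_def minus_add add.assoc)
qed

locale free_extension = poisson_space \<mu> B0 a0 bnd
  for \<mu> :: "'g::{group_add, countable} pmf" and B0 :: "'c::polish_space measure" and a0 bnd +
  fixes \<nu> :: "'b::polish_space measure" and a :: "'g \<Rightarrow> 'b \<Rightarrow> 'b" and \<pi> :: "'b \<Rightarrow> 'c"
  assumes infinite_group: "infinite (UNIV :: 'g set)"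
    and sets_\<nu>: "sets \<nu> = sets borel" and prob_space_\<nu>: "prob_space \<nu>" and action: "measurable_action \<nu> a"
    and stationary_\<nu>: "stationary \<mu> \<nu> a" and free: "essentially_free \<nu> a"
    and measurable_\<pi>: "\<pi> \<in> measurable \<nu> B0"
    and equivariant: "\<forall>g. AE x in \<nu>. \<pi> (a g x) = a0 g (\<pi> x)"
    and distr_\<pi>: "distr \<nu> B0 \<pi> = B0"
begin

lemma space_\<nu> [simp]: "space \<nu> = UNIV"
  using sets_eq_imp_space_eq[OF sets_\<nu>] by simp

lemma measurable_a: "a g \<in> measurable \<nu> \<nu>"
  using action by (simp add: measurable_action_def)

lemma a_zero [simp]: "a 0 x = x"
  using action by (simp add: measurable_action_def)

lemma a_add: "a (g + h) x = a g (a h x)"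
  using action by (simp add: measurable_action_def)

lemma a_cancel [simp]: "a g (a (- g) x) = x" "a (- g) (a g x) = x"
  by (simp_all add: a_add[symmetric])

lemma atomless: "measure \<nu> {x} = 0"
  by (rule free_stationary_atomless[OF infinite_group generates prob_space_\<nu> _ action stationary_\<nu> free])
     (simp add: sets_\<nu>)

lemma AE_distinct: "g \<noteq> h \<Longrightarrow> AE x in \<nu>. a (- g) x \<noteq> a (- h) x"
proof -
  assume "g \<noteq> h"
  then have "g + - h \<noteq> 0" by simp
  then have "AE x in \<nu>. a (g + - h) x \<noteq> x" using free by (simp only: essentially_free_def) simp
  then show "AE x in \<nu>. a (- g) x \<noteq> a (- h) x"
    by (rule eventually_mono) (metis a_add a_cancel(1))
qed

text \<open>Freeness makes the finitely many orbit points \<open>a (- g) x\<close> distinct almost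
  surely, and fine cells separate them outside a set of small measure.\<close>

lemma eventually_pieces_distinct:
  assumes code: "code \<in> borel_measurable borel" "inj code" and W: "finite W" and "t > 0"
  shows "\<forall>\<^sub>F r in sequentially. measure \<nu> {x. \<not> inj_on (\<lambda>g. piece code r (a (- g) x)) W} < t"
proof -
  interpret prob_space \<nu> by (rule prob_space_\<nu>)
  let ?A = "\<lambda>r g h. {x. piece code r (a (- g) x) = piece code r (a (- h) x)}"
  let ?P = "SIGMA g:W. W - {g}"
  have code': "code \<in> borel_measurable \<nu>" using code(1) measurable_cong_sets[OF sets_\<nu> refl] by blast
  have A: "?A r g h \<in> sets \<nu>" for r g h
    using sets_pieces_agree[OF measurable_a measurable_a code', of r "- g" "- h"] by simp
  have "(\<lambda>r. \<Sum>p\<in>?P. measure \<nu> (?A r (fst p) (snd p))) \<longlonglongrightarrow> (\<Sum>p\<in>?P. 0)"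
  proof (rule tendsto_sum)
    fix p assume "p \<in> ?P"
    then have "fst p \<noteq> snd p" by auto
    from pieces_separate[OF prob_space_axioms measurable_a measurable_a code' code(2) AE_distinct[OF this]]
    show "(\<lambda>r. measure \<nu> (?A r (fst p) (snd p))) \<longlonglongrightarrow> 0" by simp
  qed
  then have "\<forall>\<^sub>F r in sequentially. (\<Sum>p\<in>?P. measure \<nu> (?A r (fst p) (snd p))) < t"
    using \<open>t > 0\<close> by (intro order_tendstoD(2)) simp_all
  then show ?thesis
  proof (rule eventually_mono)
    fix r assume lt: "(\<Sum>p\<in>?P. measure \<nu> (?A r (fst p) (snd p))) < t"
    have "measure \<nu> {x. \<not> inj_on (\<lambda>g. piece code r (a (- g) x)) W} \<le> measure \<nu> (\<Union>p\<in>?P. ?A r (fst p) (snd p))"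
      using A W by (intro finite_measure_mono sets.finite_UN) (auto simp: inj_on_def)
    also have "\<dots> \<le> (\<Sum>p\<in>?P. measure \<nu> (?A r (fst p) (snd p)))"
      using A W by (intro finite_measure_subadditive_finite) auto
    finally show "measure \<nu> {x. \<not> inj_on (\<lambda>g. piece code r (a (- g) x)) W} < t" using lt by simp
  qed
qed

text \<open>\<nu> need not be invariant, so a cell that is small for \<nu> may be large for a
  translate of it. Smallness is therefore established for the image of \<nu> under each
  \<open>a (- g)\<close>, which has no atoms either.\<close>

lemma eventually_pieces_small:
  assumes code: "code \<in> borel_measurable borel" "inj code" and F: "finite F" and "t > 0"
  shows "\<forall>\<^sub>F r in sequentially. \<forall>g\<in>F. \<forall>P. measure \<nu> {x. piece code r (a (- g) x) = P} \<le> t"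
proof (intro eventually_ball_finite[OF F] ballI)
  fix g
  interpret prob_space \<nu> by (rule prob_space_\<nu>)
  let ?N = "distr \<nu> \<nu> (a (- g))"
  have code': "code \<in> borel_measurable \<nu>" using code(1) measurable_cong_sets[OF sets_\<nu> refl] by blast
  have N: "prob_space ?N" by (rule prob_space_distr) (rule measurable_a)
  have sing: "{x} \<in> sets \<nu>" for x by (simp add: sets_\<nu>)
  have "a (- g) -` {x} = {a g x}" for x by auto
  then have zero: "measure ?N {x} = 0" for x
    using sing atomless by (simp add: measure_distr[OF measurable_a])
  have codeN: "code \<in> borel_measurable ?N" using code' by simp
  have singN: "{x} \<in> sets ?N" for x using sing by simp
  from pieces_small[OF N codeN code(2) singN zero \<open>t > 0\<close>]
  obtain r0 where r0: "\<And>r P. r \<ge> r0 \<Longrightarrow> measure ?N {b \<in> space ?N. piece code r b = P} \<le> t"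
    by blast
  have "measure \<nu> {x. piece code r (a (- g) x) = P} \<le> t" if "r \<ge> r0" for r P
    using r0[OF that, of P] sets_piece_eq[OF code', of r P]
    by (simp add: measure_distr[OF measurable_a] vimage_def)
  then show "\<forall>\<^sub>F r in sequentially. \<forall>P. measure \<nu> {x. piece code r (a (- g) x) = P} \<le> t"
    by (auto simp: eventually_sequentially)
qed

end

section \<open>Approximation by factors\<close>

context free_extension
begin

text \<open>The events see only the coordinates in \<open>K\<close>. Off a small set the orbit of
  \<open>x\<close> shows there a single translate of a single sample, and the probability that this
  translate lies in \<open>A\<close> is a weighted sum over finitely many local patterns, to which
  the second moment bound applies.\<close>

lemma approximating_factor:
  fixes \<eta> :: "('g \<Rightarrow> nat \<Rightarrow> bool) measure" and \<epsilon> :: real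
  assumes \<eta>: "\<eta> \<in> stationary_measures \<mu>" and K: "finite K" and AA: "finite AA" "\<And>A. A \<in> AA \<Longrightarrow> A \<in> sets borel"
    and local: "\<And>A y y'. A \<in> AA \<Longrightarrow> (\<And>k. k \<in> K \<Longrightarrow> y k = y' k) \<Longrightarrow> y \<in> A \<longleftrightarrow> y' \<in> A" and \<epsilon>: "\<epsilon> > 0"
  shows "\<exists>f\<in>borel_measurable \<nu>. \<forall>A\<in>AA. \<bar>measure \<nu> {x. (\<lambda>k. f (a (- k) x)) \<in> A} - measure \<eta> A\<bar> < \<epsilon>"
proof -
  interpret prob_space \<nu> by (rule prob_space_\<nu>)
  interpret B: prob_space B0 by (rule prob_space_B0)
  have s\<eta>: "sets \<eta> = sets borel" and st\<eta>: "stationary \<mu> \<eta> shift_act" and p\<eta>: "prob_space \<eta>"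
    using \<eta> by (auto simp: stationary_measures_def)
  interpret \<eta>: prob_space \<eta> by (rule p\<eta>)
  have sp\<eta>: "space \<eta> = UNIV" using sets_eq_imp_space_eq[OF s\<eta>] by simp
  have act\<eta>: "measurable_action \<eta> shift_act" by (rule measurable_action_shift[OF s\<eta>])
  have AA\<eta>: "A \<in> sets \<eta>" if "A \<in> AA" for A using AA(2)[OF that] s\<eta> by simp
  obtain code :: "'b \<Rightarrow> nat \<Rightarrow> bool" and decode where code: "code \<in> borel_measurable borel" "\<And>x. decode (code x) = x"
    using borel_code_exists by blast
  have inj: "inj code" by (rule inj_on_inverseI[of _ decode]) (rule code(2))
  have code\<nu>: "code \<in> borel_measurable \<nu>" using code(1) measurable_cong_sets[OF sets_\<nu> refl] by blast
  \<comment> \<open>Three such parts are used up in the end: by the sampling error, by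
    \<open>bad \<sigma>\<close>, and by the points that are not good, which cost less than
    \<open>t \<le> \<epsilon>1\<close>.\<close>
  define \<epsilon>1 where "\<epsilon>1 = \<epsilon> / 4"
  have \<epsilon>1: "\<epsilon>1 > 0" using \<epsilon> by (simp add: \<epsilon>1_def)
  \<comment> \<open>The sampling lemma is applied with bias 2t, overlap t and \<open>bad\<close> of
    average at most \<open>card K * t\<close>. As \<open>(2 * t)\<^sup>2 + 2 * t \<le> 6 * t\<close>
    for t at most 1, its smallness condition follows from \<open>C * t < 1\<close>.\<close>
  define C where "C = 6 * real (card AA) / \<epsilon>1\<^sup>2 + real (card K) / \<epsilon>1"
  have C: "C \<ge> 0" using \<epsilon>1 by (simp add: C_def)
  define t where "t = min 1 (min \<epsilon>1 (1 / (2 * (C + 1))))"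
  have t: "t > 0" "t \<le> 1" "t \<le> \<epsilon>1" using C \<epsilon>1 by (simp_all add: t_def)
  have tC: "C * t < 1"
  proof -
    have "t \<le> 1 / (2 * (C + 1))" by (simp add: t_def)
    then have "t * (2 * (C + 1)) \<le> 1" using C by (simp add: field_simps)
    then show ?thesis using t C by (simp add: algebra_simps)
  qed
  have small: "card AA * ((2 * t)\<^sup>2 + 2 * t) / \<epsilon>1\<^sup>2 + card K * t / \<epsilon>1 < 1"
  proof -
    have "t * t \<le> t * 1" using t by (intro mult_left_mono) auto
    then have "(2 * t)\<^sup>2 + 2 * t \<le> 6 * t" by (simp add: power2_eq_square)
    then have "card AA * ((2 * t)\<^sup>2 + 2 * t) / \<epsilon>1\<^sup>2 \<le> card AA * (6 * t) / \<epsilon>1\<^sup>2"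
      by (intro divide_right_mono mult_left_mono) auto
    also have "\<dots> + card K * t / \<epsilon>1 = C * t" by (simp add: C_def distrib_right)
    finally show ?thesis using tC by simp
  qed
  show ?thesis
  proof (rule integer_reiter[OF K t(1)])
    fix F and M :: nat and m
    assume F: "finite F" and M: "M > 0" and mM: "\<And>b. (\<Sum>g\<in>F. m b g) = M" and mF: "\<And>b g. g \<notin> F \<Longrightarrow> m b g = 0"
      and mmeas: "\<And>g. (\<lambda>b. m b g) \<in> measurable B0 (count_space UNIV)"
      and mK: "\<And>k. k \<in> K \<Longrightarrow> (\<integral>b. (\<Sum>g\<in>F \<union> (\<lambda>g. k + g) ` F. \<bar>real (m b g) - real (m (a0 (- k) b) (- k + g))\<bar>) \<partial>B0) \<le> t * M"
      and mean: "\<And>(N :: ('g \<Rightarrow> nat \<Rightarrow> bool) measure) a A. prob_space N \<Longrightarrow> measurable_action N a \<Longrightarrow> stationary \<mu> N a \<Longrightarrow> A \<in> sets N \<Longrightarrow>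
       \<bar>(\<integral>b. (\<Sum>g\<in>F. m b g / M * measure N {y \<in> space N. a g y \<in> A}) \<partial>B0) - measure N A\<bar> \<le> t"
    have mF': "g \<in> F" if "i < m b g" for i b g using mF[of g b] that by (cases "g \<in> F") auto
    have Fne: "F \<noteq> {}" using mM[of undefined] M by auto
    have mle: "m b g \<le> M" for b g
      using mM[of b] member_le_sum[of g F "m b"] F mF by (cases "g \<in> F") auto
    define mm where "mm x = m (\<pi> x)" for x
    \<comment> \<open>All group elements that occur when the tokens of \<open>x\<close> and those of
      \<open>a (- k) x\<close> are both described relative to \<open>x\<close>.\<close>
    define W where "W = F \<union> (\<Union>k\<in>K. (\<lambda>g. k + g) ` F)"
    have W: "finite W" "F \<subseteq> W" "\<And>k g. k \<in> K \<Longrightarrow> g \<in> F \<Longrightarrow> k + g \<in> W" using F K by (auto simp: W_def)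
    \<comment> \<open>A given token occurs at a random point with probability at most the sum over
      \<open>F\<close> of the measures of its cell, that is \<open>t / M\<close>. As a point has at
      most \<open>M\<close> tokens, this bounds the overlap of two independent points by
      \<open>t\<close>.\<close>
    have "0 < t / (M * card F)" using t M F Fne by (simp add: card_gt_0_iff)
    from eventually_conj[OF eventually_pieces_distinct[OF code(1) inj W(1) t(1)] eventually_pieces_small[OF code(1) inj F this]]
    obtain r where r: "measure \<nu> {x. \<not> inj_on (\<lambda>g. piece code r (a (- g) x)) W} < t"
      "\<And>g P. g \<in> F \<Longrightarrow> measure \<nu> {x. piece code r (a (- g) x) = P} \<le> t / (M * card F)"
      using eventually_happens'[OF sequentially_bot] by blast
    define p where "p g x = piece code r (a (- g) x)" for g x
    define good where "good x = inj_on (\<lambda>g. p g x) W" for x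
    have bad_t: "measure \<nu> {x. \<not> good x} < t" using r(1) by (simp add: good_def p_def)
    have p_small: "measure \<nu> {x. p g x = P} \<le> t / (M * card F)" if "g \<in> F" for g P
      using r(2)[OF that] by (simp add: p_def)
    have p_eq: "{x. p g x = P} \<in> sets \<nu>" for g P
      using measurable_sets[OF measurable_a sets_piece_eq[OF code\<nu>], of "- g" r P] by (simp add: p_def vimage_def)
    have pm[measurable]: "Measurable.pred \<nu> (\<lambda>x. p g x = p h x)" for g h
      using sets_pieces_agree[OF measurable_a measurable_a code\<nu>, of r "- g" "- h"] by (simp add: pred_def p_def)
    have pm2[measurable]: "Measurable.pred \<nu> (\<lambda>x. P = p g x)" for g P
      using p_eq[of g P] by (simp add: pred_def eq_commute)
    have goodm[measurable]: "Measurable.pred \<nu> good"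
      unfolding good_def inj_on_def using W(1) by measurable
    have mmm[measurable]: "(\<lambda>x. mm x g) \<in> measurable \<nu> (count_space UNIV)" for g
      unfolding mm_def by (rule measurable_compose[OF measurable_\<pi> mmeas])
    have p_Pow: "p g x \<in> Pow {..<r}" for g x unfolding p_def by (rule piece_in_Pow)
    \<comment> \<open>\<open>(P, i)\<close> is the \<open>i\<close>-th token of the cell \<open>P\<close>; a triple \<open>(g, i, P)\<close> in \<open>Dt x\<close> also records the
      \<open>g\<close> for which \<open>g\<^sup>-\<^sup>1 x\<close> lies in \<open>P\<close>, and \<open>gee\<close> recovers it.\<close>
    define Dt where "Dt x = (\<lambda>(g, i). (g, i, p g x)) ` (SIGMA g:F. {..<mm x g})" for x
    define tok where "tok D = (\<lambda>(g, i, P). (P, i)) ` D" for D :: "('g \<times> nat \<times> nat set) set"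
    \<comment> \<open>A finite universe for the patterns: whatever is computed from
      \<open>Dt x\<close> is then measurable, and real-valued quantities integrate to finite sums
      over \<open>I\<close>.\<close>
    define U where "U = F \<times> {..<M} \<times> Pow {..<r}"
    define I where "I = Pow U - {{}}"
    define J where "J = Pow {..<r} \<times> {..<M}"
    have finU: "finite U" using F by (simp add: U_def)
    have I: "finite I" using finU by (simp add: I_def)
    have J: "finite J" by (simp add: J_def)
    have mem: "(g, i, P) \<in> Dt x \<longleftrightarrow> g \<in> F \<and> i < mm x g \<and> P = p g x" for g i P x
      by (auto simp: Dt_def)
    have tokDt: "tok (Dt x) = (\<lambda>(g, i). (p g x, i)) ` (SIGMA g:F. {..<mm x g})" for x
      unfolding tok_def Dt_def image_image by (rule image_cong) auto
    have DtI: "Dt x \<in> I" for x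
    proof -
      have "Dt x \<subseteq> U" using mle by (auto simp: U_def mem mm_def intro: less_le_trans dest!: p_Pow[unfolded Pow_iff, THEN subsetD])
      moreover have "\<exists>g\<in>F. mm x g > 0"
      proof (rule ccontr)
        assume "\<not> ?thesis"
        then have "(\<Sum>g\<in>F. mm x g) = 0" by simp
        then show False using mM[of "\<pi> x"] M by (simp add: mm_def)
      qed
      then have "Dt x \<noteq> {}" by (auto simp: Dt_def)
      ultimately show ?thesis by (simp add: I_def)
    qed
    have tok: "tok D \<subseteq> J" "tok D \<noteq> {}" "finite (tok D)" if "D \<in> I" for D
    proof -
      show "tok D \<subseteq> J" using that by (auto simp: I_def U_def J_def tok_def)
      then show "finite (tok D)" using J finite_subset by blast
      show "tok D \<noteq> {}" using that by (simp add: I_def tok_def)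
    qed
    have Dtm: "Dt \<in> measurable \<nu> (count_space I)"
    proof (rule measurable_count_space_eq2[OF I, THEN iffD2], intro conjI ballI)
      show "Dt \<in> space \<nu> \<rightarrow> I" using DtI by simp
      fix D assume D: "D \<in> I"
      have "Dt x = D \<longleftrightarrow> (\<forall>q\<in>U. (fst q \<in> F \<and> fst (snd q) < mm x (fst q) \<and> snd (snd q) = p (fst q) x) \<longleftrightarrow> q \<in> D)" for x
      proof -
        have "Dt x = D \<longleftrightarrow> (\<forall>q\<in>U. q \<in> Dt x \<longleftrightarrow> q \<in> D)"
          using D DtI[of x] unfolding I_def by blast
        moreover have "q \<in> Dt x \<longleftrightarrow> fst q \<in> F \<and> fst (snd q) < mm x (fst q) \<and> snd (snd q) = p (fst q) x" for q :: "'g \<times> nat \<times> nat set"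
          by (cases q) (auto simp: mem)
        ultimately show ?thesis by (simp only:)
      qed
      then have "Dt -` {D} \<inter> space \<nu> = {x \<in> space \<nu>. \<forall>q\<in>U. (fst q \<in> F \<and> fst (snd q) < mm x (fst q) \<and> snd (snd q) = p (fst q) x) \<longleftrightarrow> q \<in> D}"
        by auto
      also have "\<dots> \<in> sets \<nu>"
      proof (rule sets.sets_Collect_finite_All[OF _ finU])
        fix q :: "'g \<times> nat \<times> nat set"
        have "Measurable.pred \<nu> (\<lambda>x. snd (snd q) = p (fst q) x)" by (rule pm2)
        moreover have "Measurable.pred \<nu> (\<lambda>x. fst (snd q) < mm x (fst q))"
          by (rule measurable_compose[OF mmm]) simp
        ultimately have "Measurable.pred \<nu> (\<lambda>x. (fst q \<in> F \<and> fst (snd q) < mm x (fst q) \<and> snd (snd q) = p (fst q) x) \<longleftrightarrow> q \<in> D)"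
          by (intro pred_intros_logic) simp_all
        then show "{x \<in> space \<nu>. (fst q \<in> F \<and> fst (snd q) < mm x (fst q) \<and> snd (snd q) = p (fst q) x) \<longleftrightarrow> q \<in> D} \<in> sets \<nu>"
          by (simp only: pred_def)
      qed
      finally show "Dt -` {D} \<inter> space \<nu> \<in> sets \<nu>" .
    qed
    define w where "w D = measure \<nu> {x. Dt x = D}" for D
    note fin_range = integral_finite_range[OF prob_space_\<nu> Dtm I, simplified, folded w_def]
    have w0: "0 \<le> w D" for D by (simp add: w_def)
    have w1: "sum w I = 1" using fin_range(1)[of "\<lambda>_. 1"] prob_space by simp
    \<comment> \<open>Where cells coincide, several \<open>g\<close> may fit and the choice among
      them is arbitrary; at good points it is forced.\<close>
    define gee where "gee D j = (SOME g. (g, snd j, fst j) \<in> D)" for D :: "('g \<times> nat \<times> nat set) set" and j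
    have gee: "(gee D j, snd j, fst j) \<in> D" if "j \<in> tok D" for D j
    proof -
      have "\<exists>g. (g, snd j, fst j) \<in> D" using that by (auto simp: tok_def)
      then show ?thesis unfolding gee_def by (rule someI_ex)
    qed
    have gee_good: "gee (Dt x) (p g x, i) = g" if "good x" "g \<in> F" "i < mm x g" for x g i
    proof -
      have "(p g x, i) \<in> tok (Dt x)" using that by (auto simp: tokDt)
      from gee[OF this] have "gee (Dt x) (p g x, i) \<in> F" "p g x = p (gee (Dt x) (p g x, i)) x" by (auto simp: mem)
      then show ?thesis using that W(2) unfolding good_def by (metis inj_onD subsetD)
    qed
    have inj_tok: "inj_on (\<lambda>(g, i). (p g x, i)) (SIGMA g:F. {..<mm x g})" if "good x" for x
      using that W(2) by (auto simp: good_def inj_on_def)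
    have card_tok: "card (tok (Dt x)) = M" if "good x" for x
      unfolding tokDt card_image[OF inj_tok[OF that]] using F mM[of "\<pi> x"] by (simp add: mm_def)
    define E where "E A D j = {y \<in> space \<eta>. shift_act (gee D j) y \<in> A}" for A D j
    have E: "E A D j \<in> sets \<eta>" if "A \<in> AA" for A D j
    proof -
      have "shift_act (gee D j) \<in> measurable \<eta> \<eta>" using act\<eta> by (simp add: measurable_action_def)
      from measurable_sets[OF this AA\<eta>[OF that]] show ?thesis by (simp add: E_def vimage_def Int_def conj_commute)
    qed
    have mean_bound: "\<bar>(\<Sum>D\<in>I. w D * ((\<Sum>j\<in>tok D. measure \<eta> (E A D j)) / card (tok D))) - measure \<eta> A\<bar> \<le> 2 * t" if A: "A \<in> AA" for A
    proof -
      let ?q = "\<lambda>g. measure \<eta> {y \<in> space \<eta>. shift_act g y \<in> A}"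
      let ?\<rho> = "\<lambda>D. (\<Sum>j\<in>tok D. measure \<eta> (E A D j)) / card (tok D)"
      let ?X = "\<lambda>b. \<Sum>g\<in>F. m b g / M * ?q g"
      have Xm: "?X \<in> borel_measurable B0" using mmeas by measurable
      have X01: "0 \<le> ?X b" "?X b \<le> 1" for b
      proof -
        have "?X b \<le> (\<Sum>g\<in>F. m b g / M)" by (intro sum_mono mult_left_le) auto
        also have "\<dots> = real (\<Sum>g\<in>F. m b g) / M" by (simp add: sum_divide_distrib)
        finally show "?X b \<le> 1" unfolding mM using M by simp
        show "0 \<le> ?X b" by (intro sum_nonneg) auto
      qed
      have \<rho>01: "0 \<le> ?\<rho> D" "?\<rho> D \<le> 1" if "D \<in> I" for D
      proof -
        have "(\<Sum>j\<in>tok D. measure \<eta> (E A D j)) \<le> (\<Sum>j\<in>tok D. 1)" by (intro sum_mono) simp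
        then show "?\<rho> D \<le> 1" using tok[OF that] by (simp add: card_gt_0_iff)
        show "0 \<le> ?\<rho> D" by (intro divide_nonneg_nonneg sum_nonneg) auto
      qed
      \<comment> \<open>At good points the tokens list each \<open>g\<close> exactly
        \<open>mm x g\<close> times, so the average over tokens is the average over the integer
        masses. Elsewhere both values merely lie in [0,1].\<close>
      have pt: "\<bar>?\<rho> (Dt x) - ?X (\<pi> x)\<bar> \<le> of_bool (\<not> good x)" for x
      proof (cases "good x")
        case True
        have "(\<Sum>j\<in>tok (Dt x). measure \<eta> (E A (Dt x) j)) = (\<Sum>(g, i)\<in>(SIGMA g:F. {..<mm x g}). measure \<eta> (E A (Dt x) (p g x, i)))"
          unfolding tokDt by (subst sum.reindex[OF inj_tok[OF True]]) (simp add: case_prod_beta o_def)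
        also have "\<dots> = (\<Sum>(g, i)\<in>(SIGMA g:F. {..<mm x g}). ?q g)"
          using gee_good[OF True] by (intro sum.cong) (auto simp: E_def)
        also have "\<dots> = (\<Sum>g\<in>F. mm x g * ?q g)"
          using F by (subst sum.Sigma[symmetric]) auto
        finally have "?\<rho> (Dt x) = ?X (\<pi> x)"
          using card_tok[OF True] by (simp add: mm_def sum_divide_distrib)
        then show ?thesis using True by simp
      next
        case False
        then show ?thesis using \<rho>01[OF DtI[of x]] X01[of "\<pi> x"] by simp
      qed
      have intX: "integrable \<nu> (\<lambda>x. ?X (\<pi> x))"
        using X01 measurable_compose[OF measurable_\<pi> Xm] by (intro integrable_const_bound[where B=1]) auto
      have intg: "integrable \<nu> (\<lambda>x. of_bool (\<not> good x) :: real)"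
        by (intro integrable_const_bound[where B=1]) auto
      have "\<bar>(\<integral>x. ?\<rho> (Dt x) \<partial>\<nu>) - (\<integral>x. ?X (\<pi> x) \<partial>\<nu>)\<bar> = \<bar>\<integral>x. ?\<rho> (Dt x) - ?X (\<pi> x) \<partial>\<nu>\<bar>"
        using fin_range(2)[of ?\<rho>] intX by simp
      also have "\<dots> \<le> (\<integral>x. \<bar>?\<rho> (Dt x) - ?X (\<pi> x)\<bar> \<partial>\<nu>)" by (rule integral_abs_bound)
      also have "\<dots> \<le> (\<integral>x. of_bool (\<not> good x) \<partial>\<nu>)"
        using fin_range(2)[of ?\<rho>] intX intg by (intro integral_mono pt) auto
      also have "\<dots> = (\<integral>x. indicator {x. \<not> good x} x \<partial>\<nu>)"
        by (intro Bochner_Integration.integral_cong) (auto simp: indicator_def)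
      also have "\<dots> = measure \<nu> {x. \<not> good x}" by simp
      also have "\<dots> \<le> t" using bad_t by simp
      finally have 1: "\<bar>(\<integral>x. ?\<rho> (Dt x) \<partial>\<nu>) - (\<integral>x. ?X (\<pi> x) \<partial>\<nu>)\<bar> \<le> t" .
      have "(\<integral>x. ?X (\<pi> x) \<partial>\<nu>) = (\<integral>b. ?X b \<partial>distr \<nu> B0 \<pi>)"
        using Xm by (subst integral_distr[OF measurable_\<pi>]) auto
      then have "(\<integral>x. ?X (\<pi> x) \<partial>\<nu>) = (\<integral>b. ?X b \<partial>B0)" unfolding distr_\<pi> .
      then have "\<bar>(\<integral>x. ?X (\<pi> x) \<partial>\<nu>) - measure \<eta> A\<bar> \<le> t"
        using mean[OF p\<eta> act\<eta> st\<eta> AA\<eta>[OF A]] by simp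
      moreover have "(\<integral>x. ?\<rho> (Dt x) \<partial>\<nu>) = (\<Sum>D\<in>I. w D * ?\<rho> D)" by (rule fin_range(1))
      ultimately show ?thesis using 1 by linarith
    qed
    have overlap: "(\<Sum>D\<in>I. \<Sum>D'\<in>I. (if tok D \<inter> tok D' \<noteq> {} then w D * w D' else 0)) \<le> t"
    proof -
      \<comment> \<open>The probability that token \<open>j\<close> is present. Two independent
        patterns share a token with probability at most the sum of the \<open>q j * q j\<close>,
        hence at most the largest \<open>q j\<close> times the expected number of tokens.\<close>
      define q where "q j = (\<Sum>D\<in>I. w D * of_bool (j \<in> tok D))" for j
      have q0: "0 \<le> q j" for j unfolding q_def using w0 by (intro sum_nonneg) auto
      have q_le: "q j \<le> t / M" for j
      proof -
        have "q j = (\<integral>x. of_bool (j \<in> tok (Dt x)) \<partial>\<nu>)" unfolding q_def by (rule fin_range(1)[symmetric])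
        also have "\<dots> \<le> (\<integral>x. (\<Sum>g\<in>F. indicator {x. p g x = fst j} x) \<partial>\<nu>)"
        proof (rule integral_mono)
          show "integrable \<nu> (\<lambda>x. \<Sum>g\<in>F. indicator {x. p g x = fst j} x :: real)"
            using p_eq by (intro Bochner_Integration.integrable_sum) (auto simp: emeasure_eq_measure)
          show "(of_bool (j \<in> tok (Dt x)) :: real) \<le> (\<Sum>g\<in>F. indicator {x. p g x = fst j} x)" for x
          proof (cases "j \<in> tok (Dt x)")
            case True
            then obtain g where g: "g \<in> F" "p g x = fst j" by (auto simp: tokDt)
            then have "1 \<le> (indicator {x. p g x = fst j} x :: real)" by simp
            also have "\<dots> \<le> (\<Sum>g\<in>F. indicator {x. p g x = fst j} x)" using g F by (intro member_le_sum) auto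
            finally show ?thesis using True by simp
          qed (simp add: sum_nonneg)
        qed (rule fin_range(2))
        also have "\<dots> = (\<Sum>g\<in>F. measure \<nu> {x. p g x = fst j})"
          using p_eq by (subst Bochner_Integration.integral_sum) (auto simp: emeasure_eq_measure)
        also have "\<dots> \<le> (\<Sum>g\<in>F. t / (M * card F))" by (intro sum_mono p_small)
        also have "\<dots> = t / M" using F Fne by (simp add: card_gt_0_iff)
        finally show ?thesis .
      qed
      have q_sum: "(\<Sum>j\<in>J. q j) \<le> M"
      proof -
        have "(\<Sum>j\<in>J. q j) = (\<Sum>D\<in>I. w D * (\<Sum>j\<in>J. of_bool (j \<in> tok D)))"
          unfolding q_def by (subst sum.swap) (simp add: sum_distrib_left)
        also have "\<dots> = (\<Sum>D\<in>I. w D * card (tok D))"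
          using tok J by (intro sum.cong refl arg_cong2[where f="(*)"]) (auto simp: Int_absorb1)
        also have "\<dots> = (\<integral>x. real (card (tok (Dt x))) \<partial>\<nu>)" by (rule fin_range(1)[symmetric])
        also have "\<dots> \<le> (\<integral>x. real M \<partial>\<nu>)"
        proof (rule integral_mono)
          show "real (card (tok (Dt x))) \<le> real M" for x
          proof -
            have "card (tok (Dt x)) \<le> card (SIGMA g:F. {..<mm x g})" unfolding tokDt using F by (intro card_image_le) auto
            also have "\<dots> = M" using F mM[of "\<pi> x"] by (simp add: mm_def)
            finally show ?thesis by simp
          qed
        qed (use fin_range(2)[of "\<lambda>D. real (card (tok D))"] in simp_all)
        finally show ?thesis using prob_space by simp
      qed
      have "(\<Sum>D\<in>I. \<Sum>D'\<in>I. (if tok D \<inter> tok D' \<noteq> {} then w D * w D' else 0)) \<le> 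
         (\<Sum>D\<in>I. \<Sum>D'\<in>I. \<Sum>j\<in>J. (w D * of_bool (j \<in> tok D)) * (w D' * of_bool (j \<in> tok D')))"
      proof (intro sum_mono)
        fix D D' assume D: "D \<in> I" "D' \<in> I"
        show "(if tok D \<inter> tok D' \<noteq> {} then w D * w D' else 0) \<le> (\<Sum>j\<in>J. (w D * of_bool (j \<in> tok D)) * (w D' * of_bool (j \<in> tok D')))"
        proof (cases "tok D \<inter> tok D' = {}")
          case False
          then obtain j where j: "j \<in> tok D" "j \<in> tok D'" by auto
          have "w D * w D' = (w D * of_bool (j \<in> tok D)) * (w D' * of_bool (j \<in> tok D'))" using j by simp
          also have "\<dots> \<le> (\<Sum>j\<in>J. (w D * of_bool (j \<in> tok D)) * (w D' * of_bool (j \<in> tok D')))"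
            using w0 tok(1)[OF D(1)] j J by (intro member_le_sum) auto
          finally show ?thesis using False by simp
        qed (use w0 in \<open>auto intro!: sum_nonneg mult_nonneg_nonneg\<close>)
      qed
      also have "\<dots> = (\<Sum>j\<in>J. \<Sum>D\<in>I. \<Sum>D'\<in>I. (w D * of_bool (j \<in> tok D)) * (w D' * of_bool (j \<in> tok D')))"
        by (rule trans[OF sum.cong[OF refl sum.swap] sum.swap])
      also have "\<dots> = (\<Sum>j\<in>J. q j * q j)"
        unfolding q_def sum_product ..
      also have "\<dots> \<le> (\<Sum>j\<in>J. (t / M) * q j)"
        by (intro sum_mono mult_right_mono q_le q0)
      also have "\<dots> = (t / M) * (\<Sum>j\<in>J. q j)" by (rule sum_distrib_left[symmetric])
      also have "\<dots> \<le> (t / M) * M" using t by (intro mult_left_mono q_sum) auto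
      finally show ?thesis using M by simp
    qed
    \<comment> \<open>Restricted to good points because there the pattern has exactly
      \<open>M\<close> tokens, the denominator of the leader bound.\<close>
    define differ where "differ k \<sigma> x = (good x \<and> leader \<sigma> (tok (Dt (a (- k) x))) \<noteq> leader \<sigma> (tok (Dt x)))" for k \<sigma> x
    have Dtam: "(\<lambda>x. Dt (a (- k) x)) \<in> measurable \<nu> (count_space I)" for k
      by (rule measurable_compose[OF measurable_a Dtm])
    have differm: "{x. differ k \<sigma> x} \<in> sets \<nu>" for k \<sigma>
    proof -
      have "(\<lambda>x. (Dt (a (- k) x), Dt x)) \<in> measurable \<nu> (count_space I \<Otimes>\<^sub>M count_space I)"
        by (rule measurable_Pair[OF Dtam Dtm])
      then have "(\<lambda>x. (Dt (a (- k) x), Dt x)) \<in> measurable \<nu> (count_space (I \<times> I))"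
        using I by (simp add: pair_measure_count_space)
      from measurable_compose[OF this, of "\<lambda>q. leader \<sigma> (tok (fst q)) \<noteq> leader \<sigma> (tok (snd q))" "count_space UNIV"]
      have [measurable]: "Measurable.pred \<nu> (\<lambda>x. leader \<sigma> (tok (Dt (a (- k) x))) \<noteq> leader \<sigma> (tok (Dt x)))" by simp
      have "{x \<in> space \<nu>. differ k \<sigma> x} \<in> sets \<nu>" unfolding differ_def by measurable
      then show ?thesis by simp
    qed
    define bad where "bad \<sigma> = (\<Sum>k\<in>K. measure \<nu> {x. differ k \<sigma> x})" for \<sigma>
    have bad0: "0 \<le> bad \<sigma>" for \<sigma> by (simp add: bad_def sum_nonneg)
    have bad_avg: "rank_avg J bad \<le> card K * t"
    proof -
      have "rank_avg J (\<lambda>\<sigma>. measure \<nu> {x. differ k \<sigma> x}) \<le> t" if k: "k \<in> K" for k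
      proof -
        let ?G = "F \<union> (\<lambda>g. k + g) ` F"
        let ?d = "\<lambda>b. (\<Sum>g\<in>?G. \<bar>real (m b g) - real (m (a0 (- k) b) (- k + g))\<bar>)"
        have finG: "finite ?G" using F by simp
        have GW: "?G \<subseteq> W" using k by (auto simp: W_def)
        have dm: "?d \<in> borel_measurable B0"
          using mmeas measurable_compose[OF measurable_a0 mmeas] by measurable
        have d_bd: "\<bar>?d b\<bar> \<le> card ?G * M" for b
        proof -
          have "?d b \<le> (\<Sum>g\<in>?G. real M)"
            by (intro sum_mono) (smt (verit) mle of_nat_0_le_iff of_nat_mono)
          then show ?thesis by (simp add: sum_nonneg)
        qed
        have pt: "rank_avg J (\<lambda>\<sigma>. of_bool (differ k \<sigma> x)) \<le> ?d (\<pi> x) / M" 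
          if eq: "\<pi> (a (- k) x) = a0 (- k) (\<pi> x)" for x
        proof (cases "good x")
          case True
          let ?n1 = "\<lambda>g. m (a0 (- k) (\<pi> x)) (- k + g)"
          let ?\<phi> = "\<lambda>(g, i). (p g x, i :: nat)"
          have T0: "tok (Dt x) = ?\<phi> ` (SIGMA g:?G. {..<mm x g})"
            unfolding tokDt by (intro arg_cong[where f="image ?\<phi>"]) (auto simp: mm_def dest: mF')
          \<comment> \<open>Under \<open>g\<close> the point \<open>a (- k) x\<close> sees the cell
            that \<open>x\<close> sees under \<open>k + g\<close>. Reindexing by \<open>k\<close>
            writes both token sets as images of sets of pairs under one map, so they can be compared
            mass by mass.\<close>
          have pk: "p g (a (- k) x) = p (k + g) x" for g
            by (simp only: p_def minus_add a_add)
          have "tok (Dt (a (- k) x)) = (\<lambda>(g, i). (p (k + g) x, i)) ` (SIGMA g:F. {..<m (a0 (- k) (\<pi> x)) g})"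
            unfolding tokDt mm_def eq pk ..
          also have "\<dots> = ?\<phi> ` ((\<lambda>(g, i). (k + g, i)) ` (SIGMA g:F. {..<m (a0 (- k) (\<pi> x)) g}))"
            unfolding image_image by (rule image_cong) auto
          also have "(\<lambda>(g, i). (k + g, i)) ` (SIGMA g:F. {..<m (a0 (- k) (\<pi> x)) g}) = (SIGMA g:?G. {..<?n1 g})"
          proof (intro set_eqI iffI)
            fix q assume "q \<in> (\<lambda>(g, i). (k + g, i)) ` (SIGMA g:F. {..<m (a0 (- k) (\<pi> x)) g})"
            then show "q \<in> (SIGMA g:?G. {..<?n1 g})" by (auto simp: add.assoc[symmetric])
          next
            fix q assume q: "q \<in> (SIGMA g:?G. {..<?n1 g})"
            then obtain g i where gi: "q = (g, i)" "i < ?n1 g" by auto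
            then have "- k + g \<in> F" by (intro mF')
            moreover have "q = (k + (- k + g), i)" using gi by (simp add: add.assoc[symmetric])
            ultimately show "q \<in> (\<lambda>(g, i). (k + g, i)) ` (SIGMA g:F. {..<m (a0 (- k) (\<pi> x)) g})"
              using gi by force
          qed
          finally have T1: "tok (Dt (a (- k) x)) = ?\<phi> ` (SIGMA g:?G. {..<?n1 g})" .
          have "rank_avg J (\<lambda>\<sigma>. of_bool (differ k \<sigma> x)) = rank_avg J (\<lambda>\<sigma>. of_bool (leader \<sigma> (tok (Dt x)) \<noteq> leader \<sigma> (tok (Dt (a (- k) x)))))"
            using True by (simp add: differ_def eq_commute)
          also have "\<dots> \<le> card ((tok (Dt x) - tok (Dt (a (- k) x))) \<union> (tok (Dt (a (- k) x)) - tok (Dt x))) / card (tok (Dt x))"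
            using tok[OF DtI] by (intro rank_avg_leader_neq J) auto
          also have "\<dots> \<le> (\<Sum>g\<in>?G. nat \<bar>int (mm x g) - int (?n1 g)\<bar>) / M"
            unfolding card_tok[OF True] unfolding T0 T1 using card_image_Sigma_diff[OF finG, of ?\<phi> "mm x" ?n1]
            by (intro divide_right_mono) (auto simp only: of_nat_le_iff of_nat_0_le_iff)
          also have "real (\<Sum>g\<in>?G. nat \<bar>int (mm x g) - int (?n1 g)\<bar>) = ?d (\<pi> x)"
            unfolding of_nat_sum mm_def by (intro sum.cong) auto
          finally show ?thesis .
        next
          case False
          then show ?thesis by (simp add: differ_def rank_avg_def sum_nonneg)
        qed
        have ind: "measure \<nu> {x. differ k \<sigma> x} = (\<integral>x. of_bool (differ k \<sigma> x) \<partial>\<nu>)"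
          and indint: "integrable \<nu> (\<lambda>x. of_bool (differ k \<sigma> x) :: real)" for \<sigma>
        proof -
          have "(\<lambda>x. of_bool (differ k \<sigma> x) :: real) = indicator {x. differ k \<sigma> x}" by (auto simp: indicator_def)
          then show "measure \<nu> {x. differ k \<sigma> x} = (\<integral>x. of_bool (differ k \<sigma> x) \<partial>\<nu>)"
            "integrable \<nu> (\<lambda>x. of_bool (differ k \<sigma> x) :: real)"
            using differm[of k \<sigma>] by (auto simp: emeasure_eq_measure)
        qed
        have intd: "integrable \<nu> (\<lambda>x. ?d (\<pi> x) / M)"
        proof -
          have "integrable \<nu> (\<lambda>x. ?d (\<pi> x))"
            using measurable_compose[OF measurable_\<pi> dm] d_bd by (intro integrable_const_bound[where B="card ?G * M"]) auto
          then show ?thesis by simp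
        qed
        have "rank_avg J (\<lambda>\<sigma>. measure \<nu> {x. differ k \<sigma> x}) = (\<integral>x. rank_avg J (\<lambda>\<sigma>. of_bool (differ k \<sigma> x)) \<partial>\<nu>)"
          unfolding ind rank_avg_def using indint by (simp add: Bochner_Integration.integral_sum)
        also have "\<dots> \<le> (\<integral>x. ?d (\<pi> x) / M \<partial>\<nu>)"
        proof (rule integral_mono_AE[OF _ intd])
          show "integrable \<nu> (\<lambda>x. rank_avg J (\<lambda>\<sigma>. of_bool (differ k \<sigma> x)))"
            unfolding rank_avg_def using indint by simp
          show "AE x in \<nu>. rank_avg J (\<lambda>\<sigma>. of_bool (differ k \<sigma> x)) \<le> ?d (\<pi> x) / M"
            using equivariant[rule_format, of "- k"] by (rule eventually_mono) (rule pt)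
        qed
        also have "\<dots> = (\<integral>x. ?d (\<pi> x) \<partial>\<nu>) / M" by simp
        also have "(\<integral>x. ?d (\<pi> x) \<partial>\<nu>) = (\<integral>b. ?d b \<partial>distr \<nu> B0 \<pi>)"
          using dm by (subst integral_distr[OF measurable_\<pi>]) auto
        also have "\<dots> = (\<integral>b. ?d b \<partial>B0)" unfolding distr_\<pi> ..
        also have "\<dots> / M \<le> (t * M) / M" using mK[OF k] by (intro divide_right_mono) auto
        finally show ?thesis using M by simp
      qed
      then have "(\<Sum>k\<in>K. rank_avg J (\<lambda>\<sigma>. measure \<nu> {x. differ k \<sigma> x})) \<le> (\<Sum>k\<in>K. t)" by (rule sum_mono)
      then show ?thesis unfolding bad_def rank_avg_sum by simp
    qed
    have "\<exists>\<sigma>\<in>rankings J. \<exists>y\<in>space (PiM J (\<lambda>_. \<eta>)). bad \<sigma> < \<epsilon>1 \<and>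
      (\<forall>A\<in>AA. \<bar>(\<Sum>D\<in>I. w D * indicator (E A D (leader \<sigma> (tok D))) (y (leader \<sigma> (tok D)))) - measure \<eta> A\<bar> < \<epsilon>1)"
      by (rule sampling_exists[OF p\<eta> J w0 w1 tok(1,2) E _ _ mean_bound overlap bad0 bad_avg \<epsilon>1 small AA(1)]) simp_all
    then obtain \<sigma> y where \<sigma>: "bad \<sigma> < \<epsilon>1" and y: "\<And>A. A \<in> AA \<Longrightarrow> \<bar>(\<Sum>D\<in>I. w D * indicator (E A D (leader \<sigma> (tok D))) (y (leader \<sigma> (tok D)))) - measure \<eta> A\<bar> < \<epsilon>1"
      by blast
    define L where "L D = leader \<sigma> (tok D)" for D
    \<comment> \<open>If \<open>x\<close> and \<open>a (- k) x\<close> have the same leader, reached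
      through \<open>g0\<close> and \<open>g1\<close>, then at a good \<open>x\<close> distinctness
      of the cells gives \<open>k + g1 = g0\<close>. So the value at \<open>a (- k) x\<close> is the
      sample at \<open>- g1 = - g0 + k\<close>, which is coordinate \<open>k\<close> of the sample
      shifted by \<open>g0\<close>.\<close>
    define f where "f x = y (L (Dt x)) (- gee (Dt x) (L (Dt x)))" for x
    have L: "L D \<in> tok D" if "D \<in> I" for D unfolding L_def using leader_in tok[OF that] by blast
    have fm: "f \<in> borel_measurable \<nu>"
      unfolding f_def by (rule measurable_compose[OF Dtm]) simp
    have "\<bar>measure \<nu> {x. (\<lambda>k. f (a (- k) x)) \<in> A} - measure \<eta> A\<bar> < \<epsilon>" if A: "A \<in> AA" for A
    proof -
      let ?S = "{x. shift_act (gee (Dt x) (L (Dt x))) (y (L (Dt x))) \<in> A}"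
      let ?T = "{x. (\<lambda>k. f (a (- k) x)) \<in> A}"
      let ?N = "{x. \<not> good x} \<union> (\<Union>k\<in>K. {x. differ k \<sigma> x})"
      have agree: "x \<in> ?S \<longleftrightarrow> x \<in> ?T" if x: "x \<notin> ?N" for x
      proof -
        have g: "good x" using x by simp
        have "f (a (- k) x) = shift_act (gee (Dt x) (L (Dt x))) (y (L (Dt x))) k" if k: "k \<in> K" for k
        proof -
          have Leq: "L (Dt (a (- k) x)) = L (Dt x)" using x g k by (auto simp: differ_def L_def)
          obtain P i where Pi: "L (Dt x) = (P, i)" by (cases "L (Dt x)")
          define g0 where "g0 = gee (Dt x) (P, i)"
          define g1 where "g1 = gee (Dt (a (- k) x)) (P, i)"
          have "(g0, i, P) \<in> Dt x" using gee[OF L[OF DtI[of x]]] Pi by (simp add: g0_def)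
          then have 0: "g0 \<in> F" "P = p g0 x" by (auto simp: mem)
          have "(g1, i, P) \<in> Dt (a (- k) x)" using gee[OF L[OF DtI[of "a (- k) x"]]] Pi Leq by (simp add: g1_def)
          then have 1: "g1 \<in> F" "P = p g1 (a (- k) x)" by (auto simp: mem)
          have "p g1 (a (- k) x) = p (k + g1) x" by (simp only: p_def minus_add a_add)
          then have "p (k + g1) x = p g0 x" using 0 1 by simp
          then have "k + g1 = g0" using g W(2) W(3)[OF k 1(1)] 0(1) unfolding good_def by (metis inj_onD subsetD)
          then have "- g1 = - g0 + k" by (metis add.assoc add_minus_cancel minus_add minus_minus add.left_neutral left_minus)
          then show ?thesis unfolding f_def Leq Pi by (simp add: shift_act_def g0_def[symmetric] g1_def[symmetric])
        qed
        then have "(\<lambda>k. f (a (- k) x)) \<in> A \<longleftrightarrow> shift_act (gee (Dt x) (L (Dt x))) (y (L (Dt x))) \<in> A"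
          by (rule local[OF A])
        then show ?thesis by simp
      qed
      have Sm: "?S \<in> sets \<nu>"
      proof -
        have "Measurable.pred \<nu> (\<lambda>x. shift_act (gee (Dt x) (L (Dt x))) (y (L (Dt x))) \<in> A)"
          by (rule measurable_compose[OF Dtm]) simp
        then show ?thesis by (simp add: pred_def)
      qed
      have Tm: "?T \<in> sets \<nu>"
      proof -
        have "(\<lambda>x k. f (a (- k) x)) \<in> borel_measurable \<nu>"
          by (rule measurable_coordinatewise_then_product) (rule measurable_compose[OF measurable_a fm])
        from measurable_sets[OF this AA(2)[OF A]] show ?thesis by (simp add: vimage_def)
      qed
      have gm: "{x. \<not> good x} \<in> sets \<nu>"
      proof -
        have "{x \<in> space \<nu>. \<not> good x} \<in> sets \<nu>" by measurable
        then show ?thesis by simp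
      qed
      have Nm: "?N \<in> sets \<nu>" using gm differm K by auto
      have mN: "measure \<nu> ?N < t + \<epsilon>1"
      proof -
        have "measure \<nu> ?N \<le> measure \<nu> {x. \<not> good x} + measure \<nu> (\<Union>k\<in>K. {x. differ k \<sigma> x})"
          using gm differm K by (intro measure_Un_le) auto
        also have "measure \<nu> (\<Union>k\<in>K. {x. differ k \<sigma> x}) \<le> bad \<sigma>"
          unfolding bad_def using differm K by (intro finite_measure_subadditive_finite) auto
        finally show ?thesis using bad_t \<sigma> by simp
      qed
      have "measure \<nu> ?T \<le> measure \<nu> (?S \<union> ?N)"
        using agree by (intro finite_measure_mono sets.Un Sm Nm) blast
      also have "\<dots> \<le> measure \<nu> ?S + measure \<nu> ?N" by (rule measure_Un_le[OF Sm Nm])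
      finally have 1: "measure \<nu> ?T \<le> measure \<nu> ?S + measure \<nu> ?N" .
      have "measure \<nu> ?S \<le> measure \<nu> (?T \<union> ?N)"
        using agree by (intro finite_measure_mono sets.Un Tm Nm) blast
      also have "\<dots> \<le> measure \<nu> ?T + measure \<nu> ?N" by (rule measure_Un_le[OF Tm Nm])
      finally have 2: "measure \<nu> ?S \<le> measure \<nu> ?T + measure \<nu> ?N" .
      have "measure \<nu> ?S = (\<integral>x. indicator ?S x \<partial>\<nu>)" using Sm by simp
      also have "\<dots> = (\<integral>x. (\<lambda>D. indicator (E A D (L D)) (y (L D))) (Dt x) \<partial>\<nu>)"
        by (intro Bochner_Integration.integral_cong) (auto simp: E_def indicator_def sp\<eta>)
      also have "\<dots> = (\<Sum>D\<in>I. w D * indicator (E A D (L D)) (y (L D)))" by (rule fin_range(1))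
      finally have "\<bar>measure \<nu> ?S - measure \<eta> A\<bar> < \<epsilon>1" using y[OF A] by (simp add: L_def)
      then show ?thesis using 1 2 mN t(3) unfolding \<epsilon>1_def by linarith
    qed
    then show ?thesis using fm by blast
  qed
qed

end

section \<open>Density\<close>

definition cylinder :: "'g set \<Rightarrow> nat \<Rightarrow> ('g \<Rightarrow> nat \<Rightarrow> bool) \<Rightarrow> ('g \<Rightarrow> nat \<Rightarrow> bool) set" where
  "cylinder K n x = {z. \<forall>k\<in>K. \<forall>i<n. z k i = x k i}"

lemma open_cylinder: "finite K \<Longrightarrow> open (cylinder K n x)"
proof -
  assume K: "finite K"
  have "open {z :: 'a \<Rightarrow> nat \<Rightarrow> bool. z k i = x k i}" for k i
  proof -
    have "continuous_on UNIV (\<lambda>z :: 'a \<Rightarrow> nat \<Rightarrow> bool. z k i)"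
      by (rule continuous_on_compose2[OF continuous_on_product_coordinates continuous_on_product_coordinates]) simp
    from open_vimage[OF discrete_topology_class.open_discrete this, of "{x k i}"]
    show ?thesis by (simp add: vimage_def)
  qed
  then have "open (\<Inter>k\<in>K. \<Inter>i\<in>{..<n}. {z. z k i = x k i})"
    using K by (intro open_INT) auto
  also have "(\<Inter>k\<in>K. \<Inter>i\<in>{..<n}. {z. z k i = x k i}) = cylinder K n x"
    by (auto simp: cylinder_def)
  finally show ?thesis .
qed

lemma open_fun_contains_box:
  fixes x :: "'i \<Rightarrow> 'a::topological_space"
  assumes "open U" "x \<in> U"
  shows "\<exists>X. (\<forall>i. open (X i) \<and> x i \<in> X i) \<and> finite {i. X i \<noteq> UNIV} \<and> (\<forall>z. (\<forall>i. z i \<in> X i) \<longrightarrow> z \<in> U)"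
proof -
  have "openin (product_topology (\<lambda>i. euclidean) UNIV) U" using assms by (simp add: open_fun_def)
  from product_topology_open_contains_basis[OF this assms(2)]
  obtain X where "x \<in> Pi\<^sub>E UNIV X" "\<And>i. open (X i)" "finite {i. X i \<noteq> UNIV}" "Pi\<^sub>E UNIV X \<subseteq> U"
    by auto
  then show ?thesis by (intro exI[of _ X]) (auto simp: PiE_UNIV_domain)
qed

lemma open_contains_cylinder:
  fixes x :: "'g \<Rightarrow> nat \<Rightarrow> bool"
  assumes "open U" "x \<in> U"
  shows "\<exists>K n. finite K \<and> cylinder K n x \<subseteq> U"
proof -
  obtain X where X: "\<And>k. open (X k)" "\<And>k. x k \<in> X k" "finite {k. X k \<noteq> UNIV}" "\<And>z. (\<forall>k. z k \<in> X k) \<Longrightarrow> z \<in> U"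
    using open_fun_contains_box[OF assms] by blast
  have "\<exists>n. \<forall>w. (\<forall>i<n. w i = x k i) \<longrightarrow> w \<in> X k" for k
  proof -
    obtain Y where Y: "\<And>i. open (Y i)" "\<And>i. x k i \<in> Y i" "finite {i. Y i \<noteq> UNIV}" "\<And>w. (\<forall>i. w i \<in> Y i) \<Longrightarrow> w \<in> X k"
      using open_fun_contains_box[OF X(1,2)[of k]] by blast
    obtain n where n: "\<And>i. Y i \<noteq> UNIV \<Longrightarrow> i < n"
      using finite_nat_set_iff_bounded[THEN iffD1, OF Y(3)] by auto
    have "w \<in> X k" if "\<forall>i<n. w i = x k i" for w
    proof (rule Y(4), rule allI)
      show "w i \<in> Y i" for i using n[of i] Y(2)[of i] that by (cases "Y i = UNIV") auto
    qed
    then show ?thesis by blast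
  qed
  then obtain n where n: "\<And>k w. (\<forall>i<n k. w i = x k i) \<Longrightarrow> w \<in> X k" by metis
  let ?K = "{k. X k \<noteq> UNIV}" let ?n = "\<Sum>k\<in>{k. X k \<noteq> UNIV}. n k"
  have "cylinder ?K ?n x \<subseteq> U"
  proof
    fix z assume z: "z \<in> cylinder ?K ?n x"
    show "z \<in> U"
    proof (rule X(4), rule allI)
      fix k
      show "z k \<in> X k"
      proof (cases "X k = UNIV")
        case False
        then have "n k \<le> ?n" using X(3) by (intro member_le_sum) auto
        then show ?thesis using z False by (intro n) (auto simp: cylinder_def)
      qed simp
    qed
  qed
  then show ?thesis using X(3) by blast
qed

lemma compact_UNIV_cantor_pow: "compact (UNIV :: ('g \<Rightarrow> nat \<Rightarrow> bool) set)"
proof -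
  have fun_compact: "compact (UNIV :: ('i \<Rightarrow> 'a) set)" if "compact (UNIV :: 'a::topological_space set)"
  proof -
    have "compact_space (euclidean :: 'a topology)" using that by (simp add: compact_space_def)
    then have "compact_space (product_topology (\<lambda>i::'i. euclidean :: 'a topology) UNIV)"
      by (simp add: compact_space_product_topology)
    then show ?thesis by (simp add: euclidean_product_topology compact_space_def)
  qed
  show ?thesis by (intro fun_compact finite_imp_compact) simp
qed

text \<open>Uniform continuity on a compact space: every point has a cylinder on which
  \<open>f\<close> stays within e/2 of its value there, a finite subcover yields common
  \<open>K\<close> and \<open>n\<close>, and two points are compared through the centre of a
  covering cylinder.\<close>

lemma continuous_cylinder_approx:
  fixes f :: "('g \<Rightarrow> nat \<Rightarrow> bool) \<Rightarrow> real"
  assumes cont: "continuous_on UNIV f" and "e > 0"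
  shows "\<exists>K n. finite K \<and> (\<forall>x y. y \<in> cylinder K n x \<longrightarrow> \<bar>f y - f x\<bar> < e)"
proof -
  have "\<exists>K n. finite K \<and> cylinder K n x \<subseteq> {z. \<bar>f z - f x\<bar> < e / 2}" for x
  proof (rule open_contains_cylinder)
    have "open ((\<lambda>z. \<bar>f z - f x\<bar>) -` {..<e / 2})"
      by (intro open_vimage continuous_intros cont)
    then show "open {z. \<bar>f z - f x\<bar> < e / 2}" by (simp add: vimage_def)
  qed (use \<open>e > 0\<close> in simp)
  then obtain K n where Kn: "\<And>x. finite (K x)" "\<And>x z. z \<in> cylinder (K x) (n x) x \<Longrightarrow> \<bar>f z - f x\<bar> < e / 2"
    by (metis (mono_tags, lifting) mem_Collect_eq subsetD)
  obtain S where S: "finite S" "UNIV \<subseteq> (\<Union>x\<in>S. cylinder (K x) (n x) x)"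
  proof (rule compactE_image[OF compact_UNIV_cantor_pow])
    show "open (cylinder (K x) (n x) x)" for x by (rule open_cylinder[OF Kn(1)])
    show "(UNIV :: ('g \<Rightarrow> nat \<Rightarrow> bool) set) \<subseteq> (\<Union>x\<in>UNIV. cylinder (K x) (n x) x)" by (auto simp: cylinder_def)
  qed auto
  let ?K = "\<Union>x\<in>S. K x" and ?n = "\<Sum>x\<in>S. n x"
  have "\<bar>f y - f x\<bar> < e" if y: "y \<in> cylinder ?K ?n x" for x y
  proof -
    obtain s where s: "s \<in> S" "x \<in> cylinder (K s) (n s) s" using S(2) by blast
    have "n s \<le> ?n" using S(1) s(1) by (intro member_le_sum) auto
    then have "y \<in> cylinder (K s) (n s) s" using y s by (force simp: cylinder_def)
    then have "\<bar>f y - f s\<bar> < e / 2" "\<bar>f x - f s\<bar> < e / 2" using Kn(2) s(2) by blast+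
    then show ?thesis by linarith
  qed
  then show ?thesis using S(1) Kn(1) by (intro exI[of _ ?K] exI[of _ ?n]) auto
qed

lemma continuous_cylinder_approx_finite:
  fixes FF :: "(('g \<Rightarrow> nat \<Rightarrow> bool) \<Rightarrow> real) set"
  assumes "finite FF" "\<And>f. f \<in> FF \<Longrightarrow> continuous_on UNIV f" and "e > 0"
  shows "\<exists>K n. finite K \<and> (\<forall>f\<in>FF. \<forall>x y. y \<in> cylinder K n x \<longrightarrow> \<bar>f y - f x\<bar> < e)"
proof -
  have "\<exists>K n. finite K \<and> (\<forall>x y. y \<in> cylinder K n x \<longrightarrow> \<bar>f y - f x\<bar> < e)" if "f \<in> FF" for f
    using continuous_cylinder_approx[OF assms(2)[OF that] assms(3)] .
  then obtain K n where Kn: "\<And>f. f \<in> FF \<Longrightarrow> finite (K f)"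
    "\<And>f x y. f \<in> FF \<Longrightarrow> y \<in> cylinder (K f) (n f) x \<Longrightarrow> \<bar>f y - f x\<bar> < e" by metis
  let ?K = "\<Union>f\<in>FF. K f" and ?n = "\<Sum>f\<in>FF. n f"
  have "\<bar>f y - f x\<bar> < e" if f: "f \<in> FF" and y: "y \<in> cylinder ?K ?n x" for f x y
  proof (rule Kn(2)[OF f])
    have "n f \<le> ?n" using assms(1) f by (intro member_le_sum) auto
    then show "y \<in> cylinder (K f) (n f) x" using y f by (force simp: cylinder_def)
  qed
  then show ?thesis using Kn(1) assms(1) by (intro exI[of _ ?K] exI[of _ ?n]) auto
qed

section \<open>Orbit maps and the laws they induce\<close>

context free_extension
begin

definition orbit_map :: "('b \<Rightarrow> 'x) \<Rightarrow> 'b \<Rightarrow> 'g \<Rightarrow> 'x" where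
  "orbit_map f x = (\<lambda>k. f (a (- k) x))"

lemma orbit_map_equivariant: "orbit_map f (a g x) = shift_act g (orbit_map f x)"
  by (simp only: orbit_map_def shift_act_def minus_add minus_minus a_add)

lemma measurable_orbit_map:
  "f \<in> borel_measurable \<nu> \<Longrightarrow> orbit_map f \<in> borel_measurable \<nu>" for f :: "'b \<Rightarrow> nat \<Rightarrow> bool"
  unfolding orbit_map_def[abs_def]
  by (rule measurable_coordinatewise_then_product) (rule measurable_compose[OF measurable_a])

lemma orbit_map_stationary:
  fixes f :: "'b \<Rightarrow> nat \<Rightarrow> bool"
  assumes f: "f \<in> borel_measurable \<nu>"
  shows "distr \<nu> borel (orbit_map f) \<in> stationary_measures \<mu>"
proof -
  interpret prob_space \<nu> by (rule prob_space_\<nu>)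
  note m = measurable_orbit_map[OF f]
  have "emeasure (distr \<nu> borel (orbit_map f)) A =
      (\<integral>\<^sup>+g. emeasure (distr \<nu> borel (orbit_map f)) {x. shift_act g x \<in> A} \<partial>measure_pmf \<mu>)"
    if A: "A \<in> sets borel" for A
  proof -
    have s: "orbit_map f -` A \<in> sets \<nu>" using measurable_sets[OF m A] by simp
    have "{x. shift_act g x \<in> A} \<in> sets borel" for g :: 'g
      using measurable_sets[OF measurable_shift_act A, of g] by (simp add: vimage_def)
    then have e: "emeasure (distr \<nu> borel (orbit_map f)) {x. shift_act g x \<in> A} = emeasure \<nu> {x. a g x \<in> orbit_map f -` A}" for g
      using m by (simp add: emeasure_distr vimage_def orbit_map_equivariant)
    have "emeasure \<nu> (orbit_map f -` A) = (\<integral>\<^sup>+g. emeasure \<nu> {x \<in> space \<nu>. a g x \<in> orbit_map f -` A} \<partial>measure_pmf \<mu>)"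
      using stationary_\<nu> s unfolding stationary_def by blast
    then show ?thesis unfolding e using A m by (simp add: emeasure_distr)
  qed
  then show ?thesis
    using prob_space_distr[OF m] by (simp add: stationary_measures_def stationary_def)
qed

text \<open>The identity coordinate of the orbit map at \<open>x\<close> is \<open>f x\<close>, from
  which \<open>d\<close> recovers \<open>x\<close>. The set of \<open>y\<close> that are restored by
  \<open>orbit_map f\<close> is Borel and contains all orbits, so it has full measure without any
  claim about the image of \<open>orbit_map f\<close>.\<close>

lemma orbit_map_conjugate:
  fixes f :: "'b \<Rightarrow> nat \<Rightarrow> bool"
  assumes f: "f \<in> borel_measurable \<nu>" and d: "d \<in> borel_measurable borel" and df: "\<And>x. d (f x) = x"
  shows "measurably_conjugate (distr \<nu> borel (orbit_map f)) shift_act \<nu> a"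
proof -
  let ?\<eta> = "distr \<nu> borel (orbit_map f)"
  note m = measurable_orbit_map[OF f]
  define \<phi> where "\<phi> y = d (y (0::'g))" for y :: "'g \<Rightarrow> nat \<Rightarrow> bool"
  have \<phi>b: "\<phi> \<in> measurable borel borel"
    unfolding \<phi>_def by (rule measurable_compose[OF measurable_product_coordinates d])
  then have \<phi>\<nu>: "\<phi> \<in> measurable borel \<nu>" using measurable_cong_sets[OF refl sets_\<nu>] by blast
  have inv: "\<phi> (orbit_map f x) = x" for x by (simp add: \<phi>_def orbit_map_def df)
  have comp: "(\<lambda>y. orbit_map f (\<phi> y)) \<in> borel_measurable borel"
    by (rule measurable_compose[OF \<phi>\<nu> m])
  have s: "{y. orbit_map f (\<phi> y) = y} \<in> sets borel"
  proof -
    have [measurable]: "Measurable.pred borel (\<lambda>y. orbit_map f (\<phi> y) k i)"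
        "Measurable.pred borel (\<lambda>y :: 'g \<Rightarrow> nat \<Rightarrow> bool. y k i)" for k i
      using measurable_compose[OF measurable_compose[OF comp measurable_product_coordinates[of k]] measurable_product_coordinates[of i]]
        measurable_compose[OF measurable_product_coordinates[of k] measurable_product_coordinates[of i]]
      by (auto intro: borel_measurable_imp_pred)
    have "{y \<in> space borel. \<forall>k i. orbit_map f (\<phi> y) k i = y k i} \<in> sets borel" by measurable
    then show ?thesis by (simp add: fun_eq_iff)
  qed
  have AE: "AE y in ?\<eta>. orbit_map f (\<phi> y) = y"
    using s by (subst AE_distr_iff[OF m]) (auto simp: inv)
  show ?thesis unfolding measurably_conjugate_def
  proof (intro exI[of _ \<phi>] exI[of _ "orbit_map f"] conjI allI)
    show "\<phi> \<in> measurable ?\<eta> \<nu>" using \<phi>\<nu> by simp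
    show "orbit_map f \<in> measurable \<nu> ?\<eta>" using m by simp
    show "AE x in ?\<eta>. orbit_map f (\<phi> x) = x" by (rule AE)
    show "AE y in \<nu>. \<phi> (orbit_map f y) = y" by (simp add: inv)
    have "distr ?\<eta> \<nu> \<phi> = distr \<nu> \<nu> (\<lambda>x. \<phi> (orbit_map f x))"
      by (subst distr_distr[OF \<phi>\<nu> m]) (simp add: o_def)
    then show "distr ?\<eta> \<nu> \<phi> = \<nu>" by (simp add: inv distr_id)
    show "distr \<nu> ?\<eta> (orbit_map f) = ?\<eta>" by (rule distr_cong) simp_all
    show "AE x in ?\<eta>. \<phi> (shift_act g x) = a g (\<phi> x)" for g
      using AE
    proof (rule eventually_mono)
      fix y assume y: "orbit_map f (\<phi> y) = y"
      have "shift_act g y = orbit_map f (a g (\<phi> y))" by (simp add: orbit_map_equivariant y)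
      then show "\<phi> (shift_act g y) = a g (\<phi> y)" by (simp add: inv)
    qed
  qed
qed

lemma conjugates_dense:
  "weak_star_dense_in {\<eta> \<in> stationary_measures \<mu>. measurably_conjugate \<eta> shift_act \<nu> a} (stationary_measures \<mu>)"
  unfolding weak_star_dense_in_def
proof (intro ballI allI impI)
  fix \<eta> :: "('g \<Rightarrow> nat \<Rightarrow> bool) measure" and FF :: "(('g \<Rightarrow> nat \<Rightarrow> bool) \<Rightarrow> real) set" and \<epsilon> :: real
  assume \<eta>: "\<eta> \<in> stationary_measures \<mu>" and FF: "finite FF" and cont: "\<forall>f\<in>FF. continuous_on UNIV f" and \<epsilon>: "\<epsilon> > 0"
  interpret prob_space \<nu> by (rule prob_space_\<nu>)
  have s\<eta>: "sets \<eta> = sets borel" and p\<eta>: "prob_space \<eta>" using \<eta> by (auto simp: stationary_measures_def)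
  obtain K n where K: "finite K" and approx: "\<And>h x y. h \<in> FF \<Longrightarrow> y \<in> cylinder K n x \<Longrightarrow> \<bar>h y - h x\<bar> < \<epsilon> / 4"
  proof -
    have "0 < \<epsilon> / 4" using \<epsilon> by simp
    from continuous_cylinder_approx_finite[OF FF cont[rule_format] this] that show ?thesis by blast
  qed
  define pats where "pats = Pow (K \<times> {..<n})"
  \<comment> \<open>The point of the cylinder with pattern \<open>P\<close> whose other bits are all
    False; the test functions are evaluated there.\<close>
  define rep where "rep P = (\<lambda>k i. (k, i) \<in> P)" for P :: "('g \<times> nat) set"
  define pat where "pat y = {q \<in> K \<times> {..<n}. y (fst q) (snd q)}" for y :: "'g \<Rightarrow> nat \<Rightarrow> bool"
  have fin: "finite pats" using K by (simp add: pats_def)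
  have pat_in: "pat y \<in> pats" for y by (auto simp: pat_def pats_def)
  have cyl: "y \<in> cylinder K n (rep P) \<longleftrightarrow> pat y = P" if "P \<in> pats" for y P
    using that by (auto simp: cylinder_def rep_def pat_def pats_def)
  \<comment> \<open>Bounds, for every test function, the total weight with which cylinder errors
    enter its integral; the summand 1 keeps the divisor \<open>4 * c\<close> positive.\<close>
  define c where "c = 1 + (\<Sum>h\<in>FF. \<Sum>P\<in>pats. \<bar>h (rep P)\<bar>)"
  have c1: "c \<ge> 1" unfolding c_def by (simp add: sum_nonneg)
  have c: "(\<Sum>P\<in>pats. \<bar>h (rep P)\<bar>) \<le> c" if "h \<in> FF" for h
  proof -
    have "(\<Sum>P\<in>pats. \<bar>h (rep P)\<bar>) \<le> (\<Sum>h\<in>FF. \<Sum>P\<in>pats. \<bar>h (rep P)\<bar>)"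
      using that FF by (intro member_le_sum) (auto intro: sum_nonneg)
    then show ?thesis by (simp add: c_def)
  qed
  define AA where "AA = (\<lambda>P. cylinder K n (rep P)) ` pats"
  have "\<exists>f\<in>borel_measurable \<nu>. \<forall>A\<in>AA. \<bar>measure \<nu> {x. (\<lambda>k. f (a (- k) x)) \<in> A} - measure \<eta> A\<bar> < \<epsilon> / (4 * c)"
  proof (rule approximating_factor[OF \<eta> K])
    show "finite AA" using fin by (simp add: AA_def)
    show "A \<in> sets borel" if "A \<in> AA" for A using that open_cylinder[OF K] by (auto simp: AA_def)
    show "y \<in> A \<longleftrightarrow> y' \<in> A" if "A \<in> AA" "\<And>k. k \<in> K \<Longrightarrow> y k = y' k" for A y y'
      using that by (auto simp: AA_def cylinder_def)
    show "0 < \<epsilon> / (4 * c)" using \<epsilon> c1 by simp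
  qed
  then obtain f0 where f0: "f0 \<in> borel_measurable \<nu>"
    "\<And>P. P \<in> pats \<Longrightarrow> \<bar>measure \<nu> {x. (\<lambda>k. f0 (a (- k) x)) \<in> cylinder K n (rep P)} - measure \<eta> (cylinder K n (rep P))\<bar> < \<epsilon> / (4 * c)"
    unfolding AA_def by blast
  obtain code :: "'b \<Rightarrow> nat \<Rightarrow> bool" and decode where code: "code \<in> borel_measurable borel" "decode \<in> borel_measurable borel" "\<And>x. decode (code x) = x"
    using borel_code_exists by blast
  \<comment> \<open>The cylinders see only the first \<open>n\<close> bits. Moving the code up by
    \<open>n\<close> places gives \<open>f\<close> the Borel left inverse \<open>d\<close> without
    changing them.\<close>
  define f where "f x i = (if i < n then f0 x i else code x (i - n))" for x i
  define d where "d y = decode (\<lambda>i. y (i + n))" for y :: "nat \<Rightarrow> bool"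
  have fm: "f \<in> borel_measurable \<nu>"
  proof (rule measurable_coordinatewise_then_product)
    fix i
    have "(\<lambda>x. f0 x i) \<in> borel_measurable \<nu>" by (rule measurable_compose[OF f0(1) measurable_product_coordinates])
    moreover have "(\<lambda>x. code x (i - n)) \<in> borel_measurable \<nu>"
      using measurable_compose[OF code(1) measurable_product_coordinates] measurable_cong_sets[OF sets_\<nu> refl] by blast
    ultimately show "(\<lambda>x. f x i) \<in> borel_measurable \<nu>" unfolding f_def by (cases "i < n") simp_all
  qed
  have dm: "d \<in> borel_measurable borel"
    unfolding d_def
    by (rule measurable_compose[OF _ code(2)]) (rule measurable_coordinatewise_then_product, rule measurable_product_coordinates)
  have df: "d (f x) = x" for x by (simp add: d_def f_def code(3))
  let ?\<eta>' = "distr \<nu> borel (orbit_map f)"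
  note m = measurable_orbit_map[OF fm]
  have in_cyl: "orbit_map f x \<in> cylinder K n y \<longleftrightarrow> (\<lambda>k. f0 (a (- k) x)) \<in> cylinder K n y" for x y
    by (simp add: cylinder_def orbit_map_def f_def)
  have cylm: "cylinder K n y \<in> sets borel" for y using open_cylinder[OF K] by simp
  have close: "\<bar>measure ?\<eta>' (cylinder K n (rep P)) - measure \<eta> (cylinder K n (rep P))\<bar> < \<epsilon> / (4 * c)" if "P \<in> pats" for P
    using f0(2)[OF that] by (simp add: measure_distr[OF m cylm] vimage_def in_cyl)
  have "\<bar>(\<integral>x. h x \<partial>?\<eta>') - (\<integral>x. h x \<partial>\<eta>)\<bar> < \<epsilon>" if h: "h \<in> FF" for h
  proof -
    let ?H = "\<lambda>y. \<Sum>P\<in>pats. h (rep P) * indicator (cylinder K n (rep P)) y"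
    have H: "?H y = h (rep (pat y))" for y
    proof -
      have "?H y = (\<Sum>P\<in>pats. if pat y = P then h (rep P) else 0)"
        using cyl by (intro sum.cong) (auto simp: indicator_def)
      then show ?thesis using pat_in[of y] fin by simp
    qed
    have hH: "\<bar>h y - ?H y\<bar> \<le> \<epsilon> / 4" for y
    proof -
      have "y \<in> cylinder K n (rep (pat y))" using cyl[OF pat_in, of y y] by simp
      from approx[OF h this] show ?thesis unfolding H by simp
    qed
    \<comment> \<open>Used for both measures: two replacements of \<open>h\<close> by its step
      function and the errors of the cylinder probabilities cost at most \<epsilon>/4 each.\<close>
    have step: "\<bar>(\<integral>x. h x \<partial>N) - (\<Sum>P\<in>pats. h (rep P) * measure N (cylinder K n (rep P)))\<bar> \<le> \<epsilon> / 4"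
      if N: "prob_space N" "sets N = sets borel" for N
    proof -
      interpret N: prob_space N by fact
      have hm: "h \<in> borel_measurable N"
        using borel_measurable_continuous_onI[of h] cont h measurable_cong_sets[OF N(2) refl] by blast
      have cm: "cylinder K n y \<in> sets N" for y using cylm N(2) by simp
      have intH: "integrable N ?H"
        using cm by (intro Bochner_Integration.integrable_sum integrable_mult_right) (auto simp: N.emeasure_eq_measure)
      have intd: "integrable N (\<lambda>y. h y - ?H y)"
        using hH hm borel_measurable_integrable[OF intH] by (intro N.integrable_const_bound[where B="\<epsilon> / 4"]) auto
      have inth: "integrable N h"
        using Bochner_Integration.integrable_add[OF intd intH] by simp
      have "(\<integral>y. ?H y \<partial>N) = (\<Sum>P\<in>pats. h (rep P) * measure N (cylinder K n (rep P)))"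
        using cm by (subst Bochner_Integration.integral_sum) (auto simp: N.emeasure_eq_measure)
      then have "(\<integral>x. h x \<partial>N) - (\<Sum>P\<in>pats. h (rep P) * measure N (cylinder K n (rep P))) = (\<integral>y. h y - ?H y \<partial>N)"
        using inth intH by simp
      also have "\<bar>\<dots>\<bar> \<le> (\<integral>y. \<bar>h y - ?H y\<bar> \<partial>N)" by (rule integral_abs_bound)
      also have "\<dots> \<le> (\<integral>y. \<epsilon> / 4 \<partial>N)"
        by (rule integral_mono[OF integrable_abs[OF intd] _ hH]) simp
      finally show ?thesis by (simp add: N.prob_space)
    qed
    have "\<bar>(\<Sum>P\<in>pats. h (rep P) * measure ?\<eta>' (cylinder K n (rep P))) - (\<Sum>P\<in>pats. h (rep P) * measure \<eta> (cylinder K n (rep P)))\<bar>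
      = \<bar>\<Sum>P\<in>pats. h (rep P) * (measure ?\<eta>' (cylinder K n (rep P)) - measure \<eta> (cylinder K n (rep P)))\<bar>"
      by (simp add: sum_subtractf right_diff_distrib)
    also have "\<dots> \<le> (\<Sum>P\<in>pats. \<bar>h (rep P)\<bar> * (\<epsilon> / (4 * c)))"
      by (rule order_trans[OF sum_abs sum_mono], unfold abs_mult)
        (intro mult_left_mono less_imp_le[OF close] abs_ge_zero)
    also have "\<dots> = (\<Sum>P\<in>pats. \<bar>h (rep P)\<bar>) * (\<epsilon> / (4 * c))" by (rule sum_distrib_right[symmetric])
    also have "\<dots> \<le> c * (\<epsilon> / (4 * c))" using c1 \<epsilon> by (intro mult_right_mono c[OF h]) auto
    also have "\<dots> = \<epsilon> / 4" using c1 by simp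
    finally show ?thesis
      using step[OF prob_space_distr[OF m] sets_distr] step[OF p\<eta> s\<eta>] \<epsilon> by linarith
  qed
  moreover have "?\<eta>' \<in> {\<eta> \<in> stationary_measures \<mu>. measurably_conjugate \<eta> shift_act \<nu> a}"
    using orbit_map_stationary[OF fm] orbit_map_conjugate[OF fm dm df] by simp
  ultimately show "\<exists>\<eta>'\<in>{\<eta> \<in> stationary_measures \<mu>. measurably_conjugate \<eta> shift_act \<nu> a}.
      \<forall>f\<in>FF. \<bar>(\<integral>x. f x \<partial>\<eta>') - (\<integral>x. f x \<partial>\<eta>)\<bar> < \<epsilon>"
    by blast
qed

end

theorem theorem4p2:
  fixes \<mu> :: "'g::{group_add, countable} pmf"
    and B0 :: "'c::polish_space measure" and a0 :: "'g \<Rightarrow> 'c \<Rightarrow> 'c"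
    and bnd :: "(nat \<Rightarrow> 'g) \<Rightarrow> 'c"
    and \<nu> :: "'b::polish_space measure" and a :: "'g \<Rightarrow> 'b \<Rightarrow> 'b"
    and \<pi> :: "'b \<Rightarrow> 'c"
  assumes "infinite (UNIV :: 'g set)"
    and "semigroup_gen (set_pmf \<mu>) = UNIV"
    and "poisson_boundary \<mu> B0 a0 bnd"
    and "sets \<nu> = sets borel" and "prob_space \<nu>" and "measurable_action \<nu> a"
    and "stationary \<mu> \<nu> a"
    and "essentially_free \<nu> a"
    and "\<pi> \<in> measurable \<nu> B0"
    and "\<forall>g. AE x in \<nu>. \<pi> (a g x) = a0 g (\<pi> x)"
    and "distr \<nu> B0 \<pi> = B0"
  shows "weak_star_dense_in
           {\<eta> \<in> stationary_measures \<mu>. measurably_conjugate \<eta> shift_act \<nu> a}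
           (stationary_measures \<mu>)"
proof -
  interpret free_extension \<mu> B0 a0 bnd \<nu> a \<pi>
    by (intro free_extension.intro free_extension_axioms.intro poisson_space.intro assms)
  show ?thesis by (rule conjugates_dense)
qed

end
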